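(* For any fixed integers $i\ge 0$, $d\ge 1$, $g\ge 0$, the assignment $G\mapsto H^i(\mathrm{Conf}(\mathcal{L}^c(G),\mathbb{C}^d);\mathbb{Z})$ defines a finitely generated $\mathcal{G}_{\le g}^{\mathrm{op}}$-module over $\mathbb{Z}$.
   Context: Graphs. A graph is a quintuple $G=(V,A,h,t,\sigma)$ where $V,A$ are finite sets (vertices and arrows), $h,t:A\to V$ are maps (head and tail), and $\sigma$ is a fixed-point-free involution of $A$ with $h=t\circ\sigma$. Its edges are the elements of $E(G)=A/\sigma$. "Connected" has its usual meaning; a tree is a nonempty connected graph without cycles (loops and pairs of parallel edges count as cycles). Minor morphisms. A minor morphism from $G=(V,A,h,t,\sigma)$ to $G'=(V',A',h',t',\sigma')$ is a map $\varphi:V\sqcup A\sqcup\{\star\}\to V'\sqcup A'\sqcup\{\star\}$ such that: $\varphi(\star)=\star$; $\varphi(v)\in V'$ for every $v\in V$; $\varphi(\sigma(a))=\sigma'(\varphi(a))$ for every $a\in A$, where $\sigma'$ acts trivially on $V'\sqcup\{\star\}$; for every $a'\in A'$ there is a unique $a\in A$ with $\varphi(a)=a'$; if $\varphi(a)\in A'$ then $\varphi(h(a))=h'(\varphi(a))$ and $\varphi(t(a))=t'(\varphi(a))$; if $\varphi(a)\in V'$ then $\varphi(h(a))=\varphi(a)=\varphi(t(a))$; for every $v'\in V'$, the set $\varphi^{-1}(v')$ consists of the edges (arrows) and vertices of a tree. Minor morphisms compose as functions. A minor morphism $\varphi:G\to G'$ induces an injection $\varphi^*:E(G')\to E(G)$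 sending an edge of $G'$ to the unique edge of $G$ mapping to it. Category. The genus of $G$ is $|E(G)|-|V|+1$. $\mathcal{G}_{\le g}$ is the category whose objects are nonempty connected graphs of genus at most $g$ and whose morphisms are minor morphisms. Modules. A $\mathcal{G}_{\le g}^{\mathrm{op}}$-module over $\mathbb{Z}$ is a functor $M$ from $\mathcal{G}_{\le g}^{\mathrm{op}}$ to abelian groups; a minor morphism $\varphi:G\to G'$ induces $M(\varphi):M(G')\to M(G)$. $M$ is finitely generated if there is a finite list of graphs $G_1,\dots,G_r$ in $\mathcal{G}_{\le g}$ such that each $M(G_j)$ is finitely generated and, for every $G$ in $\mathcal{G}_{\le g}$, $M(G)$ is spanned by the images of the $M(G_j)$ under the maps induced by all minor morphisms $G\to G_j$. Line graph complement. $\mathcal{L}^c(G)$ is the simple graph whose vertices are the edges of $G$, two distinct ones being adjacent if and only if they do not share a vertex in $G$. Configuration space. For a simple graph $L$ with vertex set $V(L)$, $\mathrm{Conf}(L,\mathbb{C}^d)=\{(x_v)_{v\in V(L)}\in(\mathbb{C}^d)^{V(L)} : x_v\ne x_w \text{ whenever } \{v,w\}\text{ is an edge of }L\}$. Functoriality. For a minor morphism $\varphi:G\to G'$, the injection $\varphi^*:E(G')\to E(G)$ preserves pairs of edges not sharing a vertex, hence is a graph embedding $\mathcal{L}^c(G')\hookrightarrow\mathcal{L}^c(G)$; restriction of coordinates along it gives a map $\mathrm{Conf}(\mathcal{L}^c(G),\mathbb{C}^d)\to\mathrm{Conf}(\mathcal{L}^c(G'),\mathbb{C}^d)$, and passing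 to cohomology gives the map $H^i(\mathrm{Conf}(\mathcal{L}^c(G'),\mathbb{C}^d);\mathbb{Z})\to H^i(\mathrm{Conf}(\mathcal{L}^c(G),\mathbb{C}^d);\mathbb{Z})$ of the module structure. *)

theory Defs
  imports
    "HOL-Analysis.Analysis"
    "HOL-Homology.Homology"
    "HOL-Algebra.Generated_Groups"
    "Graph_Theory.Digraph_Component"
begin

section \<open>Graphs\<close>

text \<open>Graphs are digraphs (possibly with loops and parallel arrows) with a fixed-point-free
  arrow-reversing involution.\<close>

record ('v, 'a) mgraph = "('v, 'a) pre_digraph" +
  rev_arc :: "'a \<Rightarrow> 'a"

abbreviation digraph_of :: "('v, 'a) mgraph \<Rightarrow> ('v, 'a) pre_digraph" where
  "digraph_of G \<equiv> pre_digraph.truncate G"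

text \<open>The locale \<open>bidirected_digraph\<close> moreover normalises the involution to be the identity
  outside the set of arrows.\<close>

definition mgraph :: "('v, 'a) mgraph \<Rightarrow> bool" where
  "mgraph G \<longleftrightarrow> fin_digraph (digraph_of G) \<and> bidirected_digraph (digraph_of G) (rev_arc G)"

definition edges :: "('v, 'a) mgraph \<Rightarrow> 'a set set" where
  "edges G = (\<lambda>a. {a, rev_arc G a}) ` arcs G"

definition endpoints :: "('v, 'a) mgraph \<Rightarrow> 'a set \<Rightarrow> 'v set" where
  "endpoints G e = tail G ` e \<union> head G ` e"

text \<open>The library's \<open>connected\<close> includes nonemptiness.\<close>

definition connected_mgraph :: "('v, 'a) mgraph \<Rightarrow> bool" where
  "connected_mgraph G \<longleftrightarrow> Digraph_Component.connected (digraph_of G)"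

text \<open>The library's \<open>tree\<close> and \<open>forest\<close> cannot be used: there, an arrow followed by its
  reverse is a directed cycle. A cycle of a graph must not traverse an edge in both directions.
  Loops (length 1) and pairs of parallel edges (length 2) are cycles.\<close>

definition mgraph_cycle :: "('v, 'a) mgraph \<Rightarrow> 'a list \<Rightarrow> bool" where
  "mgraph_cycle G p \<longleftrightarrow>
     pre_digraph.cycle (digraph_of G) p \<and> (\<forall>a \<in> set p. rev_arc G a \<notin> set p)"

definition mgraph_tree :: "('v, 'a) mgraph \<Rightarrow> bool" where
  "mgraph_tree G \<longleftrightarrow> connected_mgraph G \<and> \<not> (\<exists>p. mgraph_cycle G p)"

definition genus :: "('v, 'a) mgraph \<Rightarrow> int" where
  "genus G = int (card (edges G)) - int (card (verts G)) + 1"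


section \<open>Minor morphisms\<close>

datatype ('v, 'a) elem = Vert 'v | Arr 'a | Star

definition elems :: "('v, 'a) mgraph \<Rightarrow> ('v, 'a) elem set" where
  "elems G = Vert ` verts G \<union> Arr ` arcs G \<union> {Star}"

fun rev_elem :: "('v, 'a) mgraph \<Rightarrow> ('v, 'a) elem \<Rightarrow> ('v, 'a) elem" where
  "rev_elem G (Vert v) = Vert v"
| "rev_elem G (Arr a) = Arr (rev_arc G a)"
| "rev_elem G Star = Star"

definition fibre :: "('v, 'a) mgraph \<Rightarrow> (('v, 'a) elem \<Rightarrow> ('w, 'b) elem) \<Rightarrow> 'w \<Rightarrow> ('v, 'a) mgraph"
  where
  "fibre G \<phi> v' = G\<lparr>verts := {v \<in> verts G. \<phi> (Vert v) = Vert v'},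
                     arcs := {a \<in> arcs G. \<phi> (Arr a) = Vert v'}\<rparr>"

definition minor_morphism ::
  "('v, 'a) mgraph \<Rightarrow> ('w, 'b) mgraph \<Rightarrow> (('v, 'a) elem \<Rightarrow> ('w, 'b) elem) \<Rightarrow> bool" where
  "minor_morphism G G' \<phi> \<longleftrightarrow>
     \<phi> \<in> elems G \<rightarrow>\<^sub>E elems G' \<and>
     \<phi> Star = Star \<and>
     (\<forall>v \<in> verts G. \<phi> (Vert v) \<in> Vert ` verts G') \<and>
     (\<forall>a \<in> arcs G. \<phi> (Arr (rev_arc G a)) = rev_elem G' (\<phi> (Arr a))) \<and>
     (\<forall>a' \<in> arcs G'. \<exists>!a. a \<in> arcs G \<and> \<phi> (Arr a) = Arr a') \<and>
     (\<forall>a \<in> arcs G. \<forall>a' \<in> arcs G'. \<phi> (Arr a) = Arr a' \<longrightarrow>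
        \<phi> (Vert (head G a)) = Vert (head G' a') \<and> \<phi> (Vert (tail G a)) = Vert (tail G' a')) \<and>
     (\<forall>a \<in> arcs G. \<forall>v' \<in> verts G'. \<phi> (Arr a) = Vert v' \<longrightarrow>
        \<phi> (Vert (head G a)) = Vert v' \<and> \<phi> (Vert (tail G a)) = Vert v') \<and>
     (\<forall>v' \<in> verts G'. mgraph_tree (fibre G \<phi> v'))"

text \<open>The injection \<open>edges G' \<rightarrow> edges G\<close> induced by a minor morphism \<open>\<phi> : G \<rightarrow> G'\<close>.\<close>

definition edge_pullback ::
  "('v, 'a) mgraph \<Rightarrow> (('v, 'a) elem \<Rightarrow> ('w, 'b) elem) \<Rightarrow> 'b set \<Rightarrow> 'a set" where
  "edge_pullback G \<phi> e' = (THE e. e \<in> edges G \<and> (\<lambda>a. \<phi> (Arr a)) ` e = Arr ` e')"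


section \<open>Modules over the opposite of the category of graphs of bounded genus\<close>

definition graphs_le :: "nat \<Rightarrow> ('v, 'a) mgraph set" where
  "graphs_le g = {G. mgraph G \<and> connected_mgraph G \<and> genus G \<le> int g}"

text \<open>An assignment \<open>M\<close> on objects and \<open>F\<close> on morphisms, where \<open>F G G' \<phi>\<close> maps \<open>M G'\<close> to
  \<open>M G\<close>. Source and target are arguments of \<open>F\<close> because they are not determined by the
  function \<open>\<phi>\<close>.\<close>

definition graph_op_module ::
  "nat \<Rightarrow> (('v, 'a) mgraph \<Rightarrow> 'm monoid) \<Rightarrow>
   (('v, 'a) mgraph \<Rightarrow> ('v, 'a) mgraph \<Rightarrow> (('v, 'a) elem \<Rightarrow> ('v, 'a) elem) \<Rightarrow> 'm \<Rightarrow> 'm) \<Rightarrow> bool"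
  where
  "graph_op_module g M F \<longleftrightarrow>
     (\<forall>G \<in> graphs_le g. comm_group (M G)) \<and>
     (\<forall>G \<in> graphs_le g. \<forall>G' \<in> graphs_le g. \<forall>\<phi>. minor_morphism G G' \<phi> \<longrightarrow>
        F G G' \<phi> \<in> hom (M G') (M G)) \<and>
     (\<forall>G \<in> graphs_le g. \<forall>x \<in> carrier (M G). F G G (\<lambda>u \<in> elems G. u) x = x) \<and>
     (\<forall>G \<in> graphs_le g. \<forall>G' \<in> graphs_le g. \<forall>G'' \<in> graphs_le g. \<forall>\<phi> \<psi>.
        minor_morphism G G' \<phi> \<longrightarrow> minor_morphism G' G'' \<psi> \<longrightarrow>
        (\<forall>x \<in> carrier (M G''). F G G'' (compose (elems G) \<psi> \<phi>) x = F G G' \<phi> (F G' G'' \<psi> x)))"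

definition finitely_generated_group :: "('m, 'n) monoid_scheme \<Rightarrow> bool" where
  "finitely_generated_group A \<longleftrightarrow> (\<exists>S. finite S \<and> S \<subseteq> carrier A \<and> generate A S = carrier A)"

definition finitely_generated_graph_op_module ::
  "nat \<Rightarrow> (('v, 'a) mgraph \<Rightarrow> 'm monoid) \<Rightarrow>
   (('v, 'a) mgraph \<Rightarrow> ('v, 'a) mgraph \<Rightarrow> (('v, 'a) elem \<Rightarrow> ('v, 'a) elem) \<Rightarrow> 'm \<Rightarrow> 'm) \<Rightarrow> bool"
  where
  "finitely_generated_graph_op_module g M F \<longleftrightarrow>
     graph_op_module g M F \<and>
     (\<exists>Gs. finite Gs \<and> Gs \<subseteq> graphs_le g \<and>
        (\<forall>H \<in> Gs. finitely_generated_group (M H)) \<and>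
        (\<forall>G \<in> graphs_le g.
           carrier (M G) =
           generate (M G) (\<Union>H \<in> Gs. \<Union>\<phi> \<in> {\<phi>. minor_morphism G H \<phi>}. F G H \<phi> ` carrier (M H))))"


section \<open>Singular cohomology with integer coefficients\<close>

text \<open>Singular cochains are homomorphisms from singular chains to the integers,
  represented by functions that are \<open>undefined\<close> outside the chain group.\<close>

definition cochain_group :: "nat \<Rightarrow> 'x topology \<Rightarrow> ('x chain \<Rightarrow> int) monoid" where
  "cochain_group p X =
     \<lparr>carrier = hom (chain_group p X) integer_group \<inter> extensional (singular_chain_set p X),
      monoid.mult = (\<lambda>\<alpha> \<beta>. \<lambda>c \<in> singular_chain_set p X. \<alpha> c + \<beta> c),
      one = (\<lambda>c \<in> singular_chain_set p X. 0)\<rparr>"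

definition coboundary :: "nat \<Rightarrow> 'x topology \<Rightarrow> ('x chain \<Rightarrow> int) \<Rightarrow> 'x chain \<Rightarrow> int" where
  "coboundary p X \<alpha> = (\<lambda>c \<in> singular_chain_set (Suc p) X. \<alpha> (chain_boundary (Suc p) c))"

definition cocycles :: "nat \<Rightarrow> 'x topology \<Rightarrow> ('x chain \<Rightarrow> int) set" where
  "cocycles p X = kernel (cochain_group p X) (cochain_group (Suc p) X) (coboundary p X)"

definition coboundaries :: "nat \<Rightarrow> 'x topology \<Rightarrow> ('x chain \<Rightarrow> int) set" where
  "coboundaries p X =
     (case p of 0 \<Rightarrow> {\<one>\<^bsub>cochain_group 0 X\<^esub>}
      | Suc q \<Rightarrow> coboundary q X ` carrier (cochain_group q X))"

definition cohomology_group :: "nat \<Rightarrow> 'x topology \<Rightarrow> ('x chain \<Rightarrow> int) set monoid" where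
  "cohomology_group p X = subgroup_generated (cochain_group p X) (cocycles p X) Mod coboundaries p X"

definition cochain_map ::
  "nat \<Rightarrow> 'x topology \<Rightarrow> ('x \<Rightarrow> 'y) \<Rightarrow> ('y chain \<Rightarrow> int) \<Rightarrow> 'x chain \<Rightarrow> int" where
  "cochain_map p X f \<alpha> = (\<lambda>c \<in> singular_chain_set p X. \<alpha> (chain_map p f c))"

text \<open>For continuous \<open>f : X \<rightarrow> Y\<close>, a class \<open>C = B + \<alpha>\<close> in the cohomology of \<open>Y\<close> is sent to
  the coset of the pulled-back cocycle: adding all coboundaries of \<open>X\<close> to the pullbacks of all
  representatives of \<open>C\<close> gives exactly this coset.\<close>

definition cohomology_map ::
  "nat \<Rightarrow> 'x topology \<Rightarrow> ('x \<Rightarrow> 'y) \<Rightarrow> ('y chain \<Rightarrow> int) set \<Rightarrow> ('x chain \<Rightarrow> int) set" where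
  "cohomology_map p X f C = coboundaries p X <#>\<^bsub>cochain_group p X\<^esub> (cochain_map p X f ` C)"


section \<open>Line graph complements and configuration spaces\<close>

text \<open>A simple graph is given by its vertices and its (symmetric, irreflexive) adjacency
  relation.\<close>

definition line_graph_complement :: "('v, 'a) mgraph \<Rightarrow> 'a set pair_pre_digraph" where
  "line_graph_complement G =
     \<lparr>pverts = edges G,
      parcs = {(e, f). e \<in> edges G \<and> f \<in> edges G \<and> e \<noteq> f \<and> endpoints G e \<inter> endpoints G f = {}}\<rparr>"

definition Conf :: "'l pair_pre_digraph \<Rightarrow> ('l \<Rightarrow> complex ^ 'd) topology" where
  "Conf L = subtopology (product_topology (\<lambda>_. euclidean) (pverts L))
     {x. \<forall>v w. (v, w) \<in> parcs L \<longrightarrow> x v \<noteq> x w}"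

text \<open>The map \<open>Conf (line_graph_complement G) \<rightarrow> Conf (line_graph_complement G')\<close> restricting
  coordinates along the edge injection of \<open>\<phi> : G \<rightarrow> G'\<close>.\<close>

definition conf_restriction ::
  "('v, 'a) mgraph \<Rightarrow> ('w, 'b) mgraph \<Rightarrow> (('v, 'a) elem \<Rightarrow> ('w, 'b) elem) \<Rightarrow>
   ('a set \<Rightarrow> complex ^ 'd) \<Rightarrow> 'b set \<Rightarrow> complex ^ 'd" where
  "conf_restriction G G' \<phi> x = (\<lambda>e' \<in> edges G'. x (edge_pullback G \<phi> e'))"

end

theory Submission
  imports Defs
begin

text \<open>
  The proof combines a generation statement for the cohomology of complements of subspace
  arrangements with a contraction of graphs.

  \<^emph>\<open>Topology.\<close> For a finite set \<open>L\<close> of real linear forms, each in at most two coordinates, let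
  the coordinates range over a Euclidean space of dimension \<open>D \<ge> 2\<close>, and consider the set of
  points at which no form of \<open>L\<close> vanishes. Its cohomology in degree \<open>i\<close> is generated by finitely
  many classes, each pulled back from the complement of an independent subfamily \<open>F\<close> with at most
  \<open>i\<close> members along the map that forgets all coordinates which do not occur in \<open>F\<close>
  (\<open>generated_complement\<close>). The proof is by deletion and contraction of a form \<open>e\<close>. The complement of \<open>L\<close> is
  \<open>A \<inter> B\<close>, where \<open>A\<close> is the complement of \<open>L - {e}\<close> and \<open>B\<close> is the locus \<open>e \<noteq> 0\<close>. Up to homotopy
  \<open>A \<union> B\<close> is the \<open>D\<close>-fold suspension of the complement of the contracted arrangement on \<open>e = 0\<close>,
  so induction and \<open>D\<close> applications of Mayer--Vietoris (\<open>generated_suspend\<close>) generate its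
  cohomology in degree \<open>i + 1\<close> by the analogous unions \<open>A' \<union> B'\<close> for independent families. For an
  independent family both \<open>A'\<close> and \<open>B'\<close> lie in contractible subsets of \<open>A' \<union> B'\<close>
  (\<open>indep_forms_vanish\<close>), so these classes are images of classes on \<open>A' \<inter> B'\<close> under the connecting
  homomorphism. Subtracting their pullbacks from a class on \<open>A \<inter> B\<close> leaves classes that come from
  \<open>A\<close> and from \<open>B\<close> (\<open>generated_intersection\<close>), and these are known by induction. Lifting classes in
  this way replaces the Thom isomorphism and cup products, and carrying finite sets of generators
  along makes finite generation part of the same induction.

  \<^emph>\<open>Graphs.\<close> A family of at most \<open>i\<close> forms \<open>x e - x f\<close> involves at most \<open>2 * i\<close> edges of \<open>G\<close>, and
  these have at most \<open>4 * i\<close> ends. Contracting a spanning forest, each of whose trees contains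
  exactly one of these ends, is a minor morphism to a graph with at most \<open>4 * i\<close> vertices (one
  vertex if \<open>i = 0\<close>) and the same genus, hence with boundedly many edges; up to isomorphism there
  are finitely many such graphs (\<open>marked_contraction\<close>). The ends stay distinct, so the chosen
  edges survive and disjoint ones stay disjoint, and the class descends to the configuration space
  of the small graph (\<open>class_from_small_minor\<close>).
\<close>

section \<open>Integral cochains on singular simplices\<close>

text \<open>A cochain is a function on everything that has the type of a simplex, and only its values on the
  singular simplices of the space at hand matter. Restricting a cochain to a subspace leaves the
  function unchanged, so cochains on different subspaces can be compared and added directly.\<close>

type_synonym 'x sing_simplex = "(nat \<Rightarrow> real) \<Rightarrow> 'x"
type_synonym 'x cochain = "'x sing_simplex \<Rightarrow> int"

definition ceval :: "('s \<Rightarrow> int) \<Rightarrow> ('s \<Rightarrow>\<^sub>0 int) \<Rightarrow> int" where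
  "ceval \<phi> c = (\<Sum>\<sigma> \<in> Poly_Mapping.keys c. Poly_Mapping.lookup c \<sigma> * \<phi> \<sigma>)"

lemma ceval_superset:
  assumes "finite K" "Poly_Mapping.keys c \<subseteq> K"
  shows "ceval \<phi> c = (\<Sum>\<sigma> \<in> K. Poly_Mapping.lookup c \<sigma> * \<phi> \<sigma>)"
  unfolding ceval_def
  by (rule sum.mono_neutral_left) (use assms in \<open>auto simp: in_keys_iff\<close>)

lemma ceval_0 [simp]: "ceval \<phi> 0 = 0"
  by (simp add: ceval_def)

lemma ceval_of [simp]: "ceval \<phi> (frag_of \<sigma>) = \<phi> \<sigma>"
  by (simp add: ceval_def)

lemma ceval_add: "ceval \<phi> (c + d) = ceval \<phi> c + ceval \<phi> d"
proof -
  let ?K = "Poly_Mapping.keys c \<union> Poly_Mapping.keys d"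
  have "ceval \<phi> (c + d) = (\<Sum>\<sigma> \<in> ?K. Poly_Mapping.lookup (c + d) \<sigma> * \<phi> \<sigma>)"
    by (rule ceval_superset) (auto simp: keys_add)
  also have "\<dots> = ceval \<phi> c + ceval \<phi> d"
    by (simp add: ceval_superset[of ?K] lookup_add distrib_right sum.distrib)
  finally show ?thesis .
qed

lemma ceval_minus: "ceval \<phi> (- c) = - ceval \<phi> c"
  by (simp add: ceval_def sum_negf)

lemma ceval_diff: "ceval \<phi> (c - d) = ceval \<phi> c - ceval \<phi> d"
  using ceval_add[of \<phi> c "- d"] by (simp add: ceval_minus)

lemma ceval_cmul: "ceval \<phi> (frag_cmul k c) = k * ceval \<phi> c"
  by (subst ceval_superset[of "Poly_Mapping.keys c"])
     (auto simp: ceval_def sum_distrib_left mult.assoc)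

lemma ceval_sum: "ceval \<phi> (sum f I) = (\<Sum>i\<in>I. ceval \<phi> (f i))"
  by (induction I rule: infinite_finite_induct) (simp_all add: ceval_add)

lemma ceval_cong:
  "(\<And>\<sigma>. \<sigma> \<in> Poly_Mapping.keys c \<Longrightarrow> \<phi> \<sigma> = \<psi> \<sigma>) \<Longrightarrow> ceval \<phi> c = ceval \<psi> c"
  by (simp add: ceval_def)

lemma ceval_frag_extend: "ceval \<phi> (frag_extend f c) = ceval (\<lambda>\<sigma>. ceval \<phi> (f \<sigma>)) c"
  by (simp add: frag_extend_def ceval_sum ceval_cmul) (simp add: ceval_def)

lemma ceval_fun_add: "ceval (\<lambda>\<sigma>. \<phi> \<sigma> + \<psi> \<sigma>) c = ceval \<phi> c + ceval \<psi> c"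
  by (simp add: ceval_def distrib_left sum.distrib)

lemma ceval_fun_diff: "ceval (\<lambda>\<sigma>. \<phi> \<sigma> - \<psi> \<sigma>) c = ceval \<phi> c - ceval \<psi> c"
  by (simp add: ceval_def right_diff_distrib sum_subtractf)

lemma ceval_fun_cmul: "ceval (\<lambda>\<sigma>. k * \<phi> \<sigma>) c = k * ceval \<phi> c"
  by (simp add: ceval_def sum_distrib_left algebra_simps)

lemma ceval_fun_zero [simp]: "ceval (\<lambda>\<sigma>. 0) c = 0"
  by (simp add: ceval_def)

definition bdry :: "nat \<Rightarrow> 'x sing_simplex \<Rightarrow> 'x chain" where
  "bdry p \<sigma> = chain_boundary p (frag_of \<sigma>)"

lemma bdry_0 [simp]: "bdry 0 \<sigma> = 0"
  by (simp add: bdry_def chain_boundary_def)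

lemma chain_boundary_eq: "chain_boundary p c = frag_extend (bdry p) c"
  unfolding bdry_def chain_boundary_def by (auto simp: frag_extend_eq_0)

lemma chain_boundary_frag_extend:
  "chain_boundary p (frag_extend f c) = frag_extend (\<lambda>\<sigma>. chain_boundary p (f \<sigma>)) c"
  using subset_UNIV[of "Poly_Mapping.keys c"]
  by (induction c rule: frag_induction) (auto simp: frag_extend_diff chain_boundary_diff)

lemma ceval_chain_boundary: "ceval \<phi> (chain_boundary p c) = ceval (\<lambda>\<sigma>. ceval \<phi> (bdry p \<sigma>)) c"
  by (simp add: chain_boundary_eq ceval_frag_extend)

lemma keys_bdry:
  "Poly_Mapping.keys (bdry (Suc p) \<sigma>) \<subseteq> {singular_face (Suc p) k \<sigma> | k. k \<le> Suc p}"
proof -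
  have "Poly_Mapping.keys (bdry (Suc p) \<sigma>) \<subseteq>
      (\<Union>k\<in>{..Suc p}. Poly_Mapping.keys (frag_cmul ((-1) ^ k) (frag_of (singular_face (Suc p) k \<sigma>))))"
    unfolding bdry_def chain_boundary_of by (simp only: nat.distinct if_False) (rule keys_sum)
  also have "\<dots> \<subseteq> {singular_face (Suc p) k \<sigma> | k. k \<le> Suc p}"
    by auto
  finally show ?thesis .
qed

lemma singular_chain_bdry:
  "singular_simplex (Suc p) X \<sigma> \<Longrightarrow> singular_chain p X (bdry (Suc p) \<sigma>)"
  by (simp add: bdry_def singular_chain_boundary_alt singular_chain_of)

lemma chain_boundary_bdry:
  "singular_simplex (Suc p) X \<sigma> \<Longrightarrow> chain_boundary p (bdry (Suc p) \<sigma>) = 0"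
  using chain_boundary_boundary[of "Suc p" X "frag_of \<sigma>"]
  by (simp add: bdry_def singular_chain_of)

definition cocycle :: "nat \<Rightarrow> 'x topology \<Rightarrow> 'x cochain \<Rightarrow> bool" where
  "cocycle p X \<phi> \<longleftrightarrow> (\<forall>\<sigma>. singular_simplex (Suc p) X \<sigma> \<longrightarrow> ceval \<phi> (bdry (Suc p) \<sigma>) = 0)"

text \<open>The boundary of a simplex of degree 0 is the empty chain, so in degree 0 the coboundaries are the
  cochains that vanish on all points.\<close>

definition cobdry :: "nat \<Rightarrow> 'x topology \<Rightarrow> 'x cochain \<Rightarrow> bool" where
  "cobdry p X \<phi> \<longleftrightarrow> (\<exists>\<eta>. \<forall>\<sigma>. singular_simplex p X \<sigma> \<longrightarrow> \<phi> \<sigma> = ceval \<eta> (bdry p \<sigma>))"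

definition pullback :: "nat \<Rightarrow> ('x \<Rightarrow> 'y) \<Rightarrow> (((nat \<Rightarrow> real) \<Rightarrow> 'y) \<Rightarrow> int) \<Rightarrow> 'x cochain" where
  "pullback p q \<phi> \<sigma> = \<phi> (simplex_map p q \<sigma>)"

lemma cocycle_chain:
  assumes "cocycle p X \<phi>" "singular_chain (Suc p) X c" shows "ceval \<phi> (chain_boundary (Suc p) c) = 0"
proof -
  have "ceval \<phi> (chain_boundary (Suc p) c) = ceval (\<lambda>\<sigma>. 0) c"
    unfolding ceval_chain_boundary
    by (rule ceval_cong) (use assms in \<open>auto simp: cocycle_def singular_chain_def\<close>)
  then show ?thesis by simp
qed

lemma ceval_pullback: "ceval (pullback p q \<phi>) c = ceval \<phi> (chain_map p q c)"
  unfolding chain_map_def ceval_frag_extend by (rule ceval_cong) (simp add: pullback_def)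

lemma bdry_simplex_map:
  "singular_simplex (Suc p) X \<sigma> \<Longrightarrow> bdry (Suc p) (simplex_map (Suc p) q \<sigma>) = chain_map p q (bdry (Suc p) \<sigma>)"
  using chain_boundary_chain_map[of "Suc p" X "frag_of \<sigma>" q]
  by (simp add: bdry_def singular_chain_of)

lemma cocycle_pullback:
  assumes "cocycle p Y \<phi>" "continuous_map X Y q" shows "cocycle p X (pullback p q \<phi>)"
  unfolding cocycle_def
proof (intro allI impI)
  fix \<sigma> assume s: "singular_simplex (Suc p) X \<sigma>"
  then show "ceval (pullback p q \<phi>) (bdry (Suc p) \<sigma>) = 0"
    using assms singular_simplex_simplex_map[OF s assms(2)]
    by (simp add: cocycle_def ceval_pullback flip: bdry_simplex_map)
qed

lemma cobdry_cong:
  assumes "\<And>\<sigma>. singular_simplex p X \<sigma> \<Longrightarrow> \<phi> \<sigma> = \<psi> \<sigma>" "cobdry p X \<phi>"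
  shows "cobdry p X \<psi>"
  using assms unfolding cobdry_def by metis

lemma cobdry_pullback:
  assumes "cobdry p Y \<phi>" "continuous_map X Y q" shows "cobdry p X (pullback p q \<phi>)"
proof -
  obtain \<eta> where \<eta>: "\<And>\<sigma>. singular_simplex p Y \<sigma> \<Longrightarrow> \<phi> \<sigma> = ceval \<eta> (bdry p \<sigma>)"
    using assms(1) by (auto simp: cobdry_def)
  have "pullback p q \<phi> \<sigma> = ceval (pullback (p-1) q \<eta>) (bdry p \<sigma>)" if s: "singular_simplex p X \<sigma>" for \<sigma>
  proof (cases p)
    case 0
    then show ?thesis using \<eta>[OF singular_simplex_simplex_map[OF s assms(2)]] by (simp add: pullback_def)
  next
    case (Suc r)
    then show ?thesis using \<eta>[OF singular_simplex_simplex_map[OF s assms(2)]] bdry_simplex_map[of r X \<sigma> q] s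
      by (simp add: ceval_pullback) (simp add: pullback_def)
  qed
  then show ?thesis unfolding cobdry_def by blast
qed

lemma cobdry_imp_cocycle:
  assumes "cobdry p X \<phi>" shows "cocycle p X \<phi>"
proof -
  obtain \<eta> where \<eta>: "\<And>\<sigma>. singular_simplex p X \<sigma> \<Longrightarrow> \<phi> \<sigma> = ceval \<eta> (bdry p \<sigma>)"
    using assms(1) by (auto simp: cobdry_def)
  have "ceval \<phi> (bdry (Suc p) \<sigma>) = 0" if s: "singular_simplex (Suc p) X \<sigma>" for \<sigma>
  proof -
    have "ceval \<phi> (bdry (Suc p) \<sigma>) = ceval (\<lambda>\<tau>. ceval \<eta> (bdry p \<tau>)) (bdry (Suc p) \<sigma>)"
      by (rule ceval_cong) (use singular_chain_bdry[OF s] \<eta> in \<open>auto simp: singular_chain_def\<close>)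
    also have "\<dots> = ceval \<eta> (chain_boundary p (bdry (Suc p) \<sigma>))"
      by (simp add: ceval_chain_boundary)
    finally show ?thesis by (simp add: chain_boundary_bdry[OF s])
  qed
  then show ?thesis by (auto simp: cocycle_def)
qed

lemma cocycle_diff: "cocycle p X \<phi> \<Longrightarrow> cocycle p X \<psi> \<Longrightarrow> cocycle p X (\<lambda>\<sigma>. \<phi> \<sigma> - \<psi> \<sigma>)"
  by (simp add: cocycle_def ceval_fun_diff)

lemma cocycle_cmul: "cocycle p X \<phi> \<Longrightarrow> cocycle p X (\<lambda>\<sigma>. k * \<phi> \<sigma>)"
  by (simp add: cocycle_def ceval_fun_cmul)

lemma cocycle_mono:
  "\<lbrakk>cocycle p (subtopology X T) \<phi>; S \<subseteq> T\<rbrakk> \<Longrightarrow> cocycle p (subtopology X S) \<phi>"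
  using singular_simplex_mono unfolding cocycle_def by blast

lemma cobdry_mono:
  "\<lbrakk>cobdry p (subtopology X T) \<phi>; S \<subseteq> T\<rbrakk> \<Longrightarrow> cobdry p (subtopology X S) \<phi>"
  using singular_simplex_mono unfolding cobdry_def by blast

lemma cobdryI: "(\<And>\<sigma>. singular_simplex p X \<sigma> \<Longrightarrow> \<phi> \<sigma> = ceval \<eta> (bdry p \<sigma>)) \<Longrightarrow> cobdry p X \<phi>"
  unfolding cobdry_def by blast

lemma cobdryE:
  assumes "cobdry p X \<phi>"
  obtains \<eta> where "\<And>\<sigma>. singular_simplex p X \<sigma> \<Longrightarrow> \<phi> \<sigma> = ceval \<eta> (bdry p \<sigma>)"
  using assms unfolding cobdry_def by blast

lemma cobdry_add:
  assumes "cobdry p X \<phi>" "cobdry p X \<psi>" shows "cobdry p X (\<lambda>\<sigma>. \<phi> \<sigma> + \<psi> \<sigma>)"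
proof -
  obtain a b where ab: "\<And>\<sigma>. singular_simplex p X \<sigma> \<Longrightarrow> \<phi> \<sigma> = ceval a (bdry p \<sigma>)"
    "\<And>\<sigma>. singular_simplex p X \<sigma> \<Longrightarrow> \<psi> \<sigma> = ceval b (bdry p \<sigma>)"
    by (rule cobdryE[OF assms(1)], rule cobdryE[OF assms(2)]) (use that in blast)
  show ?thesis by (rule cobdryI[of _ _ _ "\<lambda>\<rho>. a \<rho> + b \<rho>"]) (simp add: ceval_fun_add ab)
qed

lemma cobdry_zero: "cobdry p X (\<lambda>\<sigma>. 0)"
  unfolding cobdry_def by (rule exI[of _ "\<lambda>_. 0"]) simp

lemma cobdry_cmul:
  assumes "cobdry p X \<phi>" shows "cobdry p X (\<lambda>\<sigma>. k * \<phi> \<sigma>)"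
proof -
  obtain a where ab: "\<And>\<sigma>. singular_simplex p X \<sigma> \<Longrightarrow> \<phi> \<sigma> = ceval a (bdry p \<sigma>)"
    by (rule cobdryE[OF assms]) (use that in blast)
  show ?thesis by (rule cobdryI[of _ _ _ "\<lambda>\<rho>. k * a \<rho>"]) (simp add: ceval_fun_cmul ab)
qed

lemma cobdry_diff: "cobdry p X \<phi> \<Longrightarrow> cobdry p X \<psi> \<Longrightarrow> cobdry p X (\<lambda>\<sigma>. \<phi> \<sigma> - \<psi> \<sigma>)"
  using cobdry_add[OF _ cobdry_cmul[of p X \<psi> "-1"]] by fastforce

section \<open>Chain complexes relative to an acyclic subcomplex\<close>

definition subcomplex :: "'x topology \<Rightarrow> (nat \<Rightarrow> 'x sing_simplex set) \<Rightarrow> bool" where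
  "subcomplex X S \<longleftrightarrow> (\<forall>p. S p \<subseteq> singular_simplex_set p X) \<and>
     (\<forall>p. \<forall>\<sigma> \<in> S (Suc p). \<forall>k \<le> Suc p. singular_face (Suc p) k \<sigma> \<in> S p)"

text \<open>Every cycle of the quotient of the singular chains of \<open>X\<close> by the span of \<open>S\<close> is a boundary there.\<close>

definition acyclic_pair :: "'x topology \<Rightarrow> (nat \<Rightarrow> 'x sing_simplex set) \<Rightarrow> bool" where
  "acyclic_pair X S \<longleftrightarrow> (\<forall>p z. singular_chain p X z \<longrightarrow> Poly_Mapping.keys (chain_boundary p z) \<subseteq> S (p - 1) \<longrightarrow>
     (\<exists>w. singular_chain (Suc p) X w \<and> Poly_Mapping.keys (z - chain_boundary (Suc p) w) \<subseteq> S p))"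

lemma subcomplex_boundary:
  assumes "subcomplex X S" "Poly_Mapping.keys c \<subseteq> S (Suc p)"
  shows "Poly_Mapping.keys (chain_boundary (Suc p) c) \<subseteq> S p"
proof -
  have "Poly_Mapping.keys (bdry (Suc p) \<sigma>) \<subseteq> S p" if "\<sigma> \<in> Poly_Mapping.keys c" for \<sigma>
    using keys_bdry[of p \<sigma>] assms that unfolding subcomplex_def by blast
  then show ?thesis
    unfolding chain_boundary_eq using keys_frag_extend[of "bdry (Suc p)" c] by blast
qed

text \<open>A free acyclic chain complex that starts in degree 0 is contractible. For the quotient by \<open>S\<close> the
  contraction is built by recursion on the degree: for a simplex outside \<open>S\<close> it chooses a chain that
  bounds, up to chains in \<open>S\<close>, the simplex minus the contraction of its boundary.\<close>

primrec shrink :: "'x topology \<Rightarrow> (nat \<Rightarrow> 'x sing_simplex set) \<Rightarrow> nat \<Rightarrow> 'x sing_simplex \<Rightarrow> 'x chain" where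
  "shrink X S 0 = (\<lambda>\<sigma>. if \<sigma> \<in> S 0 then 0 else
     (SOME w. singular_chain 1 X w \<and> Poly_Mapping.keys (frag_of \<sigma> - chain_boundary 1 w) \<subseteq> S 0))"
| "shrink X S (Suc p) = (\<lambda>\<sigma>. if \<sigma> \<in> S (Suc p) then 0 else
     (SOME w. singular_chain (Suc (Suc p)) X w \<and>
        Poly_Mapping.keys (frag_of \<sigma> - frag_extend (shrink X S p) (bdry (Suc p) \<sigma>) - chain_boundary (Suc (Suc p)) w)
          \<subseteq> S (Suc p)))"

lemma shrink_small: "\<sigma> \<in> S p \<Longrightarrow> shrink X S p \<sigma> = 0"
  by (cases p) auto

text \<open>The identity minus the two terms of the homotopy. By construction this is a chain map to the span
  of \<open>S\<close>, it fixes the simplices in \<open>S\<close>, and it is homotopic to the identity.\<close>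

definition subcx_retract :: "'x topology \<Rightarrow> (nat \<Rightarrow> 'x sing_simplex set) \<Rightarrow> nat \<Rightarrow> 'x sing_simplex \<Rightarrow> 'x chain" where
  "subcx_retract X S p \<sigma> = frag_of \<sigma> - frag_extend (shrink X S (p - 1)) (bdry p \<sigma>) - chain_boundary (Suc p) (shrink X S p \<sigma>)"

lemma frag_extend_shrink_small:
  assumes "Poly_Mapping.keys c \<subseteq> S p" shows "frag_extend (shrink X S p) c = 0"
  by (rule frag_extend_eq_0) (use assms shrink_small in blast)

lemma subcx_retract_small:
  assumes "subcomplex X S" "\<sigma> \<in> S p" shows "subcx_retract X S p \<sigma> = frag_of \<sigma>"
proof -
  have "frag_extend (shrink X S (p - 1)) (bdry p \<sigma>) = 0"
  proof (cases p)
    case (Suc r)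
    have "Poly_Mapping.keys (bdry (Suc r) \<sigma>) \<subseteq> S r"
      using subcomplex_boundary[OF assms(1), of "frag_of \<sigma>" r] assms(2) Suc by (simp add: bdry_def)
    then show ?thesis using frag_extend_shrink_small Suc by simp
  qed simp
  then show ?thesis by (simp add: subcx_retract_def shrink_small assms(2))
qed

lemma subcx_retract_chain:
  "frag_extend (subcx_retract X S p) c =
   c - frag_extend (shrink X S (p - 1)) (chain_boundary p c) - chain_boundary (Suc p) (frag_extend (shrink X S p) c)"
proof -
  show ?thesis
    using subset_UNIV[of "Poly_Mapping.keys c"]
  proof (induction c rule: frag_induction)
    case (one \<sigma>)
    then show ?case by (simp add: subcx_retract_def bdry_def)
  next
    case (diff a b)
    then show ?case by (simp add: frag_extend_diff chain_boundary_diff)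
  qed simp
qed

text \<open>The two claims need each other: the choice in degree \<open>p + 1\<close> is possible because the boundary of
  what has to be bounded is the retraction of a boundary, and that lies in \<open>S\<close> by the claim in
  degree \<open>p\<close>.\<close>

lemma shrink_subcx_retract:
  assumes S: "subcomplex X S" and A: "acyclic_pair X S"
  shows "singular_simplex p X \<sigma> \<Longrightarrow>
    singular_chain (Suc p) X (shrink X S p \<sigma>) \<and> Poly_Mapping.keys (subcx_retract X S p \<sigma>) \<subseteq> S p"
proof (induction p arbitrary: \<sigma>)
  case 0
  show ?case
  proof (cases "\<sigma> \<in> S 0")
    case True
    then show ?thesis by (simp add: subcx_retract_small[OF S] shrink_small)
  next
    case False
    have "\<exists>w. singular_chain 1 X w \<and> Poly_Mapping.keys (frag_of \<sigma> - chain_boundary 1 w) \<subseteq> S 0"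
      using A[unfolded acyclic_pair_def, rule_format, of 0 "frag_of \<sigma>"] 0
      by (simp add: singular_chain_of chain_boundary_def)
    from someI_ex[OF this] show ?thesis using False by (simp add: subcx_retract_def)
  qed
next
  case (Suc p)
  show ?case
  proof (cases "\<sigma> \<in> S (Suc p)")
    case True
    then show ?thesis by (simp add: subcx_retract_small[OF S] shrink_small)
  next
    case False
    let ?b = "bdry (Suc p) \<sigma>"
    define z where "z = frag_of \<sigma> - frag_extend (shrink X S p) ?b"
    have b: "singular_chain p X ?b" using singular_chain_bdry Suc.prems by blast
    have 1: "singular_chain (Suc p) X (frag_extend (shrink X S p) c)" if "singular_chain p X c" for c
      by (rule singular_chain_extend) (use Suc.IH that in \<open>auto simp: singular_chain_def\<close>)
    have z: "singular_chain (Suc p) X z" 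
      unfolding z_def using 1[OF b] Suc.prems by (simp add: singular_chain_diff singular_chain_of)
    have "frag_extend (shrink X S (p - 1)) (chain_boundary p ?b) = 0"
      using chain_boundary_bdry[OF Suc.prems] by simp
    then have "frag_extend (subcx_retract X S p) ?b = chain_boundary (Suc p) z"
      unfolding subcx_retract_chain z_def by (simp add: chain_boundary_diff bdry_def)
    moreover have "Poly_Mapping.keys (frag_extend (subcx_retract X S p) ?b) \<subseteq> S p"
      using keys_frag_extend[of "subcx_retract X S p" ?b] b Suc.IH unfolding singular_chain_def by blast
    ultimately have "\<exists>w. singular_chain (Suc (Suc p)) X w \<and> Poly_Mapping.keys (z - chain_boundary (Suc (Suc p)) w) \<subseteq> S (Suc p)"
      using A[unfolded acyclic_pair_def, rule_format, of "Suc p" z] z by simp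
    from someI_ex[OF this] show ?thesis using False by (simp add: subcx_retract_def z_def)
  qed
qed

lemma subcx_retract_boundary:
  assumes S: "subcomplex X S" and A: "acyclic_pair X S" and c: "singular_chain (Suc p) X c"
  shows "frag_extend (subcx_retract X S p) (chain_boundary (Suc p) c) = chain_boundary (Suc p) (frag_extend (subcx_retract X S (Suc p)) c)"
proof -
  let ?w = "frag_extend (shrink X S (Suc p)) c"
  have "singular_chain (Suc (Suc p)) X ?w"
    by (rule singular_chain_extend) (use c shrink_subcx_retract[OF S A] singular_chain_def in blast)
  then have "chain_boundary (Suc p) (chain_boundary (Suc (Suc p)) ?w) = 0"
    using chain_boundary_boundary_alt by blast
  moreover have "chain_boundary p (chain_boundary (Suc p) c) = 0"
    using chain_boundary_boundary_alt c by blast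
  ultimately show ?thesis by (simp add: subcx_retract_chain chain_boundary_diff)
qed

text \<open>Composition with the retraction extends cochains from the subcomplex, and it preserves cocycles
  because the retraction is a chain map.\<close>

lemma cocycle_extend_from_subcomplex:
  assumes S: "subcomplex X S" and A: "acyclic_pair X S"
    and \<beta>: "\<And>\<tau>. \<tau> \<in> S (Suc p) \<Longrightarrow> ceval \<beta> (bdry (Suc p) \<tau>) = 0"
  obtains \<gamma> where "cocycle p X \<gamma>" "\<And>\<sigma>. \<sigma> \<in> S p \<Longrightarrow> \<gamma> \<sigma> = \<beta> \<sigma>"
proof
  let ?\<gamma> = "\<lambda>\<sigma>. ceval \<beta> (subcx_retract X S p \<sigma>)"
  show "?\<gamma> \<sigma> = \<beta> \<sigma>" if "\<sigma> \<in> S p" for \<sigma>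
    using that by (simp add: subcx_retract_small[OF S])
  show "cocycle p X ?\<gamma>"
    unfolding cocycle_def
  proof (intro allI impI)
    fix \<tau> assume t: "singular_simplex (Suc p) X \<tau>"
    have "ceval ?\<gamma> (bdry (Suc p) \<tau>) = ceval \<beta> (frag_extend (subcx_retract X S p) (chain_boundary (Suc p) (frag_of \<tau>)))"
      by (simp add: ceval_frag_extend bdry_def)
    also have "\<dots> = ceval \<beta> (chain_boundary (Suc p) (subcx_retract X S (Suc p) \<tau>))"
      using t by (simp add: subcx_retract_boundary[OF S A] singular_chain_of)
    also have "\<dots> = ceval (\<lambda>\<sigma>. 0) (subcx_retract X S (Suc p) \<tau>)"
      unfolding ceval_chain_boundary by (rule ceval_cong) (use shrink_subcx_retract[OF S A t] \<beta> in blast)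
    finally show "ceval ?\<gamma> (bdry (Suc p) \<tau>) = 0" by simp
  qed
qed

text \<open>The retraction is homotopic to the identity, so a cocycle is cohomologous to its composition with
  the retraction, which sees the subcomplex only.\<close>

lemma cobdry_if_cobdry_on_subcomplex:
  assumes S: "subcomplex X S" and A: "acyclic_pair X S"
    and \<gamma>: "cocycle p X \<gamma>" and \<eta>: "\<And>\<sigma>. \<sigma> \<in> S p \<Longrightarrow> \<gamma> \<sigma> = ceval \<eta> (bdry p \<sigma>)"
  shows "cobdry p X \<gamma>"
proof -
  define \<theta> where "\<theta> \<rho> = \<eta> \<rho> - ceval \<eta> (chain_boundary p (shrink X S (p-1) \<rho>)) + ceval \<gamma> (shrink X S (p-1) \<rho>)" for \<rho>
  have "\<gamma> \<sigma> = ceval \<theta> (bdry p \<sigma>)" if s: "singular_simplex p X \<sigma>" for \<sigma>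
  proof -
    let ?b = "bdry p \<sigma>" and ?h = "frag_extend (shrink X S (p-1))"
    have "ceval \<gamma> (chain_boundary (Suc p) (shrink X S p \<sigma>)) = 0"
      using cocycle_chain[OF \<gamma>] shrink_subcx_retract[OF S A s] by blast
    then have "\<gamma> \<sigma> = ceval \<gamma> (subcx_retract X S p \<sigma>) + ceval \<gamma> (?h ?b)"
      by (simp add: subcx_retract_def ceval_diff)
    also have "ceval \<gamma> (subcx_retract X S p \<sigma>) = ceval \<eta> (chain_boundary p (subcx_retract X S p \<sigma>))"
      unfolding ceval_chain_boundary by (rule ceval_cong) (use shrink_subcx_retract[OF S A s] \<eta> in blast)
    also have "chain_boundary p (subcx_retract X S p \<sigma>) = ?b - chain_boundary p (?h ?b)"
    proof -
      have "chain_boundary p (chain_boundary (Suc p) (shrink X S p \<sigma>)) = 0"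
        using chain_boundary_boundary_alt shrink_subcx_retract[OF S A s] by blast
      then show ?thesis by (simp add: subcx_retract_def chain_boundary_diff bdry_def)
    qed
    also have "chain_boundary p (?h ?b) = frag_extend (\<lambda>\<rho>. chain_boundary p (shrink X S (p-1) \<rho>)) ?b"
      by (rule chain_boundary_frag_extend)
    finally show ?thesis
      by (simp add: \<theta>_def[abs_def] ceval_fun_add ceval_fun_diff ceval_frag_extend ceval_diff)
  qed
  then show ?thesis unfolding cobdry_def by blast
qed

section \<open>Generation of cohomology by pullbacks\<close>

text \<open>Modulo coboundaries this is the subgroup generated by \<open>Z\<close>. Rule induction transports statements
  about generators through a connecting homomorphism.\<close>

inductive cspan :: "nat \<Rightarrow> 'x topology \<Rightarrow> 'x cochain set \<Rightarrow> 'x cochain \<Rightarrow> bool"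
  for p X Z where
  base: "z \<in> Z \<Longrightarrow> cspan p X Z z"
| cobdry: "cobdry p X \<phi> \<Longrightarrow> cspan p X Z \<phi>"
| diff: "cspan p X Z \<phi> \<Longrightarrow> cspan p X Z \<psi> \<Longrightarrow> cspan p X Z (\<lambda>\<sigma>. \<phi> \<sigma> - \<psi> \<sigma>)"

lemma cspan_zero: "cspan p X Z (\<lambda>\<sigma>. 0)"
  by (rule cspan.cobdry[OF cobdry_zero])

lemma cspan_minus: "cspan p X Z \<phi> \<Longrightarrow> cspan p X Z (\<lambda>\<sigma>. - \<phi> \<sigma>)"
  using cspan.diff[OF cspan_zero] by fastforce

lemma cspan_add: "cspan p X Z \<phi> \<Longrightarrow> cspan p X Z \<psi> \<Longrightarrow> cspan p X Z (\<lambda>\<sigma>. \<phi> \<sigma> + \<psi> \<sigma>)"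
  using cspan.diff[OF _ cspan_minus] by fastforce

lemma cspan_cmul: assumes "cspan p X Z \<phi>" shows "cspan p X Z (\<lambda>\<sigma>. k * \<phi> \<sigma>)"
proof -
  have nat: "cspan p X Z (\<lambda>\<sigma>. int n * \<phi> \<sigma>)" for n
  proof (induction n)
    case 0 then show ?case by (simp add: cspan_zero)
  next
    case (Suc n) then show ?case using cspan_add[OF Suc assms] by (simp add: algebra_simps)
  qed
  show ?thesis
  proof (cases "k \<ge> 0")
    case True then show ?thesis using nat[of "nat k"] by simp
  next
    case False then show ?thesis using cspan_minus[OF nat[of "nat (-k)"]] by simp
  qed
qed

lemma cspan_cong:
  assumes "cspan p X Z \<phi>" "\<And>\<sigma>. singular_simplex p X \<sigma> \<Longrightarrow> \<phi> \<sigma> = \<psi> \<sigma>"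
  shows "cspan p X Z \<psi>"
proof -
  have "cobdry p X (\<lambda>\<sigma>. \<phi> \<sigma> - \<psi> \<sigma>)"
    by (rule cobdry_cong[OF _ cobdry_zero]) (simp add: assms(2))
  from cspan.diff[OF assms(1) cspan.cobdry[OF this]] show ?thesis by simp
qed

lemma cspan_subst:
  assumes "cspan p X Z \<phi>" "\<And>z. z \<in> Z \<Longrightarrow> cspan p X Z' z"
  shows "cspan p X Z' \<phi>"
  using assms(1) by induction (use assms(2) in \<open>auto intro: cspan.intros\<close>)

lemma cspan_mono: "cspan p X Z \<phi> \<Longrightarrow> Z \<subseteq> Z' \<Longrightarrow> cspan p X Z' \<phi>"
  by (erule cspan_subst) (auto intro: cspan.base)

lemma cspan_subtopology:
  "cspan p (subtopology T B) Z \<phi> \<Longrightarrow> A \<subseteq> B \<Longrightarrow> cspan p (subtopology T A) Z \<phi>"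
  by (induction rule: cspan.induct) (auto intro: cspan.intros cobdry_mono)

text \<open>The members of \<open>\<Y>\<close> are model spaces together with maps into them. Asking for a finite set of
  generators keeps finite generation available throughout the induction below; deducing it afterwards
  would need subgroups of finitely generated groups.\<close>

definition generated :: "nat \<Rightarrow> 'x topology \<Rightarrow> ('x topology \<times> ('x \<Rightarrow> 'x)) set \<Rightarrow> bool" where
  "generated p X \<Y> \<longleftrightarrow> (\<exists>Z. finite Z \<and>
     (\<forall>z\<in>Z. \<exists>Y q \<zeta>. (Y, q) \<in> \<Y> \<and> continuous_map X Y q \<and> cocycle p Y \<zeta> \<and> z = pullback p q \<zeta>) \<and>
     (\<forall>c. cocycle p X c \<longrightarrow> cspan p X Z c))"

text \<open>A pullback along a map that factors through \<open>q'\<close> is a pullback along \<open>q'\<close>, and pullbacks of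
  coboundaries contribute nothing to a span.\<close>

lemma generated_refine:
  assumes g: "generated p X \<Y>"
    and r: "\<And>Y q. \<lbrakk>(Y, q) \<in> \<Y>; continuous_map X Y q\<rbrakk> \<Longrightarrow> (\<forall>c. cocycle p Y c \<longrightarrow> cobdry p Y c) \<or>
      (\<exists>Y' q' h. (Y', q') \<in> \<Y>' \<and> continuous_map X Y' q' \<and> continuous_map Y' Y h \<and> (\<forall>x \<in> topspace X. q x = h (q' x)))"
  shows "generated p X \<Y>'"
proof -
  let ?ok = "\<lambda>z. \<exists>Y q \<zeta>. (Y, q) \<in> \<Y>' \<and> continuous_map X Y q \<and> cocycle p Y \<zeta> \<and> z = pullback p q \<zeta>"
  obtain Z where Z: "finite Z"
     "\<And>z. z \<in> Z \<Longrightarrow> \<exists>Y q \<zeta>. (Y, q) \<in> \<Y> \<and> continuous_map X Y q \<and> cocycle p Y \<zeta> \<and> z = pullback p q \<zeta>"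
     "\<And>c. cocycle p X c \<Longrightarrow> cspan p X Z c"
    using g unfolding generated_def by blast
  have "\<exists>W. finite W \<and> (\<forall>w\<in>W. ?ok w) \<and> cspan p X W z" if "z \<in> Z" for z
  proof -
    obtain Y q \<zeta> where q: "(Y, q) \<in> \<Y>" "continuous_map X Y q" "cocycle p Y \<zeta>" "z = pullback p q \<zeta>"
      using Z(2) \<open>z \<in> Z\<close> by blast
    consider "\<forall>c. cocycle p Y c \<longrightarrow> cobdry p Y c"
      | Y' q' h where "(Y', q') \<in> \<Y>'" "continuous_map X Y' q'" "continuous_map Y' Y h" "\<And>x. x \<in> topspace X \<Longrightarrow> q x = h (q' x)"
      using r[OF q(1,2)] by blast
    then show ?thesis
    proof cases
      case 1
      then have "cobdry p X z" using q cobdry_pullback by blast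
      then show ?thesis by (intro exI[of _ "{}"]) (auto intro: cspan.cobdry)
    next
      case 2
      define w where "w = pullback p q' (pullback p h \<zeta>)"
      have "?ok w" using 2 q cocycle_pullback w_def by blast
      moreover have "cspan p X {w} z"
      proof (rule cspan_cong[of _ _ _ w])
        fix \<sigma> assume s: "singular_simplex p X \<sigma>"
        have "simplex_map p q \<sigma> = simplex_map p (h \<circ> q') \<sigma>"
          by (rule simplex_map_eq[OF s]) (simp add: 2)
        then show "w \<sigma> = z \<sigma>" by (simp add: w_def q(4) pullback_def simplex_map_compose)
      qed (auto intro: cspan.base)
      ultimately show ?thesis by blast
    qed
  qed
  then obtain W where W: "\<And>z. z \<in> Z \<Longrightarrow> finite (W z)" "\<And>z w. z \<in> Z \<Longrightarrow> w \<in> W z \<Longrightarrow> ?ok w"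
      "\<And>z. z \<in> Z \<Longrightarrow> cspan p X (W z) z"
    by metis
  have "cspan p X (\<Union>(W ` Z)) c" if "cocycle p X c" for c
    by (rule cspan_subst[OF Z(3)[OF that]]) (use W(3) cspan_mono in blast)
  moreover have "finite (\<Union>(W ` Z))" using Z(1) W(1) by blast
  moreover have "\<forall>w\<in>\<Union>(W ` Z). ?ok w" using W(2) by blast
  ultimately show ?thesis unfolding generated_def by blast
qed

lemma generated_mono: "generated p X \<Y> \<Longrightarrow> \<Y> \<subseteq> \<Y>' \<Longrightarrow> generated p X \<Y>'"
  unfolding generated_def by (meson subsetD)

section \<open>Cohomology in degree zero\<close>

text \<open>This takes the place of path connectedness; it also holds for the empty space.\<close>

definition h0_const :: "'x topology \<Rightarrow> bool" where
  "h0_const X \<longleftrightarrow> (\<forall>c. cocycle 0 X c \<longrightarrow> (\<exists>n. \<forall>\<sigma>. singular_simplex 0 X \<sigma> \<longrightarrow> c \<sigma> = n))"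

lemma cocycle_const: "cocycle 0 X (\<lambda>_. n)"
proof -
  have "ceval (\<lambda>_. n) (bdry (Suc 0) \<sigma>) = 0" for \<sigma> :: "(nat \<Rightarrow> real) \<Rightarrow> 'a"
    by (simp add: bdry_def chain_boundary_of ceval_diff)
  then show ?thesis by (simp add: cocycle_def)
qed

lemma h0_const_gen:
  assumes "h0_const X" "continuous_map X Y q" shows "generated 0 X {(Y, q)}"
proof -
  let ?z = "pullback 0 q (\<lambda>_. 1)"
  have "cspan 0 X {?z} c" if "cocycle 0 X c" for c
  proof -
    obtain n where "\<And>\<sigma>. singular_simplex 0 X \<sigma> \<Longrightarrow> c \<sigma> = n"
      using assms(1) \<open>cocycle 0 X c\<close> unfolding h0_const_def by auto
    then show ?thesis
      by (intro cspan_cong[OF cspan_cmul[OF cspan.base[of ?z], of _ _ _ n]]) (auto simp: pullback_def)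
  qed
  then show ?thesis unfolding generated_def using cocycle_const assms(2)
    by (intro exI[of _ "{?z}"]) blast
qed

lemma singular_simplex_0_point:
  assumes "singular_simplex 0 T \<sigma>"
  shows "singular_simplex 0 (subtopology T S) \<sigma> \<longleftrightarrow> \<sigma> (\<lambda>j. if j = 0 then 1 else 0) \<in> S"
  using assms by (auto simp: singular_simplex_subtopology standard_simplex_0)

lemma h0_const_Un:
  assumes "h0_const (subtopology T P)" "h0_const (subtopology T N)" "x \<in> P \<inter> N" "x \<in> topspace T"
  shows "h0_const (subtopology T (P \<union> N))"
  unfolding h0_const_def
proof (intro allI impI)
  fix c assume c: "cocycle 0 (subtopology T (P \<union> N)) c"
  obtain m where m: "\<And>\<sigma>. singular_simplex 0 (subtopology T P) \<sigma> \<Longrightarrow> c \<sigma> = m"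
    using assms(1) cocycle_mono[OF c, of P] unfolding h0_const_def by blast
  obtain n where n: "\<And>\<sigma>. singular_simplex 0 (subtopology T N) \<sigma> \<Longrightarrow> c \<sigma> = n"
    using assms(2) cocycle_mono[OF c, of N] unfolding h0_const_def by blast
  let ?s = "\<lambda>y\<in>standard_simplex 0. x"
  have s: "singular_simplex 0 T ?s"
    using assms(4) by (simp add: singular_simplex_def)
  have "?s (\<lambda>j. if j = 0 then 1 else 0) = x" by (simp add: standard_simplex_0)
  with singular_simplex_0_point[OF s] have "c ?s = m" "c ?s = n"
    using assms(3) m n by auto
  then have "c \<sigma> = m" if "singular_simplex 0 (subtopology T (P \<union> N)) \<sigma>" for \<sigma>
  proof -
    have t: "singular_simplex 0 T \<sigma>" using that by (simp add: singular_simplex_subtopology)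
    have "singular_simplex 0 (subtopology T P) \<sigma> \<or> singular_simplex 0 (subtopology T N) \<sigma>"
      using that unfolding singular_simplex_0_point[OF t] by auto
    then show ?thesis using m n \<open>c ?s = m\<close> \<open>c ?s = n\<close> by metis
  qed
  then show "\<exists>n. \<forall>\<sigma>. singular_simplex 0 (subtopology T (P \<union> N)) \<sigma> \<longrightarrow> c \<sigma> = n" by blast
qed

text \<open>A singular simplex of degree 1 has connected image, and a continuous function without zeros has
  constant sign on it.\<close>

lemma cocycle_sign:
  assumes g: "continuous_map X euclideanreal g" "\<And>x. x \<in> topspace X \<Longrightarrow> g x \<noteq> 0"
  shows "cocycle 0 X (\<lambda>\<sigma>. if g (\<sigma> (\<lambda>j. if j = 0 then 1 else 0)) > 0 then 1 else 0)"
  unfolding cocycle_def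
proof (intro allI impI)
  fix \<sigma> assume s: "singular_simplex (Suc 0) X \<sigma>"
  let ?D = "standard_simplex (Suc 0)" and ?v = "\<lambda>j. if j = 0 then 1 else (0::real)"
  let ?f = "\<lambda>k. singular_face (Suc 0) k \<sigma> ?v"
  have face: "?f k = \<sigma> (simplical_face k ?v)" "simplical_face k ?v \<in> ?D" if "k \<le> Suc 0" for k
    using that simplical_face_in_standard_simplex[of 1 k ?v] by (auto simp: singular_face_def standard_simplex_0)
  have con: "continuous_map (subtopology (powertop_real UNIV) ?D) euclideanreal (g \<circ> \<sigma>)"
    using s g(1) continuous_map_compose unfolding singular_simplex_def by blast
  have "connectedin (subtopology (powertop_real UNIV) ?D) ?D"
    using connectedin_standard_simplex[of "Suc 0"] by (simp add: connectedin_subtopology)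
  from connectedin_continuous_map_image[OF con this]
  have conn: "topological_space_class.connected ((g \<circ> \<sigma>) ` ?D)" by simp
  have nz: "0 \<notin> (g \<circ> \<sigma>) ` ?D"
    using s g(2) by (auto simp: singular_simplex_def continuous_map_def Pi_iff)
  have "g (?f 0) > 0 \<longleftrightarrow> g (?f 1) > 0"
  proof -
    have in01: "g (?f 0) \<in> (g \<circ> \<sigma>) ` ?D" "g (?f 1) \<in> (g \<circ> \<sigma>) ` ?D" using face[of 0] face[of 1] by auto
    then show ?thesis
      using conn nz connected_contains_Icc[OF conn in01] connected_contains_Icc[OF conn in01(2,1)]
      by (smt (verit) atLeastAtMost_iff subsetD)
  qed
  then show "ceval (\<lambda>\<sigma>. if g (\<sigma> ?v) > 0 then 1 else 0) (bdry (Suc 0) \<sigma>) = 0"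
    by (simp add: bdry_def chain_boundary_of ceval_diff)
qed

section \<open>Mayer--Vietoris for two open sets\<close>

definition small_simplices :: "'x topology \<Rightarrow> 'x set \<Rightarrow> 'x set \<Rightarrow> nat \<Rightarrow> 'x sing_simplex set" where
  "small_simplices T A B p = singular_simplex_set p (subtopology T A) \<union> singular_simplex_set p (subtopology T B)"

lemma subcomplex_small_simplices: "subcomplex (subtopology T (A \<union> B)) (small_simplices T A B)"
  unfolding subcomplex_def
proof (intro conjI allI ballI impI)
  fix p show "small_simplices T A B p \<subseteq> singular_simplex_set p (subtopology T (A \<union> B))"
    unfolding small_simplices_def using singular_simplex_mono[of p T A _ "A \<union> B"] singular_simplex_mono[of p T B _ "A \<union> B"] by blast
next
  fix p \<sigma> k assume "\<sigma> \<in> small_simplices T A B (Suc p)" "k \<le> Suc p"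
  then show "singular_face (Suc p) k \<sigma> \<in> small_simplices T A B p"
    using singular_simplex_singular_face[of "Suc p" _ \<sigma> k] by (auto simp: small_simplices_def)
qed

lemma small_simplices_split:
  "Poly_Mapping.keys c \<subseteq> small_simplices T A B p \<longleftrightarrow>
   (\<exists>d e. c = d + e \<and> singular_chain p (subtopology T A) d \<and> singular_chain p (subtopology T B) e)"
proof
  assume "Poly_Mapping.keys c \<subseteq> small_simplices T A B p"
  then show "\<exists>d e. c = d + e \<and> singular_chain p (subtopology T A) d \<and> singular_chain p (subtopology T B) e"
    unfolding small_simplices_def singular_chain_def by (metis frag_split)
next
  assume "\<exists>d e. c = d + e \<and> singular_chain p (subtopology T A) d \<and> singular_chain p (subtopology T B) e"
  then show "Poly_Mapping.keys c \<subseteq> small_simplices T A B p"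
    using keys_add unfolding small_simplices_def singular_chain_def by fastforce
qed

text \<open>Iterated subdivision moves every chain into the span of the simplices in \<open>A\<close> or \<open>B\<close>. The homotopy
  between subdivision and identity does not leave any subspace that contains the chain, so it maps
  the boundary, which is small already, to a small chain.\<close>

lemma acyclic_small_simplices:
  assumes "openin T A" "openin T B"
  shows "acyclic_pair (subtopology T (A \<union> B)) (small_simplices T A B)"
  unfolding acyclic_pair_def
proof (intro allI impI)
  let ?X = "subtopology T (A \<union> B)"
  fix p z assume z: "singular_chain p ?X z"
    and dz: "Poly_Mapping.keys (chain_boundary p z) \<subseteq> small_simplices T A B (p - 1)"
  have op: "\<And>U. U \<in> {A, B} \<Longrightarrow> openin ?X U"
  proof -
    fix U assume "U \<in> {A, B}"
    then have "openin T U" "U = U \<inter> (A \<union> B)" using assms by auto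
    then show "openin ?X U" unfolding openin_subtopology by blast
  qed
  obtain n where n: "\<And>f. f \<in> Poly_Mapping.keys ((singular_subdivision p ^^ n) z)
                      \<Longrightarrow> \<exists>V \<in> {A, B}. f \<in> (standard_simplex p) \<rightarrow> V"
  proof -
    have X: "topspace ?X \<subseteq> \<Union>{A, B}" by auto
    show thesis
    proof (rule sufficient_iterated_singular_subdivision_exists[OF op X z])
      fix n assume *: "\<And>m f. \<lbrakk>n \<le> m; f \<in> Poly_Mapping.keys ((singular_subdivision p ^^ m) z)\<rbrakk>
                      \<Longrightarrow> \<exists>V \<in> {A, B}. f \<in> (standard_simplex p) \<rightarrow> V"
      show thesis by (rule that[of n], rule *[OF order_refl])
    qed
  qed
  obtain h where h: "\<And>p. h p 0 = (0 :: 'a chain)"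
        "\<And>p c1 c2. h p (c1-c2) = h p c1 - h p c2"
        "\<And>p X c. singular_chain p X c \<Longrightarrow> singular_chain (Suc p) X (h p c)"
        "\<And>p X c. singular_chain p X c
                 \<Longrightarrow> chain_boundary (Suc p) (h p c) + h (p - Suc 0) (chain_boundary p c)
                   = (singular_subdivision p ^^ n) c - c"
    using chain_homotopic_iterated_singular_subdivision[of n] by blast
  have hadd: "h p (c1 + c2) = h p c1 + h p c2" for p c1 c2
    using h(2)[of p "c1 + c2" c2] by (simp add: algebra_simps)
  let ?z' = "(singular_subdivision p ^^ n) z"
  have z': "singular_chain p ?X ?z'"
    by (induction n) (auto simp: singular_chain_singular_subdivision z)
  have k1: "Poly_Mapping.keys ?z' \<subseteq> small_simplices T A B p"
    using n z' unfolding small_simplices_def singular_chain_def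
    by (fastforce simp: singular_simplex_subtopology)
  have k2: "Poly_Mapping.keys (h (p - 1) (chain_boundary p z)) \<subseteq> small_simplices T A B p"
  proof (cases p)
    case 0 then show ?thesis by (simp add: chain_boundary_def h)
  next
    case (Suc r)
    with dz obtain d e where "chain_boundary p z = d + e" "singular_chain r (subtopology T A) d" "singular_chain r (subtopology T B) e"
      unfolding small_simplices_split by auto
    then show ?thesis using h(3)[of r _ d] h(3)[of r _ e] Suc unfolding small_simplices_split by (simp add: hadd) blast
  qed
  have "z - chain_boundary (Suc p) (- h p z) = ?z' - h (p - 1) (chain_boundary p z)"
    using h(4)[OF z] by (simp add: chain_boundary_minus algebra_simps)
  then have "Poly_Mapping.keys (z - chain_boundary (Suc p) (- h p z)) \<subseteq> small_simplices T A B p"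
    using k1 k2 keys_diff by fastforce
  then show "\<exists>w. singular_chain (Suc p) ?X w \<and> Poly_Mapping.keys (z - chain_boundary (Suc p) w) \<subseteq> small_simplices T A B p"
    using h(3)[OF z] singular_chain_minus by blast
qed

text \<open>The class of \<open>\<gamma>\<close> is the image of the class of \<open>\<alpha>\<close> under the connecting homomorphism of the cover by
  \<open>A\<close> and \<open>B\<close>. For this relation between cocycles, additivity and naturality hold by inspection, while
  a map between cohomology groups would first have to be shown well defined.\<close>

definition mv_related :: "nat \<Rightarrow> 'x topology \<Rightarrow> 'x set \<Rightarrow> 'x set \<Rightarrow> 'x cochain \<Rightarrow> 'x cochain \<Rightarrow> bool" where
  "mv_related p T A B \<alpha> \<gamma> \<longleftrightarrow> (\<exists>a b.
     (\<forall>\<sigma>. singular_simplex p (subtopology T (A \<inter> B)) \<sigma> \<longrightarrow> \<alpha> \<sigma> = a \<sigma> - b \<sigma>) \<and>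
     (\<forall>\<tau>. singular_simplex (Suc p) (subtopology T A) \<tau> \<longrightarrow> \<gamma> \<tau> = ceval a (bdry (Suc p) \<tau>)) \<and>
     (\<forall>\<tau>. singular_simplex (Suc p) (subtopology T B) \<tau> \<longrightarrow> \<gamma> \<tau> = ceval b (bdry (Suc p) \<tau>)))"

lemma mv_relatedE:
  assumes "mv_related p T A B \<alpha> \<gamma>"
  obtains a b where
     "\<And>\<sigma>. singular_simplex p (subtopology T (A \<inter> B)) \<sigma> \<Longrightarrow> \<alpha> \<sigma> = a \<sigma> - b \<sigma>"
     "\<And>\<tau>. singular_simplex (Suc p) (subtopology T A) \<tau> \<Longrightarrow> \<gamma> \<tau> = ceval a (bdry (Suc p) \<tau>)"
     "\<And>\<tau>. singular_simplex (Suc p) (subtopology T B) \<tau> \<Longrightarrow> \<gamma> \<tau> = ceval b (bdry (Suc p) \<tau>)"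
  using assms unfolding mv_related_def by blast

lemma mv_relatedI:
  assumes
     "\<And>\<sigma>. singular_simplex p (subtopology T (A \<inter> B)) \<sigma> \<Longrightarrow> \<alpha> \<sigma> = a \<sigma> - b \<sigma>"
     "\<And>\<tau>. singular_simplex (Suc p) (subtopology T A) \<tau> \<Longrightarrow> \<gamma> \<tau> = ceval a (bdry (Suc p) \<tau>)"
     "\<And>\<tau>. singular_simplex (Suc p) (subtopology T B) \<tau> \<Longrightarrow> \<gamma> \<tau> = ceval b (bdry (Suc p) \<tau>)"
  shows "mv_related p T A B \<alpha> \<gamma>"
  using assms unfolding mv_related_def by blast

lemma mv_related_diff:
  assumes "mv_related p T A B \<alpha> \<gamma>" "mv_related p T A B \<alpha>' \<gamma>'"
  shows "mv_related p T A B (\<lambda>\<sigma>. \<alpha> \<sigma> - \<alpha>' \<sigma>) (\<lambda>\<sigma>. \<gamma> \<sigma> - \<gamma>' \<sigma>)"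
proof -
  obtain a b where 1:
     "\<And>\<sigma>. singular_simplex p (subtopology T (A \<inter> B)) \<sigma> \<Longrightarrow> \<alpha> \<sigma> = a \<sigma> - b \<sigma>"
     "\<And>\<tau>. singular_simplex (Suc p) (subtopology T A) \<tau> \<Longrightarrow> \<gamma> \<tau> = ceval a (bdry (Suc p) \<tau>)"
     "\<And>\<tau>. singular_simplex (Suc p) (subtopology T B) \<tau> \<Longrightarrow> \<gamma> \<tau> = ceval b (bdry (Suc p) \<tau>)"
    by (rule mv_relatedE[OF assms(1)]) (use that in blast)
  obtain a' b' where 2:
     "\<And>\<sigma>. singular_simplex p (subtopology T (A \<inter> B)) \<sigma> \<Longrightarrow> \<alpha>' \<sigma> = a' \<sigma> - b' \<sigma>"
     "\<And>\<tau>. singular_simplex (Suc p) (subtopology T A) \<tau> \<Longrightarrow> \<gamma>' \<tau> = ceval a' (bdry (Suc p) \<tau>)"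
     "\<And>\<tau>. singular_simplex (Suc p) (subtopology T B) \<tau> \<Longrightarrow> \<gamma>' \<tau> = ceval b' (bdry (Suc p) \<tau>)"
    by (rule mv_relatedE[OF assms(2)]) (use that in blast)
  show ?thesis
    by (rule mv_relatedI[of _ _ _ _ _ "\<lambda>\<sigma>. a \<sigma> - a' \<sigma>" "\<lambda>\<sigma>. b \<sigma> - b' \<sigma>"]) (simp_all add: 1 2 ceval_fun_diff)
qed

lemma mv_related_pullback:
  assumes r: "mv_related p T' A' B' \<alpha> \<gamma>"
    and q: "continuous_map T T' q" "q \<in> A \<rightarrow> A'" "q \<in> B \<rightarrow> B'"
  shows "mv_related p T A B (pullback p q \<alpha>) (pullback (Suc p) q \<gamma>)"
proof -
  obtain a b where 1:
     "\<And>\<sigma>. singular_simplex p (subtopology T' (A' \<inter> B')) \<sigma> \<Longrightarrow> \<alpha> \<sigma> = a \<sigma> - b \<sigma>"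
     "\<And>\<tau>. singular_simplex (Suc p) (subtopology T' A') \<tau> \<Longrightarrow> \<gamma> \<tau> = ceval a (bdry (Suc p) \<tau>)"
     "\<And>\<tau>. singular_simplex (Suc p) (subtopology T' B') \<tau> \<Longrightarrow> \<gamma> \<tau> = ceval b (bdry (Suc p) \<tau>)"
    by (rule mv_relatedE[OF r]) (use that in blast)
  have c: "continuous_map (subtopology T S) (subtopology T' S') q" if "q \<in> S \<rightarrow> S'" for S S'
    using q(1) that by (auto simp: continuous_map_in_subtopology continuous_map_from_subtopology)
  have AB: "q \<in> A \<inter> B \<rightarrow> A' \<inter> B'" using q by auto
  show ?thesis
  proof (rule mv_relatedI[of _ _ _ _ _ "pullback p q a" "pullback p q b"])
    fix \<sigma> assume "singular_simplex p (subtopology T (A \<inter> B)) \<sigma>"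
    from singular_simplex_simplex_map[OF this c[OF AB]]
    show "pullback p q \<alpha> \<sigma> = pullback p q a \<sigma> - pullback p q b \<sigma>" by (simp add: pullback_def 1)
  next
    fix \<tau> assume t: "singular_simplex (Suc p) (subtopology T A) \<tau>"
    from singular_simplex_simplex_map[OF this c[OF q(2)]]
    show "pullback (Suc p) q \<gamma> \<tau> = ceval (pullback p q a) (bdry (Suc p) \<tau>)"
      by (simp add: pullback_def[of "Suc p"] 1 ceval_pullback bdry_simplex_map[OF t])
  next
    fix \<tau> assume t: "singular_simplex (Suc p) (subtopology T B) \<tau>"
    from singular_simplex_simplex_map[OF this c[OF q(3)]]
    show "pullback (Suc p) q \<gamma> \<tau> = ceval (pullback p q b) (bdry (Suc p) \<tau>)"
      by (simp add: pullback_def[of "Suc p"] 1 ceval_pullback bdry_simplex_map[OF t])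
  qed
qed

text \<open>The coboundary of \<open>\<alpha>\<close> on simplices in \<open>A\<close> and zero on simplices in \<open>B\<close> agree on the intersection,
  because \<open>\<alpha>\<close> is a cocycle there; the resulting cocycle on small simplices extends.\<close>

lemma mv_connecting:
  assumes o: "openin T A" "openin T B" and \<alpha>: "cocycle p (subtopology T (A \<inter> B)) \<alpha>"
  obtains \<gamma> where "cocycle (Suc p) (subtopology T (A \<union> B)) \<gamma>" "mv_related p T A B \<alpha> \<gamma>"
proof -
  define \<beta> where "\<beta> \<tau> = (if singular_simplex (Suc p) (subtopology T A) \<tau> then ceval \<alpha> (bdry (Suc p) \<tau>) else 0)" for \<tau>
  have \<beta>B: "\<beta> \<tau> = 0" if "singular_simplex (Suc p) (subtopology T B) \<tau>" for \<tau>
    using \<alpha> that by (auto simp: \<beta>_def cocycle_def singular_simplex_subtopology)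
  have "ceval \<beta> (bdry (Suc (Suc p)) \<sigma>) = 0" if sm: "\<sigma> \<in> small_simplices T A B (Suc (Suc p))" for \<sigma>
  proof -
    consider "singular_simplex (Suc (Suc p)) (subtopology T A) \<sigma>" | "singular_simplex (Suc (Suc p)) (subtopology T B) \<sigma>"
      using sm by (auto simp: small_simplices_def)
    then show ?thesis
    proof cases
      case 1
      have "ceval \<beta> (bdry (Suc (Suc p)) \<sigma>) = ceval (\<lambda>\<tau>. ceval \<alpha> (bdry (Suc p) \<tau>)) (bdry (Suc (Suc p)) \<sigma>)"
        by (rule ceval_cong) (use singular_chain_bdry[OF 1] in \<open>auto simp: \<beta>_def singular_chain_def\<close>)
      then show ?thesis by (simp flip: ceval_chain_boundary add: chain_boundary_bdry[OF 1])
    next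
      case 2
      have "ceval \<beta> (bdry (Suc (Suc p)) \<sigma>) = ceval (\<lambda>\<tau>. 0) (bdry (Suc (Suc p)) \<sigma>)"
        by (rule ceval_cong) (use singular_chain_bdry[OF 2] \<beta>B in \<open>auto simp: singular_chain_def\<close>)
      then show ?thesis by simp
    qed
  qed
  then obtain \<gamma> where \<gamma>: "cocycle (Suc p) (subtopology T (A \<union> B)) \<gamma>" "\<And>\<sigma>. \<sigma> \<in> small_simplices T A B (Suc p) \<Longrightarrow> \<gamma> \<sigma> = \<beta> \<sigma>"
    using cocycle_extend_from_subcomplex[OF subcomplex_small_simplices acyclic_small_simplices[OF o]] by blast
  have "mv_related p T A B \<alpha> \<gamma>"
    by (rule mv_relatedI[of _ _ _ _ _ \<alpha> "\<lambda>_. 0"]) (use \<gamma>(2) \<beta>B in \<open>auto simp: small_simplices_def \<beta>_def\<close>)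
  with \<gamma>(1) show ?thesis by (rule that)
qed

text \<open>If \<open>\<alpha>\<close> is the coboundary of \<open>\<eta>\<close>, subtracting the coboundary of \<open>\<eta>\<close> from the primitive of \<open>\<gamma>\<close> on \<open>A\<close>
  makes it agree with the primitive on \<open>B\<close>, and the two glue to a primitive on small simplices.\<close>

lemma mv_related_cobdry_imp_cobdry:
  assumes o: "openin T A" "openin T B" and \<alpha>: "cobdry p (subtopology T (A \<inter> B)) \<alpha>"
    and r: "mv_related p T A B \<alpha> \<gamma>" and \<gamma>: "cocycle (Suc p) (subtopology T (A \<union> B)) \<gamma>"
  shows "cobdry (Suc p) (subtopology T (A \<union> B)) \<gamma>"
proof -
  obtain \<eta> where \<eta>: "\<And>\<sigma>. singular_simplex p (subtopology T (A \<inter> B)) \<sigma> \<Longrightarrow> \<alpha> \<sigma> = ceval \<eta> (bdry p \<sigma>)"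
    by (rule cobdryE[OF \<alpha>]) (use that in blast)
  obtain a b where 1:
     "\<And>\<sigma>. singular_simplex p (subtopology T (A \<inter> B)) \<sigma> \<Longrightarrow> \<alpha> \<sigma> = a \<sigma> - b \<sigma>"
     "\<And>\<tau>. singular_simplex (Suc p) (subtopology T A) \<tau> \<Longrightarrow> \<gamma> \<tau> = ceval a (bdry (Suc p) \<tau>)"
     "\<And>\<tau>. singular_simplex (Suc p) (subtopology T B) \<tau> \<Longrightarrow> \<gamma> \<tau> = ceval b (bdry (Suc p) \<tau>)"
    by (rule mv_relatedE[OF r]) (use that in blast)
  define \<theta> where "\<theta> \<sigma> = (if singular_simplex p (subtopology T A) \<sigma> then a \<sigma> - ceval \<eta> (bdry p \<sigma>) else b \<sigma>)" for \<sigma>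
  have \<theta>B: "\<theta> \<sigma> = b \<sigma>" if "singular_simplex p (subtopology T B) \<sigma>" for \<sigma>
  proof (cases "singular_simplex p (subtopology T A) \<sigma>")
    case True
    with that have "singular_simplex p (subtopology T (A \<inter> B)) \<sigma>" by (auto simp: singular_simplex_subtopology)
    then show ?thesis using 1(1) \<eta> True by (fastforce simp: \<theta>_def)
  qed (simp add: \<theta>_def)
  show ?thesis
  proof (rule cobdry_if_cobdry_on_subcomplex[OF subcomplex_small_simplices acyclic_small_simplices[OF o] \<gamma>, of \<theta>])
    fix \<tau> assume "\<tau> \<in> small_simplices T A B (Suc p)"
    then consider "singular_simplex (Suc p) (subtopology T A) \<tau>" | "singular_simplex (Suc p) (subtopology T B) \<tau>"
      by (auto simp: small_simplices_def)
    then show "\<gamma> \<tau> = ceval \<theta> (bdry (Suc p) \<tau>)"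
    proof cases
      case 1
      have "ceval \<theta> (bdry (Suc p) \<tau>) = ceval (\<lambda>\<sigma>. a \<sigma> - ceval \<eta> (bdry p \<sigma>)) (bdry (Suc p) \<tau>)"
        by (rule ceval_cong) (use singular_chain_bdry[OF 1] in \<open>auto simp: \<theta>_def singular_chain_def\<close>)
      then show ?thesis
        using \<open>\<And>\<tau>. singular_simplex (Suc p) (subtopology T A) \<tau> \<Longrightarrow> \<gamma> \<tau> = ceval a (bdry (Suc p) \<tau>)\<close>[OF 1]
        by (simp add: ceval_fun_diff chain_boundary_bdry[OF 1] flip: ceval_chain_boundary)
    next
      case 2
      have "ceval \<theta> (bdry (Suc p) \<tau>) = ceval b (bdry (Suc p) \<tau>)"
        by (rule ceval_cong) (use singular_chain_bdry[OF 2] \<theta>B in \<open>auto simp: singular_chain_def\<close>)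
      then show ?thesis using 1(3)[OF 2] by simp
    qed
  qed
qed

text \<open>Exactness at the union: two primitives of \<open>\<gamma>\<close> differ by a cocycle on the intersection.\<close>

lemma mv_related_of_cobs:
  assumes "cobdry (Suc p) (subtopology T A) \<gamma>" "cobdry (Suc p) (subtopology T B) \<gamma>"
  obtains \<alpha> where "cocycle p (subtopology T (A \<inter> B)) \<alpha>" "mv_related p T A B \<alpha> \<gamma>"
proof -
  obtain a where a: "\<And>\<tau>. singular_simplex (Suc p) (subtopology T A) \<tau> \<Longrightarrow> \<gamma> \<tau> = ceval a (bdry (Suc p) \<tau>)"
    by (rule cobdryE[OF assms(1)]) (use that in blast)
  obtain b where b: "\<And>\<tau>. singular_simplex (Suc p) (subtopology T B) \<tau> \<Longrightarrow> \<gamma> \<tau> = ceval b (bdry (Suc p) \<tau>)"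
    by (rule cobdryE[OF assms(2)]) (use that in blast)
  have "ceval (\<lambda>\<sigma>. a \<sigma> - b \<sigma>) (bdry (Suc p) \<tau>) = 0" if "singular_simplex (Suc p) (subtopology T (A \<inter> B)) \<tau>" for \<tau>
    using a[of \<tau>] b[of \<tau>] that by (simp add: ceval_fun_diff singular_simplex_subtopology)
  then have "cocycle p (subtopology T (A \<inter> B)) (\<lambda>\<sigma>. a \<sigma> - b \<sigma>)" by (simp add: cocycle_def)
  moreover have "mv_related p T A B (\<lambda>\<sigma>. a \<sigma> - b \<sigma>) \<gamma>"
    by (rule mv_relatedI[of _ _ _ _ _ a b]) (use a b in auto)
  ultimately show ?thesis by (rule that)
qed

text \<open>Exactness at the intersection: primitives of zero are cocycles.\<close>

lemma mv_related_cobdry_split: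
  assumes "mv_related p T A B \<alpha> (\<lambda>_. 0)"
  obtains a b where "cocycle p (subtopology T A) a" "cocycle p (subtopology T B) b"
    "\<And>\<sigma>. singular_simplex p (subtopology T (A \<inter> B)) \<sigma> \<Longrightarrow> \<alpha> \<sigma> = a \<sigma> - b \<sigma>"
proof -
  obtain a b where
     "\<And>\<sigma>. singular_simplex p (subtopology T (A \<inter> B)) \<sigma> \<Longrightarrow> \<alpha> \<sigma> = a \<sigma> - b \<sigma>"
     "\<And>\<tau>. singular_simplex (Suc p) (subtopology T A) \<tau> \<Longrightarrow> 0 = ceval a (bdry (Suc p) \<tau>)"
     "\<And>\<tau>. singular_simplex (Suc p) (subtopology T B) \<tau> \<Longrightarrow> 0 = ceval b (bdry (Suc p) \<tau>)"
    by (rule mv_relatedE[OF assms]) (use that in blast)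
  then show ?thesis by (intro that[of a b]) (simp_all add: cocycle_def)
qed

text \<open>As \<open>P\<close> and \<open>N\<close> have no cohomology in degree \<open>j + 1\<close>, every class of the union is an image under the
  connecting homomorphism. By naturality the generators can be transferred on the model spaces. In
  the applications \<open>P\<close> and \<open>N\<close> are contractible, so the union is a suspension of the intersection.\<close>

theorem generated_union:
  assumes o: "openin T P" "openin T N"
    and van: "\<And>c. cocycle (Suc j) (subtopology T P) c \<Longrightarrow> cobdry (Suc j) (subtopology T P) c"
             "\<And>c. cocycle (Suc j) (subtopology T N) c \<Longrightarrow> cobdry (Suc j) (subtopology T N) c"
    and g: "generated j (subtopology T (P \<inter> N)) \<Y>"
    and Y: "\<And>Y q. (Y, q) \<in> \<Y> \<Longrightarrow> \<exists>T' P' N'. openin T' P' \<and> openin T' N' \<and> Y = subtopology T' (P' \<inter> N') \<and>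
       continuous_map T T' q \<and> q \<in> P \<rightarrow> P' \<and> q \<in> N \<rightarrow> N' \<and> (subtopology T' (P' \<union> N'), q) \<in> \<Y>'"
  shows "generated (Suc j) (subtopology T (P \<union> N)) \<Y>'"
proof -
  let ?X = "subtopology T (P \<union> N)"
  let ?ok = "\<lambda>z. \<exists>Y q \<zeta>. (Y, q) \<in> \<Y>' \<and> continuous_map ?X Y q \<and> cocycle (Suc j) Y \<zeta> \<and> z = pullback (Suc j) q \<zeta>"
  obtain Z where Z: "finite Z"
     "\<And>z. z \<in> Z \<Longrightarrow> \<exists>Y q \<zeta>. (Y, q) \<in> \<Y> \<and> continuous_map (subtopology T (P \<inter> N)) Y q \<and> cocycle j Y \<zeta> \<and> z = pullback j q \<zeta>"
     "\<And>c. cocycle j (subtopology T (P \<inter> N)) c \<Longrightarrow> cspan j (subtopology T (P \<inter> N)) Z c"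
    using g unfolding generated_def by blast
  have "\<exists>w. ?ok w \<and> mv_related j T P N z w" if "z \<in> Z" for z
  proof -
    obtain Y q \<zeta> where q: "(Y, q) \<in> \<Y>" "cocycle j Y \<zeta>" "z = pullback j q \<zeta>"
      using Z(2) \<open>z \<in> Z\<close> by blast
    obtain T' P' N' where T': "openin T' P'" "openin T' N'" "Y = subtopology T' (P' \<inter> N')"
       "continuous_map T T' q" "q \<in> P \<rightarrow> P'" "q \<in> N \<rightarrow> N'" "(subtopology T' (P' \<union> N'), q) \<in> \<Y>'"
      using Y[OF q(1)] by blast
    obtain \<gamma> where \<gamma>: "cocycle (Suc j) (subtopology T' (P' \<union> N')) \<gamma>" "mv_related j T' P' N' \<zeta> \<gamma>"
      using mv_connecting[OF T'(1,2)] q(2) T'(3) by blast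
    have "continuous_map ?X (subtopology T' (P' \<union> N')) q"
      using T'(4,5,6) by (auto simp: continuous_map_in_subtopology continuous_map_from_subtopology)
    then have "?ok (pullback (Suc j) q \<gamma>)" using T'(7) \<gamma>(1) by blast
    then show ?thesis using mv_related_pullback[OF \<gamma>(2) T'(4,5,6)] q(3) by blast
  qed
  then obtain w where w: "\<And>z. z \<in> Z \<Longrightarrow> ?ok (w z)" "\<And>z. z \<in> Z \<Longrightarrow> mv_related j T P N z (w z)" by metis
  have lift: "\<exists>\<gamma>. cspan (Suc j) ?X (w ` Z) \<gamma> \<and> mv_related j T P N \<alpha> \<gamma>" if "cspan j (subtopology T (P \<inter> N)) Z \<alpha>" for \<alpha>
    using that
  proof induction
    case (base z)
    then show ?case using w(2) by (meson cspan.base imageI)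
  next
    case (cobdry \<phi>)
    then obtain \<eta> where \<eta>: "\<And>\<sigma>. singular_simplex j (subtopology T (P \<inter> N)) \<sigma> \<Longrightarrow> \<phi> \<sigma> = ceval \<eta> (bdry j \<sigma>)"
      by (rule cobdryE) (use that in blast)
    have "mv_related j T P N \<phi> (\<lambda>_. 0)"
    proof (rule mv_relatedI[of _ _ _ _ _ "\<lambda>\<sigma>. ceval \<eta> (bdry j \<sigma>)" "\<lambda>_. 0"])
      fix \<tau> assume t: "singular_simplex (Suc j) (subtopology T P) \<tau>"
      show "0 = ceval (\<lambda>\<sigma>. ceval \<eta> (bdry j \<sigma>)) (bdry (Suc j) \<tau>)"
        by (simp flip: ceval_chain_boundary add: chain_boundary_bdry[OF t])
    qed (simp_all add: \<eta>)
    then show ?case using cspan_zero by blast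
  next
    case (diff \<phi> \<psi>)
    then obtain g1 g2 where g: "cspan (Suc j) ?X (w ` Z) g1" "mv_related j T P N \<phi> g1"
      "cspan (Suc j) ?X (w ` Z) g2" "mv_related j T P N \<psi> g2" by blast
    show ?case using mv_related_diff[OF g(2,4)] cspan.diff[OF g(1,3)] by blast
  qed
  have "cspan (Suc j) ?X (w ` Z) c" if c: "cocycle (Suc j) ?X c" for c
  proof -
    have "cobdry (Suc j) (subtopology T P) c" "cobdry (Suc j) (subtopology T N) c"
      using van cocycle_mono[OF c] by auto
    then obtain \<alpha> where \<alpha>: "cocycle j (subtopology T (P \<inter> N)) \<alpha>" "mv_related j T P N \<alpha> c"
      by (rule mv_related_of_cobs)
    obtain \<gamma> where \<gamma>: "cspan (Suc j) ?X (w ` Z) \<gamma>" "mv_related j T P N \<alpha> \<gamma>"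
      using lift Z(3) \<alpha>(1) by blast
    have wc: "cocycle (Suc j) ?X z" if zw: "z \<in> w ` Z" for z
    proof -
      obtain y where "y \<in> Z" "z = w y" using zw by blast
      from w(1)[OF this(1)] show ?thesis
        unfolding \<open>z = w y\<close> by (elim exE conjE) (simp add: cocycle_pullback)
    qed
    have "cocycle (Suc j) ?X \<gamma>"
      using \<gamma>(1)
    proof induction
      case (base z) then show ?case by (rule wc)
    next
      case (cobdry \<phi>) then show ?case by (rule cobdry_imp_cocycle)
    next
      case (diff \<phi> \<psi>) then show ?case by (intro cocycle_diff)
    qed
    then have "cobdry (Suc j) ?X (\<lambda>\<sigma>. c \<sigma> - \<gamma> \<sigma>)"
      using mv_related_cobdry_imp_cobdry[OF o _ mv_related_diff[OF \<alpha>(2) \<gamma>(2)] cocycle_diff[OF c]]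
        cobdry_zero[of j "subtopology T (P \<inter> N)"] by simp
    from cspan_add[OF cspan.cobdry[OF this] \<gamma>(1)] show ?thesis by simp
  qed
  moreover have "finite (w ` Z)" "\<forall>z \<in> w ` Z. ?ok z" using Z(1) w(1) by simp_all
  ultimately show ?thesis unfolding generated_def by blast
qed

text \<open>Classes on the models \<open>A' \<union> B'\<close> vanish on \<open>A'\<close> and on \<open>B'\<close>, so they lift through the connecting
  homomorphism to classes on \<open>A' \<inter> B'\<close>. Subtracting from a class on \<open>A \<inter> B\<close> the pullbacks of
  suitable lifts makes its image in the cohomology of the union zero, and what remains comes from \<open>A\<close>
  and \<open>B\<close>.\<close>

theorem generated_intersection:
  assumes o: "openin T A" "openin T B"
    and g: "generated (Suc i) (subtopology T (A \<union> B)) \<Y>"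
    and Y: "\<And>Y q. (Y, q) \<in> \<Y> \<Longrightarrow> \<exists>T' A' B'. Y = subtopology T' (A' \<union> B') \<and>
       (\<forall>c. cocycle (Suc i) Y c \<longrightarrow> cobdry (Suc i) (subtopology T' A') c \<and> cobdry (Suc i) (subtopology T' B') c) \<and>
       continuous_map T T' q \<and> q \<in> A \<rightarrow> A' \<and> q \<in> B \<rightarrow> B' \<and> (subtopology T' (A' \<inter> B'), q) \<in> \<Y>'"
    and gA: "generated i (subtopology T A) \<Y>'" and gB: "generated i (subtopology T B) \<Y>'"
  shows "generated i (subtopology T (A \<inter> B)) \<Y>'"
proof -
  let ?X = "subtopology T (A \<inter> B)"
  let ?ok = "\<lambda>z. \<exists>Y q \<zeta>. (Y, q) \<in> \<Y>' \<and> continuous_map ?X Y q \<and> cocycle i Y \<zeta> \<and> z = pullback i q \<zeta>"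
  obtain Z where Z: "finite Z"
     "\<And>z. z \<in> Z \<Longrightarrow> \<exists>Y q \<zeta>. (Y, q) \<in> \<Y> \<and> continuous_map (subtopology T (A \<union> B)) Y q \<and> cocycle (Suc i) Y \<zeta> \<and> z = pullback (Suc i) q \<zeta>"
     "\<And>c. cocycle (Suc i) (subtopology T (A \<union> B)) c \<Longrightarrow> cspan (Suc i) (subtopology T (A \<union> B)) Z c"
    using g unfolding generated_def by blast
  have sub: "\<exists>Z. finite Z \<and> (\<forall>z\<in>Z. ?ok z) \<and> (\<forall>c. cocycle i (subtopology T S) c \<longrightarrow> cspan i ?X Z c)"
    if gS: "generated i (subtopology T S) \<Y>'" and S: "A \<inter> B \<subseteq> S" for S
  proof -
    obtain Z where Z: "finite Z"
     "\<And>z. z \<in> Z \<Longrightarrow> \<exists>Y q \<zeta>. (Y, q) \<in> \<Y>' \<and> continuous_map (subtopology T S) Y q \<and> cocycle i Y \<zeta> \<and> z = pullback i q \<zeta>"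
     "\<And>c. cocycle i (subtopology T S) c \<Longrightarrow> cspan i (subtopology T S) Z c"
      using gS unfolding generated_def by blast
    have "?ok z" if zZ: "z \<in> Z" for z
    proof -
      obtain Y q \<zeta> where q: "(Y, q) \<in> \<Y>'" "continuous_map (subtopology T S) Y q" "cocycle i Y \<zeta>" "z = pullback i q \<zeta>"
        using Z(2)[OF zZ] by blast
      have "continuous_map ?X Y q"
        using continuous_map_from_subtopology_mono[OF q(2) S] .
      with q show ?thesis by blast
    qed
    moreover have "cspan i ?X Z c" if "cocycle i (subtopology T S) c" for c
      using cspan_subtopology[OF Z(3)[OF that] S] .
    ultimately show ?thesis using Z(1) by blast
  qed
  obtain ZA where ZA: "finite ZA" "\<forall>z\<in>ZA. ?ok z" "\<And>c. cocycle i (subtopology T A) c \<Longrightarrow> cspan i ?X ZA c"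
    using sub[OF gA] by auto
  obtain ZB where ZB: "finite ZB" "\<forall>z\<in>ZB. ?ok z" "\<And>c. cocycle i (subtopology T B) c \<Longrightarrow> cspan i ?X ZB c"
    using sub[OF gB] by auto
  have "\<exists>w. ?ok w \<and> mv_related i T A B w z" if "z \<in> Z" for z
  proof -
    obtain Y q \<zeta> where q: "(Y, q) \<in> \<Y>" "cocycle (Suc i) Y \<zeta>" "z = pullback (Suc i) q \<zeta>"
      using Z(2) \<open>z \<in> Z\<close> by blast
    obtain T' A' B' where T': "Y = subtopology T' (A' \<union> B')"
       "\<forall>c. cocycle (Suc i) Y c \<longrightarrow> cobdry (Suc i) (subtopology T' A') c \<and> cobdry (Suc i) (subtopology T' B') c"
       "continuous_map T T' q" "q \<in> A \<rightarrow> A'" "q \<in> B \<rightarrow> B'" "(subtopology T' (A' \<inter> B'), q) \<in> \<Y>'"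
      using Y[OF q(1)] by blast
    obtain \<alpha> where \<alpha>: "cocycle i (subtopology T' (A' \<inter> B')) \<alpha>" "mv_related i T' A' B' \<alpha> \<zeta>"
      using T'(2) q(2) mv_related_of_cobs by metis
    have "continuous_map ?X (subtopology T' (A' \<inter> B')) q"
      using T'(3,4,5) by (auto simp: continuous_map_in_subtopology continuous_map_from_subtopology)
    then have "?ok (pullback i q \<alpha>)" using T'(6) \<alpha>(1) by blast
    then show ?thesis using mv_related_pullback[OF \<alpha>(2) T'(3,4,5)] q(3) by blast
  qed
  then obtain w where w: "\<And>z. z \<in> Z \<Longrightarrow> ?ok (w z)" "\<And>z. z \<in> Z \<Longrightarrow> mv_related i T A B (w z) z" by metis
  have lift: "\<exists>\<alpha>. cspan i ?X (w ` Z) \<alpha> \<and> mv_related i T A B \<alpha> \<gamma>" if "cspan (Suc i) (subtopology T (A \<union> B)) Z \<gamma>" for \<gamma>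
    using that
  proof induction
    case (base z)
    then show ?case using w(2) by (meson cspan.base imageI)
  next
    case (cobdry \<phi>)
    then obtain \<eta> where \<eta>: "\<And>\<sigma>. singular_simplex (Suc i) (subtopology T (A \<union> B)) \<sigma> \<Longrightarrow> \<phi> \<sigma> = ceval \<eta> (bdry (Suc i) \<sigma>)"
      by (rule cobdryE) (use that in blast)
    have "mv_related i T A B (\<lambda>_. 0) \<phi>"
      by (rule mv_relatedI[of _ _ _ _ _ \<eta> \<eta>]) (use \<eta> singular_simplex_mono[of "Suc i" T _ _ "A \<union> B"] in auto)
    then show ?case using cspan_zero by blast
  next
    case (diff \<phi> \<psi>)
    then obtain g1 g2 where g: "cspan i ?X (w ` Z) g1" "mv_related i T A B g1 \<phi>"
      "cspan i ?X (w ` Z) g2" "mv_related i T A B g2 \<psi>" by blast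
    show ?case using mv_related_diff[OF g(2,4)] cspan.diff[OF g(1,3)] by blast
  qed
  let ?W = "w ` Z \<union> ZA \<union> ZB"
  have W: "cspan i ?X ?W c" if c: "cocycle i ?X c" for c
  proof -
    obtain \<gamma> where \<gamma>: "cocycle (Suc i) (subtopology T (A \<union> B)) \<gamma>" "mv_related i T A B c \<gamma>"
      using mv_connecting[OF o c] by blast
    obtain \<alpha> where \<alpha>: "cspan i ?X (w ` Z) \<alpha>" "mv_related i T A B \<alpha> \<gamma>"
      using lift[OF Z(3)[OF \<gamma>(1)]] by blast
    obtain a b where ab: "cocycle i (subtopology T A) a" "cocycle i (subtopology T B) b"
      "\<And>\<sigma>. singular_simplex i ?X \<sigma> \<Longrightarrow> c \<sigma> - \<alpha> \<sigma> = a \<sigma> - b \<sigma>"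
      using mv_related_cobdry_split[of i T A B "\<lambda>\<sigma>. c \<sigma> - \<alpha> \<sigma>"] mv_related_diff[OF \<gamma>(2) \<alpha>(2)] by (auto simp: fun_eq_iff)
    have "cspan i ?X ?W (\<lambda>\<sigma>. \<alpha> \<sigma> + (a \<sigma> - b \<sigma>))"
      by (intro cspan_add cspan.diff cspan_mono[OF \<alpha>(1)] cspan_mono[OF ZA(3)[OF ab(1)]] cspan_mono[OF ZB(3)[OF ab(2)]]) auto
    then show ?thesis by (rule cspan_cong) (use ab(3) in fastforce)
  qed
  have fin: "finite ?W" using Z(1) ZA(1) ZB(1) by simp
  have ok: "\<forall>z \<in> ?W. ?ok z"
  proof
    fix z assume "z \<in> ?W"
    then consider "z \<in> w ` Z" | "z \<in> ZA" | "z \<in> ZB" by blast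
    then show "?ok z"
    proof cases
      case 1
      then obtain y where "y \<in> Z" "z = w y" by (rule imageE)
      show ?thesis unfolding \<open>z = w y\<close> by (rule w(1)[OF \<open>y \<in> Z\<close>])
    next
      case 2 then show ?thesis by (rule bspec[OF ZA(2)])
    next
      case 3 then show ?thesis by (rule bspec[OF ZB(2)])
    qed
  qed
  show ?thesis unfolding generated_def
    by (rule exI[of _ ?W], intro conjI allI impI) (rule fin, rule ok, rule W)
qed

section \<open>Contractible spaces\<close>

lemma acyclic_point:
  assumes "contractible_space X" "x \<in> topspace X"
  shows "acyclic_pair X (\<lambda>p. singular_simplex_set p (subtopology X {x}))"
proof -
  have h: "homotopic_with (\<lambda>h. True) X X id (\<lambda>_. x)"
    by (rule bspec[OF assms(1)[unfolded contractible_space_alt] assms(2)])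
  have ts: "topspace (subtopology X {x}) = {x}" using assms(2) by auto
  have triv: "trivial_group (relative_homology_group (int p) X {x})" for p
  proof (rule trivial_relative_homology_group_gen)
    show "continuous_map X (subtopology X {x}) (\<lambda>_. x)"
      using assms(2) by (simp add: continuous_map_in_subtopology)
    show "homotopic_with (\<lambda>k. True) X X (\<lambda>_. x) id"
      using h homotopic_with_sym by blast
    show "homotopic_with (\<lambda>h. True) (subtopology X {x}) (subtopology X {x}) (\<lambda>_. x) id"
      by (rule homotopic_with_equal) (use assms(2) in \<open>auto simp: continuous_map_in_subtopology\<close>)
  qed
  show ?thesis
    unfolding acyclic_pair_def
  proof (intro allI impI)
    fix p z assume z: "singular_chain p X z"
      "Poly_Mapping.keys (chain_boundary p z) \<subseteq> singular_simplex_set (p - 1) (subtopology X {x})"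
    then have cyc: "singular_relcycle p X {x} z"
      by (simp add: singular_relcycle singular_chain_def)
    have "homologous_rel_set p X {x} z \<in> carrier (relative_homology_group (int p) X {x})"
      using cyc by (simp add: carrier_relative_homology_group)
    moreover have "carrier (relative_homology_group (int p) X {x}) = {singular_relboundary_set p X {x}}"
      using triv[of p] by (simp add: trivial_group_def one_relative_homology_group)
    ultimately have "singular_relboundary p X {x} z"
      by (simp add: homologous_rel_set_eq_relboundary)
    then obtain d e where de: "singular_chain (Suc p) X d" "singular_chain p (subtopology X {x}) e" "z = chain_boundary (Suc p) d + e"
      by (auto simp: singular_relboundary)
    then have "Poly_Mapping.keys (z - chain_boundary (Suc p) d) \<subseteq> singular_simplex_set p (subtopology X {x})"
      by (simp add: singular_chain_def)
    with de(1) show "\<exists>w. singular_chain (Suc p) X w \<and> Poly_Mapping.keys (z - chain_boundary (Suc p) w)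
           \<subseteq> singular_simplex_set p (subtopology X {x})" by blast
  qed
qed

lemma subcomplex_subtopology: "subcomplex X (\<lambda>p. singular_simplex_set p (subtopology X S))"
  unfolding subcomplex_def
proof (intro conjI allI ballI impI)
  fix p show "singular_simplex_set p (subtopology X S) \<subseteq> singular_simplex_set p X"
    by (auto simp: singular_simplex_subtopology)
next
  fix p \<sigma> k assume "\<sigma> \<in> singular_simplex_set (Suc p) (subtopology X S)" "k \<le> Suc p"
  then show "singular_face (Suc p) k \<sigma> \<in> singular_simplex_set p (subtopology X S)"
    using singular_simplex_singular_face[of "Suc p" _ \<sigma> k] by auto
qed

text \<open>By acyclicity it suffices to look at constant simplices. In even positive degree the boundary of
  a constant simplex is the constant simplex one degree below, so a constant cochain is a primitive.
  In odd degree a constant simplex is the boundary of the next one, so a cocycle vanishes on it.\<close>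

lemma contractible_cocycle_imp_cobdry:
  assumes "contractible_space X" "cocycle (Suc p) X c"
  shows "cobdry (Suc p) X c"
proof (cases "topspace X = {}")
  case True
  then show ?thesis by (auto simp: cobdry_def singular_simplex_empty)
next
  case False
  then obtain x where x: "x \<in> topspace X" by blast
  let ?P = "subtopology X {x}" and ?k = "\<lambda>p. restrict (\<lambda>_. x) (standard_simplex p)"
  have ts: "topspace ?P = {x}" using x by auto
  have ss: "singular_simplex r ?P f \<longleftrightarrow> f = ?k r" for r f
    by (rule singular_simplex_singleton[OF ts])
  have b: "bdry r (?k r) = (if r = 0 \<or> odd r then 0 else frag_of (?k (r - 1)))" for r
    using chain_boundary_of_singleton[OF ts, of r "frag_of (?k r)"]
    by (simp add: bdry_def singular_chain_of ss)
  have "c (?k (Suc p)) = ceval (\<lambda>_. c (?k (Suc p))) (bdry (Suc p) (?k (Suc p)))"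
  proof (cases "odd (Suc p)")
    case True
    have "singular_simplex (Suc (Suc p)) X (?k (Suc (Suc p)))"
      using ss[of "Suc (Suc p)" "?k (Suc (Suc p))"] by (simp add: singular_simplex_subtopology)
    then have "ceval c (bdry (Suc (Suc p)) (?k (Suc (Suc p)))) = 0"
      using assms(2) unfolding cocycle_def by blast
    then show ?thesis using True by (simp add: b)
  qed (simp add: b)
  then show ?thesis
    by (intro cobdry_if_cobdry_on_subcomplex[OF subcomplex_subtopology acyclic_point[OF assms(1) x] assms(2)]) (simp add: ss)
qed

lemma contractible_h0_const:
  assumes "contractible_space X"
  shows "h0_const X"
  unfolding h0_const_def
proof (intro allI impI)
  fix c assume c: "cocycle 0 X c"
  show "\<exists>n. \<forall>\<sigma>. singular_simplex 0 X \<sigma> \<longrightarrow> c \<sigma> = n"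
  proof (cases "topspace X = {}")
    case True then show ?thesis by (simp add: singular_simplex_empty)
  next
    case False
    then obtain x where x: "x \<in> topspace X" by blast
    let ?k = "restrict (\<lambda>_. x) (standard_simplex 0)"
    have ts: "topspace (subtopology X {x}) = {x}" using x by auto
    have "c \<sigma> = c ?k" if s: "singular_simplex 0 X \<sigma>" for \<sigma>
    proof -
      obtain w where w: "singular_chain 1 X w"
        "singular_chain 0 (subtopology X {x}) (frag_of \<sigma> - chain_boundary 1 w)"
        using acyclic_point[OF assms x, unfolded acyclic_pair_def, rule_format, of 0 "frag_of \<sigma>"] s
        by (auto simp: singular_chain_of singular_chain_def chain_boundary_def)
      then obtain m where m: "frag_of \<sigma> - chain_boundary 1 w = frag_cmul m (frag_of ?k)"
        using singular_chain_singleton[OF ts] by blast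
      have "ceval \<phi> (frag_of \<sigma> - chain_boundary 1 w) = \<phi> \<sigma>" if "cocycle 0 X \<phi>" for \<phi>
        using cocycle_chain[OF that, of w] w(1) by (simp add: ceval_diff)
      from this[OF c] this[OF cocycle_const, of 1] show ?thesis unfolding m by (simp add: ceval_cmul)
    qed
    then show ?thesis by blast
  qed
qed

section \<open>Linear forms and arrangement complements\<close>

abbreviation coords :: "'l set \<Rightarrow> ('l \<Rightarrow> 'e::euclidean_space) topology" where
  "coords W \<equiv> product_topology (\<lambda>_. euclidean) W"

definition lform :: "'l set \<Rightarrow> ('l \<Rightarrow> real) \<Rightarrow> ('l \<Rightarrow> 'e::euclidean_space) \<Rightarrow> 'e" where
  "lform W f x = (\<Sum>v\<in>W. f v *\<^sub>R x v)"

definition pairing :: "'l set \<Rightarrow> ('l \<Rightarrow> real) \<Rightarrow> ('l \<Rightarrow> real) \<Rightarrow> real" where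
  "pairing W f c = (\<Sum>v\<in>W. f v * c v)"

definition translate :: "'l set \<Rightarrow> ('l \<Rightarrow> real) \<Rightarrow> 'e::euclidean_space \<Rightarrow> ('l \<Rightarrow> 'e) \<Rightarrow> 'l \<Rightarrow> 'e" where
  "translate W c u x = (\<lambda>v\<in>W. x v + c v *\<^sub>R u)"

definition arr_compl :: "'l set \<Rightarrow> ('l \<Rightarrow> real) set \<Rightarrow> ('l \<Rightarrow> 'e::euclidean_space) set" where
  "arr_compl W L = {x \<in> extensional W. \<forall>f\<in>L. lform W f x \<noteq> 0}"

lemma topspace_coords: "topspace (coords W :: ('l \<Rightarrow> 'e::euclidean_space) topology) = extensional W"
  by (auto simp: PiE_def)

lemma lform_translate: "lform W f (translate W c u x) = lform W f x + pairing W f c *\<^sub>R u"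
  unfolding lform_def pairing_def translate_def
  by (simp add: scaleR_right_distrib sum.distrib scaleR_sum_left)

lemma lform_zero [simp]: "lform W f (\<lambda>_. 0) = 0"
  by (simp add: lform_def)

lemma translate_ext [simp]: "translate W c u x \<in> extensional W"
  by (simp add: translate_def)

lemma translate_0: "x \<in> extensional W \<Longrightarrow> translate W c 0 x = x"
  by (auto simp: translate_def fun_eq_iff extensional_def)

lemma continuous_map_lform:
  "continuous_map (coords W) euclidean (lform W f)"
proof (cases "finite W")
  case True
  have "continuous_map (coords W) euclidean (\<lambda>x. \<Sum>v\<in>W. f v *\<^sub>R x v)"
  proof (rule continuous_map_sum[OF True])
    fix v assume "v \<in> W"
    have "continuous_map (coords W) euclidean ((\<lambda>y. f v *\<^sub>R y) \<circ> (\<lambda>x. x v))"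
      by (rule continuous_map_compose[OF continuous_map_product_projection[OF \<open>v \<in> W\<close>]])
         (auto intro!: continuous_intros)
    then show "continuous_map (coords W) euclidean (\<lambda>x. f v *\<^sub>R x v)" by (simp add: o_def)
  qed
  then show ?thesis by (simp add: lform_def[abs_def])
qed (simp add: lform_def[abs_def])

lemma openin_lform_ne: "openin (coords W) {x \<in> extensional W. lform W f x \<noteq> 0}"
  using openin_continuous_map_preimage[OF continuous_map_lform, of "- {0}" W f] open_Compl[OF closed_singleton]
  by (simp only: topspace_coords) auto

lemma continuous_map_lform_inner: "continuous_map (coords W) euclideanreal (\<lambda>x. lform W f x \<bullet> u)"
proof -
  have "continuous_map (coords W) euclideanreal ((\<lambda>y. y \<bullet> u) \<circ> lform W f)"
    by (rule continuous_map_compose[OF continuous_map_lform]) (auto intro!: continuous_intros)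
  then show ?thesis by (simp add: o_def)
qed

lemma openin_lform_pos: "openin (coords W) {x \<in> extensional W. lform W f x \<bullet> u > 0}"
  using openin_continuous_map_preimage[OF continuous_map_lform_inner, of "{0<..}" W f u]
  by (simp only: topspace_coords) simp

lemma openin_arr_compl:
  assumes "finite L" shows "openin (coords W) (arr_compl W L :: ('l \<Rightarrow> 'e::euclidean_space) set)"
proof -
  let ?N = "\<Inter>f\<in>L. {x \<in> extensional W. lform W f x \<noteq> (0::'e)}"
  have "(arr_compl W L :: ('l \<Rightarrow> 'e) set) = ?N \<inter> extensional W"
    by (auto simp: arr_compl_def)
  moreover have "openin (coords W) (?N \<inter> extensional W)"
  proof (cases "L = {}")
    case True then show ?thesis using openin_topspace[of "coords W :: ('l \<Rightarrow> 'e) topology"] by (simp only: topspace_coords) simp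
  next
    case False
    then have "openin (coords W) ?N"
      by (intro openin_INT2 assms openin_lform_ne)
    then show ?thesis using openin_topspace[of "coords W :: ('l \<Rightarrow> 'e) topology"] by (simp only: topspace_coords) (rule openin_Int)
  qed
  ultimately show ?thesis by simp
qed

lemma continuous_map_restrict_coords: "W \<subseteq> V \<Longrightarrow> continuous_map (coords V) (coords W) (\<lambda>x. restrict x W)"
  by (auto simp: continuous_map_componentwise intro!: continuous_map_product_projection)

lemma lform_restrict:
  assumes "finite V" "W \<subseteq> V" "\<And>v. v \<in> V \<Longrightarrow> f v \<noteq> 0 \<Longrightarrow> v \<in> W"
  shows "lform W f (restrict x W) = lform V f x"
  unfolding lform_def by (rule sum.mono_neutral_cong_left) (use assms in auto)

lemma homotopic_with_True_iff:
  "homotopic_with (\<lambda>_. True) X Y p q \<longleftrightarrow>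
     (\<exists>h. continuous_map (prod_topology (top_of_set {0..1::real}) X) Y h \<and>
          (\<forall>x \<in> topspace X. h (0, x) = p x) \<and> (\<forall>x \<in> topspace X. h (1, x) = q x))"
  by (subst homotopic_with) auto

text \<open>A translation in direction \<open>c\<close> increases the \<open>u\<close>-component of all forms in \<open>F\<close> at the same rate
  and preserves \<open>X\<close>. So every point can be pushed, by an amount depending continuously on it, into
  the convex set on which these components are positive, and from there to a point.\<close>

lemma contractible_push:
  fixes u :: "'e::euclidean_space"
  assumes W: "finite W" and F: "finite F" and c: "\<And>f. f \<in> F \<Longrightarrow> pairing W f c = 1" and u: "u \<bullet> u = 1"
    and X: "X \<subseteq> extensional W" "\<And>x t. \<lbrakk>x \<in> X; t \<ge> 0\<rbrakk> \<Longrightarrow> translate W c (t *\<^sub>R u) x \<in> X"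
  shows "contractible_space (subtopology (coords W) ({x \<in> extensional W. \<forall>f\<in>F. lform W f x \<bullet> u > 0} \<union> X))"
    (is "contractible_space (subtopology _ (?K \<union> X))")
proof -
  let ?D = "?K \<union> X" and ?I = "top_of_set {0..1::real}"
  let ?S = "subtopology (coords W) ?D"
  \<comment> \<open>Pushing by \<open>\<tau> x\<close> makes all components positive, whatever their sign at \<open>x\<close>.\<close>
  define \<tau> where "\<tau> x = 1 + (\<Sum>f\<in>F. \<bar>lform W f x \<bullet> u\<bar>)" for x
  have \<tau>: "\<tau> x \<ge> 1" "\<And>f. f \<in> F \<Longrightarrow> \<tau> x \<ge> 1 + \<bar>lform W f x \<bullet> u\<bar>" for x
  proof -
    show "\<tau> x \<ge> 1" unfolding \<tau>_def by (simp add: sum_nonneg)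
    fix f assume "f \<in> F"
    then have "\<bar>lform W f x \<bullet> u\<bar> \<le> (\<Sum>f\<in>F. \<bar>lform W f x \<bullet> u\<bar>)"
      by (intro member_le_sum) (use F in auto)
    then show "\<tau> x \<ge> 1 + \<bar>lform W f x \<bullet> u\<bar>" unfolding \<tau>_def by simp
  qed
  define g where "g x = translate W c (\<tau> x *\<^sub>R u) x" for x
  define k0 where "k0 = translate W c u (\<lambda>_. 0)"
  have k0K: "k0 \<in> ?K" using c u by (auto simp: k0_def lform_translate)
  have ts: "topspace ?S = ?D" using X(1) by (auto simp: topspace_coords simp del: topspace_product_topology)
  have lfs: "lform W f (translate W c (t *\<^sub>R u) x) \<bullet> u = lform W f x \<bullet> u + t" if "f \<in> F" for f t x
    using c[OF that] u by (simp add: lform_translate inner_add_left)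
  have shD: "translate W c (t *\<^sub>R u) x \<in> ?D" if "x \<in> ?D" "t \<ge> 0" for x t
  proof (cases "x \<in> X")
    case True then show ?thesis using X(2) that by auto
  next
    case False
    then have "x \<in> ?K" using that by auto
    then have "translate W c (t *\<^sub>R u) x \<in> ?K" using lfs that(2) by (auto intro: add_pos_nonneg)
    then show ?thesis by blast
  qed
  have gK: "g x \<in> ?K" for x
  proof -
    have "lform W f x \<bullet> u + \<tau> x > 0" if "f \<in> F" for f using \<tau>(2)[OF that, of x] by linarith
    then show ?thesis by (auto simp: g_def lfs)
  qed
  have lin: "(\<lambda>v\<in>W. (1 - t) *\<^sub>R x v + t *\<^sub>R k0 v) \<in> ?K" if x: "x \<in> ?K" and t: "0 \<le> t" "t \<le> 1" for x t
  proof -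
    have "lform W f (\<lambda>v\<in>W. (1 - t) *\<^sub>R x v + t *\<^sub>R k0 v) = (1 - t) *\<^sub>R lform W f x + t *\<^sub>R lform W f k0" for f
      unfolding lform_def by (simp add: scaleR_right_distrib sum.distrib scaleR_sum_right mult.commute)
    moreover have "(1 - t) * (lform W f x \<bullet> u) + t * (lform W f k0 \<bullet> u) > 0" if "f \<in> F" for f
    proof (cases "t = 1")
      case True then show ?thesis using k0K that by auto
    next
      case False
      then have "(1 - t) * (lform W f x \<bullet> u) > 0" using x t that by auto
      moreover have "t * (lform W f k0 \<bullet> u) \<ge> 0" using k0K t that by (intro mult_nonneg_nonneg) (auto intro: less_imp_le)
      ultimately show ?thesis by linarith
    qed
    ultimately show ?thesis by (auto simp: inner_add_left)
  qed
  have pr2: "continuous_map (prod_topology ?I ?S) (coords W) snd"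
    using continuous_map_snd[of ?I ?S] continuous_map_in_subtopology by blast
  have pr1: "continuous_map (prod_topology ?I ?S) euclideanreal fst"
    using continuous_map_fst[of ?I ?S] continuous_map_in_subtopology by blast
  have cv: "continuous_map (prod_topology ?I ?S) euclidean (\<lambda>z. snd z v)" if "v \<in> W" for v
    using continuous_map_compose[OF pr2 continuous_map_product_projection[OF that]] by (simp add: o_def)
  have c\<tau>: "continuous_map (coords W) euclideanreal \<tau>"
    unfolding \<tau>_def[abs_def]
    by (intro continuous_intros F continuous_map_real_abs continuous_map_lform_inner continuous_map_sum)
  have c\<tau>2: "continuous_map (prod_topology ?I ?S) euclideanreal (\<lambda>z. \<tau> (snd z))"
    using continuous_map_compose[OF pr2 c\<tau>] by (simp add: o_def)
  have sc: "continuous_map Z euclidean (\<lambda>z. a z *\<^sub>R b z)"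
    if "continuous_map Z euclideanreal a" "continuous_map Z euclidean b" for Z :: "'z topology" and a and b :: "'z \<Rightarrow> 'e"
  proof -
    have 1: "continuous_map Z (prod_topology euclideanreal (euclidean :: 'e topology)) (\<lambda>z. (a z, b z))"
      unfolding continuous_map_pairwise o_def using that by simp
    have 2: "continuous_map (prod_topology euclideanreal (euclidean :: 'e topology)) euclidean (\<lambda>z. fst z *\<^sub>R snd z)"
      by (auto intro!: continuous_intros)
    from continuous_map_compose[OF 1 2] show ?thesis by (simp add: o_def)
  qed
  have ad: "continuous_map Z euclidean (\<lambda>z. a z + b z)"
    if "continuous_map Z euclidean a" "continuous_map Z euclidean b" for Z :: "'z topology" and a and b :: "'z \<Rightarrow> 'e"
    using that by (rule continuous_map_add)
  have 1: "homotopic_with (\<lambda>_. True) ?S ?S id g"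
    unfolding homotopic_with_True_iff
  proof (intro exI[of _ "\<lambda>z. translate W c ((fst z * \<tau> (snd z)) *\<^sub>R u) (snd z)"] conjI ballI)
    show "continuous_map (prod_topology ?I ?S) ?S (\<lambda>z. translate W c ((fst z * \<tau> (snd z)) *\<^sub>R u) (snd z))"
      unfolding continuous_map_in_subtopology
    proof
      have "continuous_map (prod_topology ?I ?S) euclidean (\<lambda>z. snd z v + c v *\<^sub>R ((fst z * \<tau> (snd z)) *\<^sub>R u))" if "v \<in> W" for v
        by (intro ad cv that sc continuous_map_real_mult pr1 c\<tau>2) auto
      then show "continuous_map (prod_topology ?I ?S) (coords W) (\<lambda>z. translate W c ((fst z * \<tau> (snd z)) *\<^sub>R u) (snd z))"
        by (auto simp: continuous_map_componentwise translate_def)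
      show "(\<lambda>z. translate W c ((fst z * \<tau> (snd z)) *\<^sub>R u) (snd z)) \<in> topspace (prod_topology ?I ?S) \<rightarrow> ?D"
      proof
        fix z assume "z \<in> topspace (prod_topology ?I ?S)"
        then have "snd z \<in> ?D" "0 \<le> fst z" unfolding topspace_prod_topology ts by auto
        then show "translate W c ((fst z * \<tau> (snd z)) *\<^sub>R u) (snd z) \<in> ?D"
          using \<tau>(1)[of "snd z"] by (intro shD) auto
      qed
    qed
    show "translate W c ((fst (0, x) * \<tau> (snd (0, x))) *\<^sub>R u) (snd (0, x)) = id x" if "x \<in> topspace ?S" for x
      using that X(1) unfolding ts by (auto simp: translate_0)
    show "translate W c ((fst (1, x) * \<tau> (snd (1, x))) *\<^sub>R u) (snd (1, x)) = g x" for x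
      by (simp add: g_def)
  qed
  have 2: "homotopic_with (\<lambda>_. True) ?S ?S g (\<lambda>_. k0)"
    unfolding homotopic_with_True_iff
  proof (intro exI[of _ "\<lambda>z. \<lambda>v\<in>W. (1 - fst z) *\<^sub>R g (snd z) v + fst z *\<^sub>R k0 v"] conjI ballI)
    show "continuous_map (prod_topology ?I ?S) ?S (\<lambda>z. \<lambda>v\<in>W. (1 - fst z) *\<^sub>R g (snd z) v + fst z *\<^sub>R k0 v)"
      unfolding continuous_map_in_subtopology
    proof
      have g: "continuous_map (prod_topology ?I ?S) euclidean (\<lambda>z. g (snd z) v)" if "v \<in> W" for v
      proof -
        have "continuous_map (prod_topology ?I ?S) euclidean (\<lambda>z. snd z v + c v *\<^sub>R (\<tau> (snd z) *\<^sub>R u))"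
          by (intro ad cv that sc c\<tau>2) auto
        then show ?thesis using that by (simp add: g_def translate_def)
      qed
      have "continuous_map (prod_topology ?I ?S) euclidean (\<lambda>z. (1 - fst z) *\<^sub>R g (snd z) v + fst z *\<^sub>R k0 v)" if "v \<in> W" for v
        by (intro ad sc g that continuous_map_diff pr1) auto
      then show "continuous_map (prod_topology ?I ?S) (coords W) (\<lambda>z. \<lambda>v\<in>W. (1 - fst z) *\<^sub>R g (snd z) v + fst z *\<^sub>R k0 v)"
        by (auto simp: continuous_map_componentwise)
      show "(\<lambda>z. \<lambda>v\<in>W. (1 - fst z) *\<^sub>R g (snd z) v + fst z *\<^sub>R k0 v) \<in> topspace (prod_topology ?I ?S) \<rightarrow> ?D"
      proof
        fix z assume "z \<in> topspace (prod_topology ?I ?S)"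
        then have "0 \<le> fst z" "fst z \<le> 1" unfolding topspace_prod_topology by auto
        then show "(\<lambda>v\<in>W. (1 - fst z) *\<^sub>R g (snd z) v + fst z *\<^sub>R k0 v) \<in> ?D"
          by (intro UnI1 lin gK)
      qed
    qed
    show "(\<lambda>v\<in>W. (1 - fst (0, x)) *\<^sub>R g (snd (0, x)) v + fst (0, x) *\<^sub>R k0 v) = g x" for x
      by (auto simp: g_def translate_def)
    show "(\<lambda>v\<in>W. (1 - fst (1, x)) *\<^sub>R g (snd (1, x)) v + fst (1, x) *\<^sub>R k0 v) = k0" for x
      by (auto simp: k0_def translate_def)
  qed
  show ?thesis
    unfolding contractible_space_def using homotopic_with_trans[OF 1 2] by blast
qed

lemma contractible_coords:
  assumes "finite W"
  shows "contractible_space (coords W :: ('l \<Rightarrow> 'e::euclidean_space) topology)"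
proof -
  obtain u :: 'e where "u \<in> Basis" using nonempty_Basis by blast
  then have u: "u \<bullet> u = 1" by (simp add: inner_Basis)
  have "subtopology (coords W) ({x \<in> extensional W. \<forall>f\<in>{}. lform W f x \<bullet> u > 0} \<union> {}) = (coords W :: ('l \<Rightarrow> 'e) topology)"
    using subtopology_topspace[of "coords W :: ('l \<Rightarrow> 'e) topology"] by (simp only: topspace_coords) simp
  then show ?thesis
    using contractible_push[OF assms, of "{}" "\<lambda>_. 0" u "{}"] u by simp
qed

section \<open>Iterated suspensions\<close>

text \<open>If \<open>X\<close> is invariant under translations in a direction dual to \<open>e\<close>, this is, up to homotopy, the
  suspension of \<open>X\<close> iterated \<open>card S\<close> times: \<open>X\<close> together with everything off the slice on which the
  coordinates of \<open>e\<close> in \<open>S\<close> vanish.\<close>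

definition suspend :: "'l set \<Rightarrow> ('l \<Rightarrow> real) \<Rightarrow> 'e set \<Rightarrow> ('l \<Rightarrow> 'e::euclidean_space) set \<Rightarrow> ('l \<Rightarrow> 'e) set" where
  "suspend W e S X = {x \<in> extensional W. \<exists>b\<in>S. lform W e x \<bullet> b \<noteq> 0} \<union> X"

lemma openin_suspend:
  assumes "finite S" "openin (coords W) X" shows "openin (coords W) (suspend W e S X)"
proof -
  have "openin (coords W) {x \<in> extensional W. lform W e x \<bullet> b \<noteq> 0}" for b
    using openin_continuous_map_preimage[OF continuous_map_lform_inner, of "- {0}" W e b] open_Compl[OF closed_singleton]
    by (simp only: topspace_coords) auto
  then have "openin (coords W) (\<Union>b\<in>S. {x \<in> extensional W. lform W e x \<bullet> b \<noteq> 0})"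
    by blast
  moreover have "{x \<in> extensional W. \<exists>b\<in>S. lform W e x \<bullet> b \<noteq> 0} = (\<Union>b\<in>S. {x \<in> extensional W. lform W e x \<bullet> b \<noteq> 0})"
    by blast
  ultimately show ?thesis unfolding suspend_def using assms(2) by (simp add: openin_Un)
qed

text \<open>One of the two cones whose union is a suspension of \<open>X\<close>.\<close>

definition half_susp :: "'l set \<Rightarrow> ('l \<Rightarrow> real) \<Rightarrow> 'e \<Rightarrow> ('l \<Rightarrow> 'e::euclidean_space) set \<Rightarrow> ('l \<Rightarrow> 'e) set" where
  "half_susp W e u X = {x \<in> extensional W. lform W e x \<bullet> u > 0} \<union> X"

lemma openin_half_susp: "openin (coords W) X \<Longrightarrow> openin (coords W) (half_susp W e u X)"
  unfolding half_susp_def by (intro openin_Un openin_lform_pos)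

lemma contractible_half_susp:
  assumes "finite W" "pairing W e c = 1" "u \<bullet> u = 1" "X \<subseteq> extensional W"
    "\<And>x t. \<lbrakk>x \<in> X; t \<ge> 0\<rbrakk> \<Longrightarrow> translate W c (t *\<^sub>R u) x \<in> X"
  shows "contractible_space (subtopology (coords W) (half_susp W e u X))"
  using contractible_push[of W "{e}" c u X] assms by (simp add: half_susp_def)

lemma half_susp_Int: "X \<subseteq> extensional W \<Longrightarrow> half_susp W e b X \<inter> half_susp W e (- b) X = X"
  by (auto simp: half_susp_def)

lemma half_susp_Un_suspend:
  "half_susp W e b (suspend W e S X) \<union> half_susp W e (- b) (suspend W e S X) = suspend W e (insert b S) X"
  by (auto simp: half_susp_def suspend_def)

abbreviation susp_models ::
  "('l \<Rightarrow> real) \<Rightarrow> 'e set \<Rightarrow> ('l set \<times> ('l \<Rightarrow> 'e::euclidean_space) set) set \<Rightarrow>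
    (('l \<Rightarrow> 'e) topology \<times> (('l \<Rightarrow> 'e) \<Rightarrow> ('l \<Rightarrow> 'e))) set" where
  "susp_models e S \<W> \<equiv>
    {(subtopology (coords W) (suspend W e S X'), \<lambda>x. restrict x W) | W X'. (W, X') \<in> \<W>}"

text \<open>Translations in direction \<open>c\<close> sweep out the cones of a suspension.\<close>

locale susp_dir =
  fixes V :: "'l set" and e c :: "'l \<Rightarrow> real" and X :: "('l \<Rightarrow> 'e::euclidean_space) set"
  assumes finV: "finite V" and dual: "pairing V e c = 1"
    and openX: "openin (coords V) X"
    and inv: "\<And>x u. x \<in> X \<Longrightarrow> translate V c u x \<in> X"
begin

lemma X_ext: "X \<subseteq> extensional V"
  using openin_subset[OF openX] by (simp only: topspace_coords)

lemma suspend_ext: "suspend V e S X \<subseteq> extensional V"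
  using X_ext by (auto simp: suspend_def)

lemma suspend_translate:
  assumes "S \<subseteq> Basis" "b \<in> Basis" "b \<notin> S" "x \<in> suspend V e S X"
  shows "translate V c (t *\<^sub>R b) x \<in> suspend V e S X"
proof -
  have "lform V e (translate V c (t *\<^sub>R b) x) \<bullet> b' = lform V e x \<bullet> b'" if "b' \<in> S" for b'
  proof -
    have "b \<bullet> b' = 0" using assms that by (metis inner_not_same_Basis subsetD)
    then show ?thesis by (simp add: lform_translate dual inner_add_left)
  qed
  then show ?thesis using assms(4) inv unfolding suspend_def by auto
qed

lemma contractible_half_susp_suspend:
  assumes S: "S \<subseteq> Basis" "b \<in> Basis" "b \<notin> S"
  shows "contractible_space (subtopology (coords V) (half_susp V e b (suspend V e S X)))"
    and "contractible_space (subtopology (coords V) (half_susp V e (- b) (suspend V e S X)))"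
proof -
  show "contractible_space (subtopology (coords V) (half_susp V e b (suspend V e S X)))"
    by (rule contractible_half_susp[OF finV dual]) (use S suspend_ext suspend_translate[OF S] in auto)
  have "translate V c (t *\<^sub>R - b) x \<in> suspend V e S X" if "x \<in> suspend V e S X" for x t
    using suspend_translate[OF S that, of "- t"] by simp
  then show "contractible_space (subtopology (coords V) (half_susp V e (- b) (suspend V e S X)))"
    by (intro contractible_half_susp[OF finV dual]) (use S suspend_ext in auto)
qed

lemma h0_const_suspend:
  assumes S: "S \<subseteq> Basis" "b \<in> Basis" "b \<notin> S" and x: "x \<in> suspend V e S X"
  shows "h0_const (subtopology (coords V) (suspend V e (insert b S) X))"
  unfolding half_susp_Un_suspend[symmetric]
proof (rule h0_const_Un)
  show "h0_const (subtopology (coords V) (half_susp V e b (suspend V e S X)))"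
       "h0_const (subtopology (coords V) (half_susp V e (- b) (suspend V e S X)))"
    using contractible_half_susp_suspend[OF S] contractible_h0_const by blast+
  show "x \<in> half_susp V e b (suspend V e S X) \<inter> half_susp V e (- b) (suspend V e S X)"
    using x half_susp_Int[OF suspend_ext] by blast
  show "x \<in> topspace (coords V)" unfolding topspace_coords using x suspend_ext by blast
qed

text \<open>The two cones are contractible and meet in the set that is suspended. Forgetting the coordinates
  outside \<open>W\<close> is compatible with the cones because \<open>W\<close> contains the support of \<open>e\<close>.\<close>

lemma generated_suspension:
  assumes S: "S \<subseteq> Basis" "b \<in> Basis" "b \<notin> S"
    and models: "\<And>W X'. (W, X') \<in> \<W> \<Longrightarrow> W \<subseteq> V \<and> (\<forall>v\<in>V. e v \<noteq> 0 \<longrightarrow> v \<in> W) \<and> openin (coords W) X' \<and>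
        (\<forall>x\<in>X. restrict x W \<in> X')"
    and g: "generated j (subtopology (coords V) (suspend V e S X))
       (susp_models e S \<W>)"
  shows "generated (Suc j) (subtopology (coords V) (suspend V e (insert b S) X))
       (susp_models e (insert b S) \<W>)"
  unfolding half_susp_Un_suspend[of V, symmetric]
proof (rule generated_union)
  have finS: "finite S" using S finite_subset[OF _ finite_Basis] by blast
  show "openin (coords V) (half_susp V e b (suspend V e S X))" "openin (coords V) (half_susp V e (- b) (suspend V e S X))"
    using openin_half_susp openin_suspend finS openX by blast+
  show "cobdry (Suc j) (subtopology (coords V) (half_susp V e b (suspend V e S X))) c"
    if "cocycle (Suc j) (subtopology (coords V) (half_susp V e b (suspend V e S X))) c" for c
    using contractible_cocycle_imp_cobdry[OF contractible_half_susp_suspend(1)[OF S] that] .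
  show "cobdry (Suc j) (subtopology (coords V) (half_susp V e (- b) (suspend V e S X))) c"
    if "cocycle (Suc j) (subtopology (coords V) (half_susp V e (- b) (suspend V e S X))) c" for c
    using contractible_cocycle_imp_cobdry[OF contractible_half_susp_suspend(2)[OF S] that] .
  show "generated j (subtopology (coords V) (half_susp V e b (suspend V e S X) \<inter> half_susp V e (- b) (suspend V e S X)))
     (susp_models e S \<W>)"
    using g by (simp only: half_susp_Int[OF suspend_ext])
next
  fix Y :: "('l \<Rightarrow> 'e) topology" and q :: "('l \<Rightarrow> 'e) \<Rightarrow> ('l \<Rightarrow> 'e)"
  assume "(Y, q) \<in> susp_models e S \<W>"
  then obtain W X' where Y: "Y = subtopology (coords W) (suspend W e S X')" "q = (\<lambda>x. restrict x W)" and WX: "(W, X') \<in> \<W>"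
    by blast
  note f = models[OF WX]
  have finS: "finite S" using S finite_subset[OF _ finite_Basis] by blast
  have lfr: "lform W e (restrict x W) = lform V e x" for x :: "'l \<Rightarrow> 'e"
    by (rule lform_restrict) (use finV f in auto)
  have rx: "restrict x W \<in> suspend W e S X'" if "x \<in> suspend V e S X" for x
    using that f by (auto simp: suspend_def lfr)
  have X'e: "suspend W e S X' \<subseteq> extensional W"
    using f openin_subset[of "coords W" X'] unfolding topspace_coords by (auto simp: suspend_def)
  show "\<exists>T' P' N'. openin T' P' \<and> openin T' N' \<and> Y = subtopology T' (P' \<inter> N') \<and>
       continuous_map (coords V) T' q \<and> q \<in> half_susp V e b (suspend V e S X) \<rightarrow> P' \<and> q \<in> half_susp V e (- b) (suspend V e S X) \<rightarrow> N' \<and>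
       (subtopology T' (P' \<union> N'), q) \<in> susp_models e (insert b S) \<W>"
  proof (intro exI conjI)
    show "openin (coords W) (half_susp W e b (suspend W e S X'))" "openin (coords W) (half_susp W e (- b) (suspend W e S X'))"
      using openin_half_susp openin_suspend finS f by blast+
    show "Y = subtopology (coords W) (half_susp W e b (suspend W e S X') \<inter> half_susp W e (- b) (suspend W e S X'))"
      by (simp only: half_susp_Int[OF X'e] Y)
    show "continuous_map (coords V) (coords W) q" unfolding Y(2) by (rule continuous_map_restrict_coords) (use f in blast)
    show "q \<in> half_susp V e b (suspend V e S X) \<rightarrow> half_susp W e b (suspend W e S X')" "q \<in> half_susp V e (- b) (suspend V e S X) \<rightarrow> half_susp W e (- b) (suspend W e S X')"
      using rx by (auto simp: half_susp_def Y(2) lfr)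
    show "(subtopology (coords W) (half_susp W e b (suspend W e S X') \<union> half_susp W e (- b) (suspend W e S X')), q) \<in>
      susp_models e (insert b S) \<W>"
      unfolding half_susp_Un_suspend Y(2) using WX by blast
  qed
qed

end

section \<open>Deletion and contraction of linear forms\<close>

text \<open>Linear independence, expressed by the dual vectors that are needed as directions of
  translation.\<close>

definition indep_forms :: "'l set \<Rightarrow> ('l \<Rightarrow> real) set \<Rightarrow> bool" where
  "indep_forms W F \<longleftrightarrow> (\<forall>f\<in>F. \<exists>c. pairing W f c = 1 \<and> (\<forall>g\<in>F - {f}. pairing W g c = 0))"

text \<open>The bound on \<open>W\<close> reflects that a form involves at most two coordinates.\<close>

definition indep_family :: "'l set \<Rightarrow> ('l \<Rightarrow> real) set \<Rightarrow> nat \<Rightarrow> (('l \<Rightarrow> 'e::euclidean_space) topology \<times> (('l \<Rightarrow> 'e) \<Rightarrow> ('l \<Rightarrow> 'e))) set" where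
  "indep_family V L i = {(subtopology (coords W) (arr_compl W F), \<lambda>x. restrict x W) | W F.
      F \<subseteq> L \<and> indep_forms W F \<and> card F \<le> i \<and> W \<subseteq> V \<and> card W \<le> 2 * card F \<and> (\<forall>f\<in>F. \<forall>v. f v \<noteq> 0 \<longrightarrow> v \<in> W)}"

lemma indep_family_mono: "L \<subseteq> L' \<Longrightarrow> indep_family V L i \<subseteq> indep_family V L' i"
  unfolding indep_family_def by blast

text \<open>The form on the hyperplane \<open>e = 0\<close> that is induced by \<open>f\<close>, rewritten by means of \<open>e\<close> so that the
  coordinate \<open>v\<close> does not occur. This keeps all arrangements in the same coordinate space.\<close>

definition contract :: "('l \<Rightarrow> real) \<Rightarrow> 'l \<Rightarrow> ('l \<Rightarrow> real) \<Rightarrow> 'l \<Rightarrow> real" where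
  "contract e v f = (\<lambda>w. f w - (f v / e v) * e w)"

definition dual_dir :: "('l \<Rightarrow> real) \<Rightarrow> 'l \<Rightarrow> 'l \<Rightarrow> real" where
  "dual_dir e v = (\<lambda>w. if w = v then 1 / e v else 0)"

lemma pairing_dual_dir: "finite W \<Longrightarrow> v \<in> W \<Longrightarrow> pairing W f (dual_dir e v) = f v / e v"
  by (simp add: pairing_def dual_dir_def if_distrib[of "\<lambda>x. _ * x"] cong: if_cong)

lemma lform_contract: "lform W (contract e v f) x = lform W f x - (f v / e v) *\<^sub>R lform W e x"
  by (simp add: lform_def contract_def scaleR_diff_left sum_subtractf scaleR_sum_right)

lemma pairing_contract: "pairing W (contract e v f) c = pairing W f c - (f v / e v) * pairing W e c"
  by (simp add: pairing_def contract_def left_diff_distrib sum_subtractf sum_distrib_left algebra_simps)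

lemma contract_v: "e v \<noteq> 0 \<Longrightarrow> contract e v f v = 0"
  by (simp add: contract_def)

lemma arr_compl_translate:
  assumes "\<And>f. f \<in> L \<Longrightarrow> pairing W f c = 0" "x \<in> arr_compl W L" shows "translate W c u x \<in> arr_compl W L"
  using assms by (simp add: arr_compl_def lform_translate)

lemma arr_compl_contract: "{x \<in> extensional W. lform W e x \<noteq> 0} \<union> arr_compl W L = {x \<in> extensional W. lform W e x \<noteq> 0} \<union> arr_compl W (contract e v ` L)"
  by (auto simp: arr_compl_def lform_contract)

lemma arr_compl_restrict:
  assumes "finite V" "W \<subseteq> V" "\<And>f v. f \<in> F \<Longrightarrow> f v \<noteq> 0 \<Longrightarrow> v \<in> W" "F \<subseteq> L" "x \<in> arr_compl V L"
  shows "restrict x W \<in> arr_compl W F"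
proof -
  have "lform W f (restrict x W) = lform V f x" if "f \<in> F" for f
    by (rule lform_restrict) (use assms that in auto)
  then show ?thesis using assms(4,5) by (auto simp: arr_compl_def)
qed

lemma pairing_superset:
  assumes "finite V" "W \<subseteq> V" "\<And>v. f v \<noteq> 0 \<Longrightarrow> v \<in> W"
  shows "pairing V f c = pairing W f c"
  unfolding pairing_def by (rule sum.mono_neutral_right) (use assms in auto)

text \<open>On a line parallel to a coordinate axis, a form that does not vanish identically on the line has at
  most one zero. So a point off the given hyperplanes can be moved off one more.\<close>

lemma arr_compl_nonempty:
  assumes V: "finite V" and "finite L"
    and L: "\<And>f. f \<in> L \<Longrightarrow> \<exists>v\<in>V. f v \<noteq> 0"
  shows "\<exists>x :: 'l \<Rightarrow> 'e::euclidean_space. x \<in> arr_compl V L"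
  using assms(2) L
proof (induction L)
  case empty
  have "(\<lambda>v\<in>V. 0::'e) \<in> arr_compl V {}" by (simp add: arr_compl_def)
  then show ?case by blast
next
  case (insert f L)
  then obtain x :: "'l \<Rightarrow> 'e" where x: "x \<in> arr_compl V L" by blast
  obtain v where v: "v \<in> V" "f v \<noteq> 0" using insert.prems by blast
  obtain u :: 'e where u: "u \<in> Basis" using nonempty_Basis by blast
  have u0: "u \<noteq> 0" using u by (rule nonzero_Basis)
  define y where "y t = translate V (dual_dir (\<lambda>_. 1) v) (t *\<^sub>R u) x" for t
  have lfy: "lform V g (y t) = lform V g x + (t * g v) *\<^sub>R u" for g t
    using pairing_dual_dir[OF V v(1), of g "\<lambda>_. 1"] by (simp add: y_def lform_translate mult.commute)
  have fin: "finite {t. lform V g (y t) = 0}" if "g \<in> insert f L" for g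
  proof (cases "g v = 0")
    case True
    then have "g \<in> L" using that v by auto
    then have "lform V g x \<noteq> 0" using x by (simp add: arr_compl_def)
    then show ?thesis using True by (simp add: lfy)
  next
    case False
    have "t = s" if "lform V g (y t) = 0" "lform V g (y s) = 0" for t s
    proof -
      have "(t * g v) *\<^sub>R u = (s * g v) *\<^sub>R u" using that unfolding lfy by (metis add_left_cancel)
      then show ?thesis using False u0 by simp
    qed
    then have "{t. lform V g (y t) = 0} \<subseteq> {SOME t. lform V g (y t) = 0}" by (auto intro: someI2)
    then show ?thesis using finite_subset by blast
  qed
  have "finite (\<Union>g\<in>insert f L. {t. lform V g (y t) = 0})" using fin insert.hyps(1) by blast
  then obtain t :: real where "t \<notin> (\<Union>g\<in>insert f L. {t. lform V g (y t) = 0})"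
    using ex_new_if_finite[OF infinite_UNIV_char_0] by blast
  then have "y t \<in> arr_compl V (insert f L)" by (auto simp: arr_compl_def y_def)
  then show ?case by blast
qed

lemma generated_vanish:
  assumes "\<And>c. cocycle p X c \<Longrightarrow> cobdry p X c" shows "generated p X \<Y>"
  unfolding generated_def by (rule exI[of _ "{}"]) (simp add: assms cspan.cobdry)

lemma suspend_Basis: "suspend W e Basis X = {x \<in> extensional W. lform W e x \<noteq> 0} \<union> X"
  unfolding suspend_def by (metis (no_types, lifting) euclidean_all_zero_iff inner_commute)

text \<open>Suspending the empty set yields spheres. The first suspension has two components, and the cocycle
  that separates them by the sign of a coordinate is a pullback from the coordinates in \<open>W\<close>.\<close>

lemma generated_single_suspend:
  fixes V :: "'l set" and S :: "'e::euclidean_space set"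
  assumes V: "finite V" and v: "v \<in> V" "e v \<noteq> 0" and W: "W = {w\<in>V. e w \<noteq> 0}" and "finite S" "S \<subseteq> Basis"
  shows "generated j (subtopology (coords V) (suspend V e S ({} :: ('l \<Rightarrow> 'e) set))) {(subtopology (coords W) (suspend W e S {}), \<lambda>x. restrict x W)}"
  using assms(5,6)
proof (induction S arbitrary: j)
  case empty
  show ?case by (rule generated_vanish) (simp add: suspend_def cobdry_def singular_simplex_empty)
next
  case (insert b S)
  interpret susp_dir V e "dual_dir e v" "{} :: ('l \<Rightarrow> 'e) set"
    by unfold_locales (use V v pairing_dual_dir[OF V v(1), of e e] in auto)
  have b: "S \<subseteq> Basis" "b \<in> Basis" "b \<notin> S" using insert by auto
  have lfr: "lform W e (restrict x W) = lform V e x" for x :: "'l \<Rightarrow> 'e"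
    by (rule lform_restrict) (use V W in auto)
  have cont: "continuous_map (subtopology (coords V) (suspend V e (insert b S) ({} :: ('l \<Rightarrow> 'e) set)))
     (subtopology (coords W) (suspend W e (insert b S) {})) (\<lambda>x. restrict x W)"
    unfolding continuous_map_in_subtopology
    using continuous_map_from_subtopology[OF continuous_map_restrict_coords, of W V] W lfr by (auto simp: suspend_def)
  show ?case
  proof (cases j)
    case (Suc k)
    have sing: "{(subtopology (coords W') (suspend W' e S' X'), \<lambda>x. restrict x W') | W' X'. (W', X') \<in> {(W, {} :: ('l \<Rightarrow> 'e) set)}}
      = {(subtopology (coords W) (suspend W e S' {}), \<lambda>x. restrict x W)}" for S'
      by auto
    have IH: "generated k (subtopology (coords V) (suspend V e S ({} :: ('l \<Rightarrow> 'e) set))) {(subtopology (coords W) (suspend W e S {}), \<lambda>x. restrict x W)}"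
      by (rule insert.IH[OF b(1)])
    show ?thesis unfolding Suc
      by (rule generated_suspension[OF b, of "{(W, {})}" k, unfolded sing, OF _ IH]) (use W in auto)
  next
    case 0
    show ?thesis
    proof (cases "S = {}")
      case False
      then obtain b' where b': "b' \<in> S" by blast
      let ?x = "translate V (dual_dir e v) b' (\<lambda>_. 0)"
      have "lform V e ?x \<bullet> b' = 1"
        using dual b b' by (auto simp: lform_translate lform_zero inner_Basis)
      then have "?x \<in> suspend V e S {}" unfolding suspend_def using b' by force
      from h0_const_gen[OF h0_const_suspend[OF b this] cont] show ?thesis unfolding 0 .
    next
      case True
      let ?p = "\<lambda>j. if j = 0 then 1 else (0::real)"
      let ?X = "subtopology (coords V) (suspend V e {b} ({} :: ('l \<Rightarrow> 'e) set))" and ?Y = "subtopology (coords W) (suspend W e {b} ({} :: ('l \<Rightarrow> 'e) set))"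
      define s where "s \<sigma> = (if lform W e (\<sigma> ?p) \<bullet> b > 0 then 1 else (0::int))" for \<sigma> :: "(nat \<Rightarrow> real) \<Rightarrow> 'l \<Rightarrow> 'e"
      have s: "cocycle 0 ?Y s" unfolding s_def
        by (rule cocycle_sign[of ?Y "\<lambda>x. lform W e x \<bullet> b"])
           (use continuous_map_from_subtopology[OF continuous_map_lform_inner] in \<open>auto simp: suspend_def\<close>)
      let ?Z = "{pullback 0 (\<lambda>x. restrict x W) s, pullback 0 (\<lambda>x. restrict x W) (\<lambda>_. 1)}"
      have "cspan 0 ?X ?Z c" if c: "cocycle 0 ?X c" for c
      proof -
        have half_susp: "suspend V e {b} ({} :: ('l \<Rightarrow> 'e) set) = half_susp V e b {} \<union> half_susp V e (- b) {}"
          using half_susp_Un_suspend[of V e b "{}" "{}"] by (simp add: suspend_def)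
        have cn: "h0_const (subtopology (coords V) (half_susp V e b ({} :: ('l \<Rightarrow> 'e) set)))"
          "h0_const (subtopology (coords V) (half_susp V e (- b) ({} :: ('l \<Rightarrow> 'e) set)))"
          using contractible_half_susp_suspend[of "{}" b] contractible_h0_const b(2) by (auto simp: suspend_def)
        have "cocycle 0 (subtopology (coords V) (half_susp V e b ({} :: ('l \<Rightarrow> 'e) set))) c" "cocycle 0 (subtopology (coords V) (half_susp V e (- b) ({} :: ('l \<Rightarrow> 'e) set))) c"
          by (rule cocycle_mono[OF c]; unfold half_susp; blast)+
        then obtain m n where m: "\<And>\<sigma>. singular_simplex 0 (subtopology (coords V) (half_susp V e b {})) \<sigma> \<Longrightarrow> c \<sigma> = m"
          and n: "\<And>\<sigma>. singular_simplex 0 (subtopology (coords V) (half_susp V e (- b) {})) \<sigma> \<Longrightarrow> c \<sigma> = n"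
          using cn unfolding h0_const_def by metis
        \<comment> \<open>\<open>c\<close> has the value \<open>m\<close> on the positive and \<open>n\<close> on the negative component.\<close>
        have "cspan 0 ?X ?Z (\<lambda>\<sigma>. (m - n) * pullback 0 (\<lambda>x. restrict x W) s \<sigma> + n * pullback 0 (\<lambda>x. restrict x W) (\<lambda>_. 1) \<sigma>)"
          by (intro cspan_add cspan_cmul cspan.base) auto
        then show ?thesis
        proof (rule cspan_cong)
          fix \<sigma> assume sg: "singular_simplex 0 ?X \<sigma>"
          then have t: "singular_simplex 0 (coords V) \<sigma>" by (simp add: singular_simplex_subtopology)
          have "pullback 0 (\<lambda>x. restrict x W) s \<sigma> = (if lform V e (\<sigma> ?p) \<bullet> b > 0 then 1 else 0)"
            by (simp add: pullback_def s_def simplex_map_def standard_simplex_0 lfr)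
          moreover have "c \<sigma> = (if lform V e (\<sigma> ?p) \<bullet> b > 0 then m else n)"
          proof (cases "lform V e (\<sigma> ?p) \<bullet> b > 0")
            case True
            have "\<sigma> ?p \<in> half_susp V e b {}"
              using sg True unfolding singular_simplex_0_point[OF t] by (auto simp: half_susp_def suspend_def)
            then show ?thesis using m[of \<sigma>] True by (simp add: singular_simplex_0_point[OF t])
          next
            case False
            then have "\<sigma> ?p \<in> half_susp V e (- b) {}"
              using sg unfolding singular_simplex_0_point[OF t] by (auto simp: half_susp_def suspend_def)
            then show ?thesis using n[of \<sigma>] False by (simp add: singular_simplex_0_point[OF t])
          qed
          ultimately show "(m - n) * pullback 0 (\<lambda>x. restrict x W) s \<sigma> + n * pullback 0 (\<lambda>x. restrict x W) (\<lambda>_. 1) \<sigma> = c \<sigma>"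
            by (simp add: pullback_def)
        qed
      qed
      moreover have "\<exists>Y q \<zeta>. (Y, q) \<in> {(?Y, \<lambda>x. restrict x W)} \<and> continuous_map ?X Y q \<and> cocycle 0 Y \<zeta> \<and> z = pullback 0 q \<zeta>" if "z \<in> ?Z" for z
      proof -
        have c: "continuous_map ?X ?Y (\<lambda>x. restrict x W)" using cont True by simp
        from that consider "z = pullback 0 (\<lambda>x. restrict x W) s" | "z = pullback 0 (\<lambda>x. restrict x W) (\<lambda>_. 1)" by blast
        then show ?thesis
        proof cases
          case 1 show ?thesis by (intro exI conjI) (rule singletonI, rule c, rule s, rule 1)
        next
          case 2 show ?thesis by (intro exI conjI) (rule singletonI, rule c, rule cocycle_const, rule 2)
        qed
      qed
      ultimately have "generated 0 ?X {(?Y, \<lambda>x. restrict x W)}"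
        unfolding generated_def by (intro exI[of _ ?Z] conjI ballI allI impI) auto
      then show ?thesis unfolding 0 True .
    qed
  qed
qed

lemma subtopology_arr_compl_empty: "subtopology (coords W) (arr_compl W {}) = (coords W :: ('l \<Rightarrow> 'e::euclidean_space) topology)"
proof -
  have "(arr_compl W {} :: ('l \<Rightarrow> 'e) set) = topspace (coords W)" unfolding topspace_coords by (simp add: arr_compl_def)
  then show ?thesis by (simp only: subtopology_topspace)
qed

lemma indep_forms_superset:
  assumes "finite V" "W \<subseteq> V" "\<And>f v. f \<in> F \<Longrightarrow> f v \<noteq> 0 \<Longrightarrow> v \<in> W" "indep_forms W F"
  shows "indep_forms V F"
  unfolding indep_forms_def
proof
  fix f assume f: "f \<in> F"
  obtain c where c: "pairing W f c = 1" "\<forall>g\<in>F - {f}. pairing W g c = 0"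
    using assms(4) f unfolding indep_forms_def by blast
  have "pairing V g c = pairing W g c" if "g \<in> F" for g
    by (rule pairing_superset) (use assms that in auto)
  then show "\<exists>c. pairing V f c = 1 \<and> (\<forall>g\<in>F - {f}. pairing V g c = 0)"
    using c f by (intro exI[of _ c]) auto
qed

text \<open>The last alternative covers degree 0, where only the constants are needed; they come from the empty
  family of forms.\<close>

definition susp_family :: "'l set \<Rightarrow> ('l \<Rightarrow> real) \<Rightarrow> ('l \<Rightarrow> real) set \<Rightarrow> nat \<Rightarrow> nat \<Rightarrow> ('l set \<times> ('l \<Rightarrow> 'e::euclidean_space) set) set" where
  "susp_family V e L j s = {(W, arr_compl W F) | W F. F \<subseteq> L \<and> indep_forms W F \<and> W \<subseteq> V \<and> (\<forall>v. e v \<noteq> 0 \<longrightarrow> v \<in> W) \<and>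
      (\<forall>f\<in>F. \<forall>v. f v \<noteq> 0 \<longrightarrow> v \<in> W) \<and> card W \<le> 2 * card F + 2 \<and> (card F + s \<le> j \<or> F = {} \<and> j = 0)}"

text \<open>A suspension raises both the degree and \<open>card S\<close> by one, so the bound on \<open>card F\<close> persists. Since
  the complement of the arrangement is nonempty, its suspensions are connected and need only
  constants in degree 0. These constants die in the next suspension: the complement of the empty
  arrangement is contractible.\<close>

lemma generated_suspend:
  fixes V :: "'l set" and S :: "'e::euclidean_space set"
  assumes V: "finite V" and v: "v \<in> V" "e v \<noteq> 0" and eV: "\<And>w. e w \<noteq> 0 \<Longrightarrow> w \<in> V" and e2: "card {w. e w \<noteq> 0} \<le> 2"
    and L: "finite L" "\<And>f. f \<in> L \<Longrightarrow> f v = 0" "\<And>f w. f \<in> L \<Longrightarrow> f w \<noteq> 0 \<Longrightarrow> w \<in> V" "\<And>f. f \<in> L \<Longrightarrow> \<exists>w. f w \<noteq> 0"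
    and g: "\<And>j. generated j (subtopology (coords V) (arr_compl V L :: ('l \<Rightarrow> 'e) set)) (indep_family V L j)"
    and S: "finite S" "S \<subseteq> Basis"
  shows "generated j (subtopology (coords V) (suspend V e S (arr_compl V L)))
     (susp_models e S (susp_family V e L j (card S)))"
  using S
proof (induction S arbitrary: j)
  case empty
  have x0: "suspend W e {} X = X" for W and X :: "('l \<Rightarrow> 'e) set" by (simp add: suspend_def)
  show ?case
    unfolding x0
  proof (rule generated_refine[OF g])
    fix Y :: "('l \<Rightarrow> 'e) topology" and q :: "('l \<Rightarrow> 'e) \<Rightarrow> ('l \<Rightarrow> 'e)" assume "(Y, q) \<in> indep_family V L j"
    then obtain W F where Y: "Y = subtopology (coords W) (arr_compl W F)" "q = (\<lambda>x. restrict x W)"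
      and F: "F \<subseteq> L" "indep_forms W F" "card F \<le> j" "W \<subseteq> V" "card W \<le> 2 * card F" "\<forall>f\<in>F. \<forall>v. f v \<noteq> 0 \<longrightarrow> v \<in> W"
      unfolding indep_family_def by blast
    \<comment> \<open>The coordinates of \<open>e\<close> are needed from the first suspension on.\<close>
    let ?W = "W \<union> {w. e w \<noteq> 0}"
    have WV: "?W \<subseteq> V" using F(4) eV by auto
    have fW: "finite ?W" using V WV finite_subset by blast
    have "card ?W \<le> 2 * card F + 2" using card_Un_le[of W "{w. e w \<noteq> 0}"] F(5) e2 by linarith
    moreover have "indep_forms ?W F" by (rule indep_forms_superset[OF fW _ _ F(2)]) (use F in auto)
    ultimately have "(?W, arr_compl ?W F) \<in> susp_family V e L j (card {})"
      using F WV unfolding susp_family_def by (auto simp del: Un_iff)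
    moreover have "continuous_map (subtopology (coords V) (arr_compl V L)) (subtopology (coords ?W) (arr_compl ?W F)) (\<lambda>x. restrict x ?W)"
      unfolding continuous_map_in_subtopology
    proof
      show "continuous_map (subtopology (coords V) (arr_compl V L)) (coords ?W) (\<lambda>x. restrict x ?W)"
        by (rule continuous_map_from_subtopology[OF continuous_map_restrict_coords[OF WV]])
      show "(\<lambda>x. restrict x ?W) \<in> topspace (subtopology (coords V) (arr_compl V L)) \<rightarrow> arr_compl ?W F"
        using arr_compl_restrict[OF V WV _ F(1)] F(6) by auto
    qed
    moreover have "continuous_map (subtopology (coords ?W) (arr_compl ?W F)) Y (\<lambda>x. restrict x W)"
      unfolding continuous_map_in_subtopology Y
    proof
      show "continuous_map (subtopology (coords ?W) (arr_compl ?W F)) (coords W) (\<lambda>x. restrict x W)"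
        by (rule continuous_map_from_subtopology[OF continuous_map_restrict_coords]) auto
      show "(\<lambda>x. restrict x W) \<in> topspace (subtopology (coords ?W) (arr_compl ?W F)) \<rightarrow> arr_compl W F"
        using arr_compl_restrict[OF fW _ _ order_refl[of F], of W] F(6) by auto
    qed
    moreover have "q x = restrict (restrict x ?W) W" for x
      unfolding Y by (simp add: Int_absorb1)
    ultimately show "(\<forall>c. cocycle j Y c \<longrightarrow> cobdry j Y c) \<or>
       (\<exists>Y' q' h. (Y', q') \<in> {(subtopology (coords W) X', \<lambda>x. restrict x W) | W X'. (W, X') \<in> susp_family V e L j (card {})} \<and>
          continuous_map (subtopology (coords V) (arr_compl V L)) Y' q' \<and> continuous_map Y' Y h \<and>
          (\<forall>x\<in>topspace (subtopology (coords V) (arr_compl V L)). q x = h (q' x)))"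
      by blast
  qed
next
  case (insert b S)
  have dv: "pairing V f (dual_dir e v) = f v / e v" for f using pairing_dual_dir[OF V v(1)] .
  interpret susp_dir V e "dual_dir e v" "arr_compl V L :: ('l \<Rightarrow> 'e) set"
  proof unfold_locales
    show "finite V" "pairing V e (dual_dir e v) = 1" using V v dv by auto
    show "openin (coords V) (arr_compl V L)" by (rule openin_arr_compl[OF L(1)])
    show "translate V (dual_dir e v) u x \<in> arr_compl V L" if "x \<in> arr_compl V L" for x and u :: 'e
      by (rule arr_compl_translate[OF _ that]) (simp add: dv L(2))
  qed
  have b: "S \<subseteq> Basis" "b \<in> Basis" "b \<notin> S" using insert by auto
  let ?W0 = "{w. e w \<noteq> 0}"
  have W0: "?W0 \<subseteq> V" "finite ?W0" using eV V finite_subset[of ?W0 V] by auto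
  show ?case
  proof (cases j)
    case 0
    have "\<exists>w\<in>V. f w \<noteq> 0" if "f \<in> L" for f using L(3,4)[OF that] by blast
    from arr_compl_nonempty[OF V L(1) this] obtain x :: "'l \<Rightarrow> 'e" where "x \<in> arr_compl V L" by blast
    then have x: "x \<in> suspend V e S (arr_compl V L)" by (simp add: suspend_def)
    have e: "suspend ?W0 e (insert b S) (arr_compl ?W0 {} :: ('l \<Rightarrow> 'e) set) = arr_compl ?W0 {}"
      by (auto simp: suspend_def arr_compl_def)
    have "continuous_map (subtopology (coords V) (suspend V e (insert b S) (arr_compl V L)))
        (subtopology (coords ?W0) (suspend ?W0 e (insert b S) (arr_compl ?W0 {}))) (\<lambda>x. restrict x ?W0)"
      unfolding e subtopology_arr_compl_empty
      by (rule continuous_map_from_subtopology[OF continuous_map_restrict_coords[OF W0(1)]])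
    from h0_const_gen[OF h0_const_suspend[OF b x] this]
    show ?thesis unfolding 0
    proof (rule generated_mono)
      have "(?W0, arr_compl ?W0 {}) \<in> susp_family V e L 0 (card (insert b S))"
        using W0(1) e2 unfolding susp_family_def indep_forms_def by auto
      then show "{(subtopology (coords ?W0) (suspend ?W0 e (insert b S) (arr_compl ?W0 {})), \<lambda>x. restrict x ?W0)}
        \<subseteq> susp_models e (insert b S) (susp_family V e L 0 (card (insert b S)))"
        by blast
    qed
  next
    case (Suc k)
    have fm: "W \<subseteq> V \<and> (\<forall>v\<in>V. e v \<noteq> 0 \<longrightarrow> v \<in> W) \<and> openin (coords W) X' \<and> (\<forall>x\<in>arr_compl V L. restrict x W \<in> X')"
      if WX: "(W, X') \<in> susp_family V e L k (card S)" for W and X' :: "('l \<Rightarrow> 'e) set"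
    proof -
      obtain F where F: "X' = arr_compl W F" "F \<subseteq> L" "W \<subseteq> V" "\<forall>v. e v \<noteq> 0 \<longrightarrow> v \<in> W" "\<forall>f\<in>F. \<forall>v. f v \<noteq> 0 \<longrightarrow> v \<in> W"
        using WX unfolding susp_family_def by blast
      have "finite F" using F(2) L(1) finite_subset by blast
      then have "openin (coords W) X'" unfolding F(1) by (rule openin_arr_compl)
      moreover have "restrict x W \<in> X'" if "x \<in> arr_compl V L" for x
        unfolding F(1) by (rule arr_compl_restrict[OF V F(3) _ F(2) that]) (use F(5) in blast)
      ultimately show ?thesis using F(3,4) by blast
    qed
    have "generated (Suc k) (subtopology (coords V) (suspend V e (insert b S) (arr_compl V L)))
       (susp_models e (insert b S) (susp_family V e L k (card S)))"
      by (rule generated_suspension[OF b fm insert.IH[OF b(1)]])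
    then show ?thesis unfolding Suc
    proof (rule generated_refine)
      fix Y :: "('l \<Rightarrow> 'e) topology" and q :: "('l \<Rightarrow> 'e) \<Rightarrow> ('l \<Rightarrow> 'e)"
      assume "(Y, q) \<in> susp_models e (insert b S) (susp_family V e L k (card S))"
        and cont: "continuous_map (subtopology (coords V) (suspend V e (insert b S) (arr_compl V L))) Y q"
      then obtain W F where Y: "Y = subtopology (coords W) (suspend W e (insert b S) (arr_compl W F))" "q = (\<lambda>x. restrict x W)"
        and F: "F \<subseteq> L \<and> indep_forms W F \<and> W \<subseteq> V \<and> (\<forall>v. e v \<noteq> 0 \<longrightarrow> v \<in> W) \<and>
          (\<forall>f\<in>F. \<forall>v. f v \<noteq> 0 \<longrightarrow> v \<in> W) \<and> card W \<le> 2 * card F + 2" "card F + card S \<le> k \<or> F = {}"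
        unfolding susp_family_def by blast
      show "(\<forall>c. cocycle (Suc k) Y c \<longrightarrow> cobdry (Suc k) Y c) \<or>
       (\<exists>Y' q' h. (Y', q') \<in> susp_models e (insert b S) (susp_family V e L (Suc k) (card (insert b S))) \<and>
          continuous_map (subtopology (coords V) (suspend V e (insert b S) (arr_compl V L))) Y' q' \<and> continuous_map Y' Y h \<and>
          (\<forall>x\<in>topspace (subtopology (coords V) (suspend V e (insert b S) (arr_compl V L))). q x = h (q' x)))"
      proof (cases "F = {}")
        case True
        have "suspend W e (insert b S) (arr_compl W {} :: ('l \<Rightarrow> 'e) set) = arr_compl W {}" by (auto simp: suspend_def arr_compl_def)
        then have "Y = coords W" unfolding Y True by (simp only: subtopology_arr_compl_empty)
        moreover have "finite W" using F V finite_subset by blast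
        ultimately show ?thesis using contractible_cocycle_imp_cobdry[OF contractible_coords] by blast
      next
        case False
        then have "(W, arr_compl W F) \<in> susp_family V e L (Suc k) (card (insert b S))"
          using F insert.hyps unfolding susp_family_def by auto
        then show ?thesis using cont unfolding Y
          by (intro disjI2 exI[of _ "subtopology (coords W) (suspend W e (insert b S) (arr_compl W F))"] exI[of _ "\<lambda>x. restrict x W"] exI[of _ "\<lambda>x. x"]) auto
      qed
    qed
  qed
qed

text \<open>Dual vectors of the contractions, moved into \<open>e = 0\<close> along the direction dual to \<open>e\<close>, are dual to
  the original forms. Correcting that direction by them gives the dual vector of \<open>e\<close>.\<close>

lemma indep_forms_insert_contract:
  assumes W: "finite W" "v \<in> W" "e v \<noteq> 0" and F0: "e \<notin> F0" "finite F0" and inj: "inj_on (contract e v) F0" and ind: "indep_forms W (contract e v ` F0)"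
  shows "indep_forms W (insert e F0)"
proof -
  have dv: "pairing W f (dual_dir e v) = f v / e v" for f using pairing_dual_dir[OF W(1,2)] .
  have "\<exists>c. pairing W f c = 1 \<and> (\<forall>g\<in>F0 - {f}. pairing W g c = 0) \<and> pairing W e c = 0" if f: "f \<in> F0" for f
  proof -
    obtain c where c: "pairing W (contract e v f) c = 1" "\<And>g. g \<in> contract e v ` F0 - {contract e v f} \<Longrightarrow> pairing W g c = 0"
      using ind f unfolding indep_forms_def by blast
    define c' where "c' w = c w - pairing W e c * dual_dir e v w" for w
    have "pairing W g c' = pairing W g c - pairing W e c * pairing W g (dual_dir e v)" for g
      by (simp add: pairing_def c'_def right_diff_distrib sum_subtractf sum_distrib_left algebra_simps)
    then have d: "pairing W g c' = pairing W (contract e v g) c" for g by (simp add: dv pairing_contract)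
    have ee: "contract e v e = (\<lambda>_. 0)" using W by (simp add: contract_def)
    have "pairing W g c' = 0" if "g \<in> F0 - {f}" for g
    proof -
      have "contract e v g \<noteq> contract e v f" using inj that f by (auto dest: inj_onD)
      then show ?thesis unfolding d using c(2) that by blast
    qed
    moreover have "pairing W e c' = 0" unfolding d ee by (simp add: pairing_def)
    ultimately show ?thesis using c(1) d by metis
  qed
  then obtain C where C: "\<And>f. f \<in> F0 \<Longrightarrow> pairing W f (C f) = 1" "\<And>f g. f \<in> F0 \<Longrightarrow> g \<in> F0 - {f} \<Longrightarrow> pairing W g (C f) = 0"
     "\<And>f. f \<in> F0 \<Longrightarrow> pairing W e (C f) = 0" by metis
  define c where "c w = dual_dir e v w - (\<Sum>f\<in>F0. (f v / e v) * C f w)" for w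
  have dc: "pairing W g c = g v / e v - (\<Sum>f\<in>F0. (f v / e v) * pairing W g (C f))" for g
  proof -
    have "pairing W g c = pairing W g (dual_dir e v) - (\<Sum>w\<in>W. \<Sum>f\<in>F0. g w * ((f v / e v) * C f w))"
      by (simp add: pairing_def c_def right_diff_distrib sum_subtractf sum_distrib_left)
    also have "(\<Sum>w\<in>W. \<Sum>f\<in>F0. g w * ((f v / e v) * C f w)) = (\<Sum>f\<in>F0. (f v / e v) * pairing W g (C f))"
      by (subst sum.swap) (simp add: pairing_def sum_distrib_left algebra_simps)
    finally show ?thesis by (simp add: dv)
  qed
  have "pairing W e c = 1" using W C(3) by (simp add: dc)
  moreover have "pairing W g c = 0" if "g \<in> F0" for g
  proof -
    have "(\<Sum>f\<in>F0. (f v / e v) * pairing W g (C f)) = (\<Sum>f\<in>F0. if f = g then g v / e v else 0)"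
      by (rule sum.cong) (use C that in auto)
    then show ?thesis using that F0 by (simp add: dc)
  qed
  ultimately show ?thesis
    unfolding indep_forms_def using C F0(1) by (metis (no_types, lifting) Diff_iff insert_iff singletonD singletonI)
qed

text \<open>The complement of \<open>F0\<close> is invariant in the direction dual to \<open>e\<close>, so its union with a half-space of
  \<open>e\<close> is contractible, and \<open>e\<close> or all forms of \<open>F0\<close> are nonzero at each of its points. The same works
  with \<open>e\<close> and \<open>F0\<close> exchanged, in the direction of the sum of the vectors dual to \<open>F0\<close>.\<close>

lemma indep_forms_vanish:
  fixes c :: "('l \<Rightarrow> 'e::euclidean_space) cochain"
  assumes W: "finite W" and F0: "finite F0" "e \<notin> F0" and ind: "indep_forms W (insert e F0)"
    and c: "cocycle (Suc i) (subtopology (coords W) (arr_compl W F0 \<union> arr_compl W {e} :: ('l \<Rightarrow> 'e) set)) c"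
  shows "cobdry (Suc i) (subtopology (coords W) (arr_compl W F0 :: ('l \<Rightarrow> 'e) set)) c"
    and "cobdry (Suc i) (subtopology (coords W) (arr_compl W {e} :: ('l \<Rightarrow> 'e) set)) c"
proof -
  obtain u :: 'e where "u \<in> Basis" using nonempty_Basis by blast
  then have u: "u \<bullet> u = 1" by (simp add: inner_Basis)
  obtain C where C: "\<And>f. f \<in> insert e F0 \<Longrightarrow> pairing W f (C f) = 1" "\<And>f g. f \<in> insert e F0 \<Longrightarrow> g \<in> insert e F0 - {f} \<Longrightarrow> pairing W g (C f) = 0"
    using ind unfolding indep_forms_def by metis
  have key: "cobdry (Suc i) (subtopology (coords W) X) c"
    if "finite G" "\<And>f. f \<in> G \<Longrightarrow> pairing W f d = 1" "X \<subseteq> extensional W" "\<And>x t. x \<in> X \<Longrightarrow> t \<ge> 0 \<Longrightarrow> translate W d (t *\<^sub>R u) x \<in> X"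
      "{x \<in> extensional W. \<forall>f\<in>G. lform W f x \<bullet> u > 0} \<union> X \<subseteq> arr_compl W F0 \<union> arr_compl W {e}" for G d and X :: "('l \<Rightarrow> 'e) set"
  proof -
    have "contractible_space (subtopology (coords W) ({x \<in> extensional W. \<forall>f\<in>G. lform W f x \<bullet> u > 0} \<union> X))"
      by (rule contractible_push[OF W that(1) that(2) u that(3) that(4)])
    from contractible_cocycle_imp_cobdry[OF this cocycle_mono[OF c that(5)]]
    show ?thesis by (rule cobdry_mono) auto
  qed
  have ne: "y \<noteq> 0" if "y \<bullet> u > 0" for y :: 'e using that by auto
  show "cobdry (Suc i) (subtopology (coords W) (arr_compl W F0 :: ('l \<Rightarrow> 'e) set)) c"
  proof (rule key[of "{e}" "C e"])
    show "translate W (C e) (t *\<^sub>R u) x \<in> arr_compl W F0" if "x \<in> arr_compl W F0" for x t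
      by (rule arr_compl_translate[OF _ that]) (use C(2)[of e] F0(2) in auto)
  qed (use C(1) ne in \<open>auto simp: arr_compl_def\<close>)
  define d where "d w = (\<Sum>f\<in>F0. C f w)" for w
  have dd: "pairing W g d = (\<Sum>f\<in>F0. pairing W g (C f))" for g
    unfolding pairing_def d_def sum_distrib_left by (subst sum.swap) simp
  have d1: "pairing W g d = 1" if "g \<in> F0" for g
  proof -
    have "(\<Sum>f\<in>F0. pairing W g (C f)) = (\<Sum>f\<in>F0. if f = g then 1 else 0)"
      by (rule sum.cong) (use C that in auto)
    then show ?thesis using that F0 by (simp add: dd)
  qed
  have d0: "pairing W e d = 0" unfolding dd by (rule sum.neutral) (use C(2) F0(2) in auto)
  show "cobdry (Suc i) (subtopology (coords W) (arr_compl W {e} :: ('l \<Rightarrow> 'e) set)) c"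
  proof (rule key[of F0 d])
    show "translate W d (t *\<^sub>R u) x \<in> arr_compl W {e}" if "x \<in> arr_compl W {e}" for x t
      by (rule arr_compl_translate[OF _ that]) (use d0 in auto)
  qed (use d1 ne F0 in \<open>auto simp: arr_compl_def\<close>)
qed

text \<open>Induction on the number of forms. If some other form is a multiple of \<open>e\<close>, it can be dropped.
  Otherwise no contraction is zero, the contractions still involve at most two coordinates each, and
  \<open>A\<close>, \<open>B\<close> and \<open>A \<union> B\<close> in Mayer--Vietoris are covered by the induction hypothesis, by
  \<open>generated_single_suspend\<close> and by \<open>generated_suspend\<close>.\<close>

theorem generated_complement:
  fixes V :: "'l set"
  assumes D: "DIM('e::euclidean_space) \<ge> 2" and V: "finite V" and "finite L"
    and "\<And>f w. f \<in> L \<Longrightarrow> f w \<noteq> 0 \<Longrightarrow> w \<in> V" "\<And>f. f \<in> L \<Longrightarrow> \<exists>w. f w \<noteq> 0" "\<And>f. f \<in> L \<Longrightarrow> card {w. f w \<noteq> 0} \<le> 2"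
  shows "generated i (subtopology (coords V) (arr_compl V L :: ('l \<Rightarrow> 'e) set)) (indep_family V L i)"
  using assms(3-)
proof (induction "card L" arbitrary: L i rule: less_induct)
  case less
  note L = less.prems
  show ?case
  proof (cases "L = {}")
    case True
    have "contractible_space (subtopology (coords V) (arr_compl V {} :: ('l \<Rightarrow> 'e) set))"
      unfolding subtopology_arr_compl_empty by (rule contractible_coords[OF V])
    note con = this
    show ?thesis
    proof (cases i)
      case 0
      have "continuous_map (subtopology (coords V) (arr_compl V L)) (subtopology (coords {}) (arr_compl {} {})) (\<lambda>x. restrict x {})"
        unfolding subtopology_arr_compl_empty by (rule continuous_map_from_subtopology[OF continuous_map_restrict_coords]) simp
      from h0_const_gen[OF contractible_h0_const this] con
      have "generated 0 (subtopology (coords V) (arr_compl V L :: ('l \<Rightarrow> 'e) set)) {(subtopology (coords {}) (arr_compl {} {}), \<lambda>x. restrict x {})}"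
        unfolding True .
      then show ?thesis unfolding 0
      proof (rule generated_mono)
        show "{(subtopology (coords {}) (arr_compl {} {}), \<lambda>x. restrict x {})} \<subseteq> indep_family V L 0"
          unfolding indep_family_def by (rule subsetI, rule CollectI, rule exI[of _ "{}"], rule exI[of _ "{}"]) (simp add: indep_forms_def)
      qed
    next
      case (Suc k)
      show ?thesis unfolding Suc True by (rule generated_vanish) (rule contractible_cocycle_imp_cobdry[OF con])
    qed
  next
    case False
    then obtain e where e: "e \<in> L" by blast
    then obtain v where v: "e v \<noteq> 0" "v \<in> V" using L(2,3) by blast
    have eV: "w \<in> V" if "e w \<noteq> 0" for w using L(2) e that by blast
    let ?L0 = "L - {e}"
    have smaller: "generated i (subtopology (coords V) (arr_compl V (L - {f}) :: ('l \<Rightarrow> 'e) set)) (indep_family V L i)" if "f \<in> L" for f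
    proof -
      have "card (L - {f}) < card L" using that L(1) by (meson card_Diff1_less)
      then have "generated i (subtopology (coords V) (arr_compl V (L - {f}) :: ('l \<Rightarrow> 'e) set)) (indep_family V (L - {f}) i)"
        by (rule less.hyps) (use L in auto)
      then show ?thesis by (rule generated_mono) (rule indep_family_mono, blast)
    qed
    show ?thesis
    proof (cases "\<exists>f\<in>?L0. \<forall>w. contract e v f w = 0")
      case True
      then obtain f where f: "f \<in> ?L0" "\<And>w. contract e v f w = 0" by blast
      have fe: "f w = (f v / e v) * e w" for w using f(2)[of w] by (simp add: contract_def)
      have "f v \<noteq> 0" using L(3)[of f] f(1) fe by (metis DiffD1 div_0 mult_zero_left)
      moreover have "lform V f x = (f v / e v) *\<^sub>R lform V e x" for x :: "'l \<Rightarrow> 'e"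
        unfolding lform_def scaleR_sum_right by (rule sum.cong[OF refl], subst fe) simp
      ultimately have lf0: "lform V f x = 0 \<longleftrightarrow> lform V e x = 0" for x :: "'l \<Rightarrow> 'e"
        using v by simp
      have "e \<in> L - {f}" using f(1) e by blast
      then have "(arr_compl V L :: ('l \<Rightarrow> 'e) set) = arr_compl V (L - {f})"
        unfolding arr_compl_def using lf0 by blast
      then show ?thesis using smaller[of f] f(1) by simp
    next
      case False
      let ?L' = "contract e v ` ?L0"
      have cL: "card ?L' < card L"
        using card_image_le[of ?L0 "contract e v"] card_Diff1_less[OF L(1) e] L(1) by simp
      have sup: "{w. contract e v f w \<noteq> 0} \<subseteq> {w. f w \<noteq> 0} \<union> {w. e w \<noteq> 0}" for f by (auto simp: contract_def)
      have sup2: "card {w. contract e v f w \<noteq> 0} \<le> 2" if "f \<in> ?L0" for f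
      proof (cases "f v = 0")
        case True
        then have "contract e v f = f" by (simp add: contract_def)
        then show ?thesis using L(4) that by simp
      next
        case False
        have fin: "finite {w. f w \<noteq> 0}" "finite {w. e w \<noteq> 0}"
          using finite_subset[OF _ V, of "{w. f w \<noteq> 0}"] finite_subset[OF _ V, of "{w. e w \<noteq> 0}"] L(2) that e by auto
        let ?A = "{w. f w \<noteq> 0} - {v}" and ?B = "{w. e w \<noteq> 0} - {v}"
        have "{w. contract e v f w \<noteq> 0} \<subseteq> ?A \<union> ?B" using sup contract_v[of e v f, OF v(1)] by auto
        then have "card {w. contract e v f w \<noteq> 0} \<le> card (?A \<union> ?B)" using fin by (intro card_mono) auto
        also have "\<dots> \<le> card ?A + card ?B" by (rule card_Un_le)
        also have "card ?A \<le> 1" using L(4)[of f] that False fin by (auto simp: card_Diff_singleton)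
        also have "card ?B \<le> 1" using L(4)[of e] e v fin by (auto simp: card_Diff_singleton)
        finally show ?thesis by simp
      qed
      have L': "finite ?L'" "\<And>f. f \<in> ?L' \<Longrightarrow> f v = 0" "\<And>f w. f \<in> ?L' \<Longrightarrow> f w \<noteq> 0 \<Longrightarrow> w \<in> V" "\<And>f. f \<in> ?L' \<Longrightarrow> \<exists>w. f w \<noteq> 0"
        "\<And>f. f \<in> ?L' \<Longrightarrow> card {w. f w \<noteq> 0} \<le> 2"
        using L(1) contract_v[of e v, OF v(1)] False sup2 sup L(2) eV by (auto, blast)
      have gL': "generated j (subtopology (coords V) (arr_compl V ?L' :: ('l \<Rightarrow> 'e) set)) (indep_family V ?L' j)" for j
        by (rule less.hyps[OF cL]) (use L' in auto)
      have gU: "generated (Suc i) (subtopology (coords V) (suspend V e Basis (arr_compl V ?L' :: ('l \<Rightarrow> 'e) set)))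
         (susp_models e Basis (susp_family V e ?L' (Suc i) DIM('e)))"
      proof (rule generated_suspend[where v = v])
        show "finite V" "v \<in> V" "e v \<noteq> 0" by (fact V v)+
        show "w \<in> V" if "e w \<noteq> 0" for w using eV[OF that] .
        show "card {w. e w \<noteq> 0} \<le> 2" using L(4) e by blast
        show "finite ?L'" by (fact L'(1))
        show "f v = 0" "\<exists>w. f w \<noteq> 0" if "f \<in> ?L'" for f using L'(2,4) that by blast+
        show "w \<in> V" if "f \<in> ?L'" "f w \<noteq> 0" for f w using L'(3) that by blast
        show "generated j (subtopology (coords V) (arr_compl V ?L' :: ('l \<Rightarrow> 'e) set)) (indep_family V ?L' j)" for j by (rule gL')
      qed auto
      have U: "suspend V e Basis (arr_compl V ?L') = arr_compl V ?L0 \<union> (arr_compl V {e} :: ('l \<Rightarrow> 'e) set)"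
        unfolding suspend_Basis arr_compl_contract[symmetric] by (auto simp: arr_compl_def)
      have AB: "(arr_compl V L :: ('l \<Rightarrow> 'e) set) = arr_compl V ?L0 \<inter> arr_compl V {e}" using e by (auto simp: arr_compl_def)
      show ?thesis unfolding AB
      proof (rule generated_intersection)
        show "openin (coords V) (arr_compl V ?L0 :: ('l \<Rightarrow> 'e) set)" "openin (coords V) (arr_compl V {e} :: ('l \<Rightarrow> 'e) set)"
          using openin_arr_compl L(1) by blast+
        show "generated (Suc i) (subtopology (coords V) (arr_compl V ?L0 \<union> arr_compl V {e} :: ('l \<Rightarrow> 'e) set))
         (susp_models e Basis (susp_family V e ?L' (Suc i) DIM('e)))"
          using gU unfolding U .
        show "generated i (subtopology (coords V) (arr_compl V ?L0 :: ('l \<Rightarrow> 'e) set)) (indep_family V L i)" by (rule smaller[OF e])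
        let ?W0 = "{w. e w \<noteq> 0}"
        have W0: "?W0 = {w\<in>V. e w \<noteq> 0}" using eV by auto
        have e1: "suspend W e Basis {} = (arr_compl W {e} :: ('l \<Rightarrow> 'e) set)" for W
          unfolding suspend_Basis by (auto simp: arr_compl_def)
        show "generated i (subtopology (coords V) (arr_compl V {e} :: ('l \<Rightarrow> 'e) set)) (indep_family V L i)"
        proof (cases i)
          case 0
          \<comment> \<open>Since \<open>DIM('e) \<ge> 2\<close>, the locus \<open>e \<noteq> 0\<close> is a suspension of a nonempty set.\<close>
          obtain b :: 'e where b: "b \<in> Basis" using nonempty_Basis by blast
          have "card (Basis - {b}) > 0" using D b by (simp add: card_Diff_singleton)
          then obtain b' where b': "b' \<in> Basis - {b}" by (metis all_not_in_conv card.empty less_irrefl)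
          interpret susp_dir V e "dual_dir e v" "{} :: ('l \<Rightarrow> 'e) set"
            by unfold_locales (use V v pairing_dual_dir[OF V v(2), of e e] in auto)
          let ?x = "translate V (dual_dir e v) b' (\<lambda>_. 0)"
          have "lform V e ?x \<bullet> b' = 1" using dual b' by (auto simp: lform_translate lform_zero inner_Basis)
          then have x: "?x \<in> suspend V e (Basis - {b}) {}" unfolding suspend_def using b' by force
          have "h0_const (subtopology (coords V) (suspend V e (insert b (Basis - {b})) ({} :: ('l \<Rightarrow> 'e) set)))"
            by (rule h0_const_suspend[OF _ b _ x]) auto
          then have cn: "h0_const (subtopology (coords V) (arr_compl V {e} :: ('l \<Rightarrow> 'e) set))"
            using b by (simp add: insert_absorb e1)
          have "continuous_map (subtopology (coords V) (arr_compl V {e})) (subtopology (coords {}) (arr_compl {} {})) (\<lambda>x. restrict x {})"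
            unfolding subtopology_arr_compl_empty by (rule continuous_map_from_subtopology[OF continuous_map_restrict_coords]) simp
          from h0_const_gen[OF cn this] show ?thesis unfolding 0
          proof (rule generated_mono)
            show "{(subtopology (coords {}) (arr_compl {} {}), \<lambda>x. restrict x {})} \<subseteq> indep_family V L 0"
              unfolding indep_family_def by (rule subsetI, rule CollectI, rule exI[of _ "{}"], rule exI[of _ "{}"]) (simp add: indep_forms_def)
          qed
        next
          case (Suc k)
          have "generated i (subtopology (coords V) (suspend V e Basis ({} :: ('l \<Rightarrow> 'e) set))) {(subtopology (coords ?W0) (suspend ?W0 e Basis {}), \<lambda>x. restrict x ?W0)}"
            by (rule generated_single_suspend[where V = V and v = v and e = e, OF V v(2,1) W0]) auto
          then show ?thesis unfolding e1
          proof (rule generated_mono)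
            have fW0: "finite ?W0" "v \<in> ?W0" using V W0 v by auto
            have "pairing ?W0 e (dual_dir e v) = 1" using pairing_dual_dir[OF fW0, of e e] v by simp
            then have "indep_forms ?W0 {e}" unfolding indep_forms_def by blast
            then show "{(subtopology (coords ?W0) (arr_compl ?W0 {e}), \<lambda>x. restrict x ?W0)} \<subseteq> indep_family V L i"
              using e Suc L(4)[OF e] eV unfolding indep_family_def
              by (intro subsetI CollectI exI[of _ ?W0] exI[of _ "{e}"]) auto
          qed
        qed
      next
        fix Y :: "('l \<Rightarrow> 'e) topology" and q :: "('l \<Rightarrow> 'e) \<Rightarrow> ('l \<Rightarrow> 'e)"
        assume "(Y, q) \<in> susp_models e Basis (susp_family V e ?L' (Suc i) DIM('e))"
        then obtain W F where Y: "Y = subtopology (coords W) (suspend W e Basis (arr_compl W F))" "q = (\<lambda>x. restrict x W)"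
          and F: "F \<subseteq> ?L'" "indep_forms W F" "W \<subseteq> V" "\<forall>v. e v \<noteq> 0 \<longrightarrow> v \<in> W" "\<forall>f\<in>F. \<forall>v. f v \<noteq> 0 \<longrightarrow> v \<in> W"
            "card W \<le> 2 * card F + 2" "card F + DIM('e) \<le> Suc i"
          unfolding susp_family_def by blast
        obtain F0 where F0: "F0 \<subseteq> ?L0" "inj_on (contract e v) F0" "F = contract e v ` F0"
          using F(1) by (meson subset_image_inj)
        have fF0: "finite F0" "e \<notin> F0" using F0(1) L(1) finite_subset[of F0 ?L0] by auto
        have fW: "finite W" "v \<in> W" using F(3,4) V v finite_subset by auto
        have cF: "card F = card F0" unfolding F0(3) by (rule card_image[OF F0(2)])
        have ind: "indep_forms W (insert e F0)"
          by (rule indep_forms_insert_contract[where W = W and v = v and e = e, OF fW v(1) fF0(2,1) F0(2)]) (use F(2) F0(3) in simp)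
        have supW: "w \<in> W" if "f \<in> insert e F0" "f w \<noteq> 0" for f w
        proof (rule ccontr)
          assume w: "w \<notin> W"
          then have "e w = 0" using F(4) by blast
          moreover have "f \<in> F0" using that calculation by auto
          ultimately show False using F(5) F0(3) w that(2) by (auto simp: contract_def)
        qed
        have xsW: "suspend W e Basis (arr_compl W F) = arr_compl W F0 \<union> (arr_compl W {e} :: ('l \<Rightarrow> 'e) set)"
          unfolding suspend_Basis F0(3) arr_compl_contract[symmetric] by (auto simp: arr_compl_def)
        show "\<exists>T' A' B'. Y = subtopology T' (A' \<union> B') \<and>
          (\<forall>c. cocycle (Suc i) Y c \<longrightarrow> cobdry (Suc i) (subtopology T' A') c \<and> cobdry (Suc i) (subtopology T' B') c) \<and>
          continuous_map (coords V) T' q \<and> q \<in> arr_compl V ?L0 \<rightarrow> A' \<and> q \<in> arr_compl V {e} \<rightarrow> B' \<and> (subtopology T' (A' \<inter> B'), q) \<in> indep_family V L i"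
        proof (intro exI conjI allI impI)
          show "Y = subtopology (coords W) (arr_compl W F0 \<union> arr_compl W {e})" unfolding Y xsW ..
          show "cobdry (Suc i) (subtopology (coords W) (arr_compl W F0)) c" "cobdry (Suc i) (subtopology (coords W) (arr_compl W {e})) c"
            if "cocycle (Suc i) Y c" for c
            using indep_forms_vanish[OF fW(1) fF0 ind] that unfolding Y xsW by blast+
          show "continuous_map (coords V) (coords W) q" unfolding Y(2) by (rule continuous_map_restrict_coords[OF F(3)])
          show "q \<in> arr_compl V ?L0 \<rightarrow> arr_compl W F0" unfolding Y(2)
            using arr_compl_restrict[OF V F(3) _ F0(1)] supW by auto
          show "q \<in> arr_compl V {e} \<rightarrow> arr_compl W {e}" unfolding Y(2)
            using arr_compl_restrict[OF V F(3) _ order_refl[of "{e}"]] supW by auto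
          have i: "arr_compl W F0 \<inter> arr_compl W {e} = (arr_compl W (insert e F0) :: ('l \<Rightarrow> 'e) set)" by (auto simp: arr_compl_def)
          have "card (insert e F0) = Suc (card F)" using fF0 cF by simp
          \<comment> \<open>\<open>card F + DIM('e) \<le> i + 1\<close> and \<open>DIM('e) \<ge> 2\<close> leave room for the additional form \<open>e\<close>.\<close>
          then have "card (insert e F0) \<le> i" "card W \<le> 2 * card (insert e F0)" using F(6,7) D by auto
          then show "(subtopology (coords W) (arr_compl W F0 \<inter> arr_compl W {e}), q) \<in> indep_family V L i"
            unfolding i Y(2) indep_family_def using F0(1) e ind F(3) supW by blast
        qed
      qed
    qed
  qed
qed

section \<open>Singular cohomology groups through cochains\<close>

text \<open>The homomorphism on the free abelian group of chains that is determined by its values on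
  simplices; \<open>as_cochain_surj\<close> shows that every cochain has this form.\<close>

definition as_cochain :: "nat \<Rightarrow> 'x topology \<Rightarrow> 'x cochain \<Rightarrow> 'x chain \<Rightarrow> int" where
  "as_cochain p X \<phi> = (\<lambda>c \<in> singular_chain_set p X. ceval \<phi> c)"

lemma as_cochain_in_carrier: "as_cochain p X \<phi> \<in> carrier (cochain_group p X)"
  by (auto simp: cochain_group_def as_cochain_def hom_def singular_chain_def ceval_add dest!: subsetD[OF keys_add])

lemma as_cochain_cong: "(\<And>\<sigma>. singular_simplex p X \<sigma> \<Longrightarrow> \<phi> \<sigma> = \<psi> \<sigma>) \<Longrightarrow> as_cochain p X \<phi> = as_cochain p X \<psi>"
  unfolding as_cochain_def by (rule restrict_ext) (auto intro!: ceval_cong simp: singular_chain_def)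

lemma as_cochain_eq_iff: "as_cochain p X \<phi> = as_cochain p X \<psi> \<longleftrightarrow> (\<forall>\<sigma>. singular_simplex p X \<sigma> \<longrightarrow> \<phi> \<sigma> = \<psi> \<sigma>)"
proof
  assume eq: "as_cochain p X \<phi> = as_cochain p X \<psi>"
  show "\<forall>\<sigma>. singular_simplex p X \<sigma> \<longrightarrow> \<phi> \<sigma> = \<psi> \<sigma>"
  proof (intro allI impI)
    fix \<sigma> assume "singular_simplex p X \<sigma>"
    with fun_cong[OF eq, of "frag_of \<sigma>"] show "\<phi> \<sigma> = \<psi> \<sigma>" by (simp add: as_cochain_def singular_chain_of)
  qed
qed (blast intro: as_cochain_cong)

lemma as_cochain_surj:
  assumes "\<alpha> \<in> carrier (cochain_group p X)"
  shows "\<alpha> = as_cochain p X (\<lambda>\<sigma>. \<alpha> (frag_of \<sigma>))"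
proof
  fix c
  have ext: "\<alpha> \<in> extensional (singular_chain_set p X)" and hom: "\<alpha> \<in> hom (chain_group p X) integer_group"
    using assms by (auto simp: cochain_group_def)
  have add: "\<alpha> (a + b) = \<alpha> a + \<alpha> b" if "singular_chain p X a" "singular_chain p X b" for a b
    using hom that by (simp add: hom_def singular_chain_def)
  have z: "\<alpha> 0 = 0" using add[of 0 0] by simp
  have diff_form: "\<alpha> (a - b) = \<alpha> a - \<alpha> b" if "singular_chain p X a" "singular_chain p X b" for a b
    using add[OF singular_chain_diff[OF that] that(2)] by simp
  have *: "singular_chain p X c \<and> \<alpha> c = ceval (\<lambda>\<sigma>. \<alpha> (frag_of \<sigma>)) c" if "Poly_Mapping.keys c \<subseteq> singular_simplex_set p X"
    using that
  proof (induction c rule: frag_induction)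
    case (one x) then show ?case by (simp add: singular_chain_of)
  next
    case (diff a b) then show ?case by (simp add: ceval_diff singular_chain_diff diff_form)
  qed (simp add: z)
  have "\<alpha> c = ceval (\<lambda>\<sigma>. \<alpha> (frag_of \<sigma>)) c" if "singular_chain p X c"
    using * that unfolding singular_chain_def by blast
  then show "\<alpha> c = as_cochain p X (\<lambda>\<sigma>. \<alpha> (frag_of \<sigma>)) c"
    using ext by (auto simp: as_cochain_def extensional_def)
qed

lemma carrier_cochain_group: "carrier (cochain_group p X) = range (as_cochain p X)"
  using as_cochain_surj as_cochain_in_carrier by blast

lemma mult_as_cochain: "as_cochain p X \<phi> \<otimes>\<^bsub>cochain_group p X\<^esub> as_cochain p X \<psi> = as_cochain p X (\<lambda>\<sigma>. \<phi> \<sigma> + \<psi> \<sigma>)"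
  by (simp add: cochain_group_def as_cochain_def ceval_fun_add fun_eq_iff)

lemma one_as_cochain: "\<one>\<^bsub>cochain_group p X\<^esub> = as_cochain p X (\<lambda>_. 0)"
  by (simp add: cochain_group_def as_cochain_def)

lemma comm_group_cochain_group: "comm_group (cochain_group p X)"
proof (rule comm_groupI)
  fix x assume "x \<in> carrier (cochain_group p X)"
  then obtain \<phi> where "x = as_cochain p X \<phi>" unfolding carrier_cochain_group by blast
  then have "as_cochain p X (\<lambda>\<sigma>. - \<phi> \<sigma>) \<otimes>\<^bsub>cochain_group p X\<^esub> x = \<one>\<^bsub>cochain_group p X\<^esub>"
    by (simp add: mult_as_cochain one_as_cochain)
  then show "\<exists>y\<in>carrier (cochain_group p X). y \<otimes>\<^bsub>cochain_group p X\<^esub> x = \<one>\<^bsub>cochain_group p X\<^esub>"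
    using as_cochain_in_carrier by blast
qed (auto simp: carrier_cochain_group mult_as_cochain one_as_cochain algebra_simps)

lemma coboundary_as_cochain:
  "coboundary p X (as_cochain p X \<phi>) = as_cochain (Suc p) X (\<lambda>\<sigma>. ceval \<phi> (bdry (Suc p) \<sigma>))"
  unfolding coboundary_def as_cochain_def
  by (rule restrict_ext) (simp add: singular_chain_boundary_alt ceval_chain_boundary)

lemma cocycles_eq: "cocycles p X = as_cochain p X ` {\<phi>. cocycle p X \<phi>}"
proof -
  have "as_cochain p X \<phi> \<in> cocycles p X \<longleftrightarrow> cocycle p X \<phi>" for \<phi>
    by (simp add: cocycles_def kernel_def as_cochain_in_carrier coboundary_as_cochain one_as_cochain as_cochain_eq_iff cocycle_def)
  moreover have "cocycles p X \<subseteq> range (as_cochain p X)"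
    by (auto simp: cocycles_def kernel_def carrier_cochain_group)
  ultimately show ?thesis by blast
qed

lemma coboundaries_eq: "coboundaries p X = as_cochain p X ` {\<phi>. cobdry p X \<phi>}"
proof (cases p)
  case 0
  have "cobdry 0 X \<phi> \<longleftrightarrow> as_cochain 0 X \<phi> = as_cochain 0 X (\<lambda>_. 0)" for \<phi>
    by (simp add: cobdry_def as_cochain_eq_iff)
  then have "as_cochain 0 X ` {\<phi>. cobdry 0 X \<phi>} = {as_cochain 0 X (\<lambda>_. 0)}" by auto
  then show ?thesis by (simp add: 0 coboundaries_def one_as_cochain)
next
  case (Suc q)
  have "coboundaries p X = {as_cochain p X (\<lambda>\<sigma>. ceval \<eta> (bdry p \<sigma>)) | \<eta>. True}"
    by (auto simp: Suc coboundaries_def carrier_cochain_group image_image coboundary_as_cochain)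
  also have "\<dots> = as_cochain p X ` {\<phi>. cobdry p X \<phi>}"
  proof (intro Set.set_eqI iffI)
    fix x assume "x \<in> {as_cochain p X (\<lambda>\<sigma>. ceval \<eta> (bdry p \<sigma>)) | \<eta>. True}"
    then obtain \<eta> where "x = as_cochain p X (\<lambda>\<sigma>. ceval \<eta> (bdry p \<sigma>))" by blast
    moreover have "cobdry p X (\<lambda>\<sigma>. ceval \<eta> (bdry p \<sigma>))" by (rule cobdryI) simp
    ultimately show "x \<in> as_cochain p X ` {\<phi>. cobdry p X \<phi>}" by blast
  next
    fix x assume "x \<in> as_cochain p X ` {\<phi>. cobdry p X \<phi>}"
    then obtain \<phi> where x: "x = as_cochain p X \<phi>" and c: "cobdry p X \<phi>" by blast
    from c obtain \<eta> where "\<And>\<sigma>. singular_simplex p X \<sigma> \<Longrightarrow> \<phi> \<sigma> = ceval \<eta> (bdry p \<sigma>)"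
      by (rule cobdryE) (use that in blast)
    then have "x = as_cochain p X (\<lambda>\<sigma>. ceval \<eta> (bdry p \<sigma>))" unfolding x by (rule as_cochain_cong)
    then show "x \<in> {as_cochain p X (\<lambda>\<sigma>. ceval \<eta> (bdry p \<sigma>)) | \<eta>. True}" by blast
  qed
  finally show ?thesis .
qed

lemma inv_as_cochain: "inv\<^bsub>cochain_group p X\<^esub> (as_cochain p X \<phi>) = as_cochain p X (\<lambda>\<sigma>. - \<phi> \<sigma>)"
proof -
  interpret comm_group "cochain_group p X" by (rule comm_group_cochain_group)
  show ?thesis by (rule inv_equality) (simp_all add: as_cochain_in_carrier mult_as_cochain one_as_cochain)
qed

lemma cocycle_minus: "cocycle p X \<phi> \<Longrightarrow> cocycle p X (\<lambda>\<sigma>. - \<phi> \<sigma>)"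
  using cocycle_cmul[of p X \<phi> "-1"] by simp

lemma cocycle_add: "cocycle p X \<phi> \<Longrightarrow> cocycle p X \<psi> \<Longrightarrow> cocycle p X (\<lambda>\<sigma>. \<phi> \<sigma> + \<psi> \<sigma>)"
  using cocycle_diff[OF _ cocycle_minus] by fastforce

lemma cobdry_minus: "cobdry p X \<phi> \<Longrightarrow> cobdry p X (\<lambda>\<sigma>. - \<phi> \<sigma>)"
  using cobdry_cmul[of p X \<phi> "-1"] by simp

lemma cocycle_zero: "cocycle p X (\<lambda>_. 0)"
  by (simp add: cocycle_def)

lemma subgroup_cocycles: "subgroup (cocycles p X) (cochain_group p X)"
proof -
  interpret comm_group "cochain_group p X" by (rule comm_group_cochain_group)
  show ?thesis
  proof (rule subgroupI)
    show "cocycles p X \<noteq> {}" unfolding cocycles_eq using cocycle_zero by blast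
  qed (auto simp: cocycles_eq as_cochain_in_carrier inv_as_cochain mult_as_cochain cocycle_minus cocycle_add)
qed

abbreviation cocycle_group :: "nat \<Rightarrow> 'x topology \<Rightarrow> ('x chain \<Rightarrow> int) monoid" where
  "cocycle_group p X \<equiv> subgroup_generated (cochain_group p X) (cocycles p X)"

lemma carrier_cocycle_group: "carrier (cocycle_group p X) = cocycles p X"
proof -
  show ?thesis by (rule subgroup.carrier_subgroup_generated_subgroup[OF subgroup_cocycles])
qed

lemma comm_group_cocycle_group: "comm_group (cocycle_group p X)"
  by (rule group.abelian_subgroup_generated[OF comm_group.axioms(2)[OF comm_group_cochain_group] comm_group_cochain_group])

lemma subgroup_coboundaries: "subgroup (coboundaries p X) (cocycle_group p X)"
proof -
  interpret comm_group "cochain_group p X" by (rule comm_group_cochain_group)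
  interpret Z: comm_group "cocycle_group p X" by (rule comm_group_cocycle_group)
  show ?thesis
  proof (rule Z.subgroupI)
    have "coboundaries p X \<subseteq> cocycles p X"
      unfolding cocycles_eq coboundaries_eq by (intro image_mono Collect_mono) (simp add: cobdry_imp_cocycle)
    then show sub: "coboundaries p X \<subseteq> carrier (cocycle_group p X)"
      unfolding carrier_cocycle_group .
    show "coboundaries p X \<noteq> {}" unfolding coboundaries_eq using cobdry_zero by blast
    fix a assume a: "a \<in> coboundaries p X"
    then have "inv\<^bsub>cocycle_group p X\<^esub> a = inv\<^bsub>cochain_group p X\<^esub> a"
      using sub by (intro inv_subgroup_generated) blast
    then show "inv\<^bsub>cocycle_group p X\<^esub> a \<in> coboundaries p X"
      using a by (auto simp: coboundaries_eq inv_as_cochain cobdry_minus)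
  next
    fix a b assume "a \<in> coboundaries p X" "b \<in> coboundaries p X"
    then show "a \<otimes>\<^bsub>cocycle_group p X\<^esub> b \<in> coboundaries p X"
      by (auto simp: coboundaries_eq mult_as_cochain cobdry_add)
  qed
qed

lemma comm_group_cohomology_group: "comm_group (cohomology_group p X)"
  unfolding cohomology_group_def
  by (rule comm_group.abelian_FactGroup[OF comm_group_cocycle_group subgroup_coboundaries])

definition cclass :: "nat \<Rightarrow> 'x topology \<Rightarrow> 'x cochain \<Rightarrow> ('x chain \<Rightarrow> int) set" where
  "cclass p X \<phi> = as_cochain p X ` {\<psi>. cobdry p X (\<lambda>\<sigma>. \<psi> \<sigma> - \<phi> \<sigma>)}"

lemma cclass_eq_coset: "coboundaries p X #>\<^bsub>cochain_group p X\<^esub> as_cochain p X \<phi> = cclass p X \<phi>"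
proof -
  have "coboundaries p X #>\<^bsub>cochain_group p X\<^esub> as_cochain p X \<phi> = {as_cochain p X (\<lambda>\<sigma>. \<beta> \<sigma> + \<phi> \<sigma>) | \<beta>. cobdry p X \<beta>}"
    by (auto simp: r_coset_def coboundaries_eq mult_as_cochain)
  also have "\<dots> = cclass p X \<phi>"
    unfolding cclass_def
  proof (intro Set.set_eqI iffI)
    fix x assume "x \<in> {as_cochain p X (\<lambda>\<sigma>. \<beta> \<sigma> + \<phi> \<sigma>) | \<beta>. cobdry p X \<beta>}"
    then obtain \<beta> where "x = as_cochain p X (\<lambda>\<sigma>. \<beta> \<sigma> + \<phi> \<sigma>)" "cobdry p X \<beta>" by blast
    then show "x \<in> as_cochain p X ` {\<psi>. cobdry p X (\<lambda>\<sigma>. \<psi> \<sigma> - \<phi> \<sigma>)}" by auto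
  next
    fix x assume "x \<in> as_cochain p X ` {\<psi>. cobdry p X (\<lambda>\<sigma>. \<psi> \<sigma> - \<phi> \<sigma>)}"
    then obtain \<psi> where \<psi>: "x = as_cochain p X \<psi>" "cobdry p X (\<lambda>\<sigma>. \<psi> \<sigma> - \<phi> \<sigma>)" by blast
    have "x = as_cochain p X (\<lambda>\<sigma>. (\<psi> \<sigma> - \<phi> \<sigma>) + \<phi> \<sigma>)" using \<psi>(1) by simp
    with \<psi>(2) show "x \<in> {as_cochain p X (\<lambda>\<sigma>. \<beta> \<sigma> + \<phi> \<sigma>) | \<beta>. cobdry p X \<beta>}"
      by (intro CollectI exI[of _ "\<lambda>\<sigma>. \<psi> \<sigma> - \<phi> \<sigma>"]) auto
  qed
  finally show ?thesis .
qed

lemma carrier_cohomology_group: "carrier (cohomology_group p X) = cclass p X ` {\<phi>. cocycle p X \<phi>}"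
proof -
  have "carrier (cohomology_group p X) = (\<Union>a\<in>cocycles p X. {coboundaries p X #>\<^bsub>cochain_group p X\<^esub> a})"
    by (simp add: cohomology_group_def FactGroup_def RCOSETS_def r_coset_def carrier_cocycle_group)
  also have "\<dots> = cclass p X ` {\<phi>. cocycle p X \<phi>}" by (auto simp: cocycles_eq cclass_eq_coset)
  finally show ?thesis .
qed

lemma cclass_eqI:
  assumes "cobdry p X (\<lambda>\<sigma>. \<phi> \<sigma> - \<psi> \<sigma>)" shows "cclass p X \<phi> = cclass p X \<psi>"
proof -
  have "cobdry p X (\<lambda>\<sigma>. \<xi> \<sigma> - \<phi> \<sigma>) \<longleftrightarrow> cobdry p X (\<lambda>\<sigma>. \<xi> \<sigma> - \<psi> \<sigma>)" for \<xi>
    using cobdry_add[OF _ assms, of "\<lambda>\<sigma>. \<xi> \<sigma> - \<phi> \<sigma>"] cobdry_diff[OF _ assms, of "\<lambda>\<sigma>. \<xi> \<sigma> - \<psi> \<sigma>"] by auto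
  then show ?thesis by (simp add: cclass_def)
qed

lemma cclass_cong:
  assumes "\<And>\<sigma>. singular_simplex p X \<sigma> \<Longrightarrow> \<phi> \<sigma> = \<psi> \<sigma>" shows "cclass p X \<phi> = cclass p X \<psi>"
  by (rule cclass_eqI, rule cobdry_cong[OF _ cobdry_zero]) (simp add: assms)

lemma set_mult_cclass:
  "cclass p X \<phi> <#>\<^bsub>cochain_group p X\<^esub> cclass p X \<psi> = cclass p X (\<lambda>\<sigma>. \<phi> \<sigma> + \<psi> \<sigma>)"
proof (intro Set.set_eqI iffI)
  fix x assume "x \<in> cclass p X \<phi> <#>\<^bsub>cochain_group p X\<^esub> cclass p X \<psi>"
  then obtain a b where "cobdry p X (\<lambda>\<sigma>. a \<sigma> - \<phi> \<sigma>)" "cobdry p X (\<lambda>\<sigma>. b \<sigma> - \<psi> \<sigma>)" and x: "x = as_cochain p X (\<lambda>\<sigma>. a \<sigma> + b \<sigma>)"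
    by (auto simp: set_mult_def cclass_def mult_as_cochain)
  then have "cobdry p X (\<lambda>\<sigma>. (a \<sigma> - \<phi> \<sigma>) + (b \<sigma> - \<psi> \<sigma>))" by (intro cobdry_add)
  then show "x \<in> cclass p X (\<lambda>\<sigma>. \<phi> \<sigma> + \<psi> \<sigma>)"
    unfolding cclass_def x by (intro imageI CollectI) (simp add: algebra_simps)
next
  fix x assume "x \<in> cclass p X (\<lambda>\<sigma>. \<phi> \<sigma> + \<psi> \<sigma>)"
  then obtain a where a: "cobdry p X (\<lambda>\<sigma>. a \<sigma> - (\<phi> \<sigma> + \<psi> \<sigma>))" "x = as_cochain p X a" by (auto simp: cclass_def)
  have "as_cochain p X (\<lambda>\<sigma>. a \<sigma> - \<psi> \<sigma>) \<in> cclass p X \<phi>"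
    unfolding cclass_def by (rule imageI, rule CollectI) (use a(1) in \<open>simp add: algebra_simps\<close>)
  moreover have "as_cochain p X \<psi> \<in> cclass p X \<psi>"
    unfolding cclass_def by (rule imageI, rule CollectI) (simp add: cobdry_zero)
  moreover have "x = as_cochain p X (\<lambda>\<sigma>. a \<sigma> - \<psi> \<sigma>) \<otimes>\<^bsub>cochain_group p X\<^esub> as_cochain p X \<psi>"
    by (simp add: mult_as_cochain a(2))
  ultimately show "x \<in> cclass p X \<phi> <#>\<^bsub>cochain_group p X\<^esub> cclass p X \<psi>"
    unfolding set_mult_def by blast
qed

lemma mult_cclass: "cclass p X \<phi> \<otimes>\<^bsub>cohomology_group p X\<^esub> cclass p X \<psi> = cclass p X (\<lambda>\<sigma>. \<phi> \<sigma> + \<psi> \<sigma>)"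
  by (simp add: cohomology_group_def FactGroup_def set_mult_cclass[symmetric]) (simp add: set_mult_def)

lemma one_cohomology_group: "\<one>\<^bsub>cohomology_group p X\<^esub> = cclass p X (\<lambda>_. 0)"
  by (simp add: cohomology_group_def FactGroup_def cclass_def coboundaries_eq)

lemma cochain_map_as_cochain:
  assumes "continuous_map X Y f"
  shows "cochain_map p X f (as_cochain p Y \<phi>) = as_cochain p X (pullback p f \<phi>)"
  unfolding cochain_map_def as_cochain_def
  by (rule restrict_ext) (simp add: singular_chain_chain_map[OF _ assms] ceval_pullback)

lemma cohomology_map_cclass:
  assumes f: "continuous_map X Y f"
  shows "cohomology_map p X f (cclass p Y \<phi>) = cclass p X (pullback p f \<phi>)"
proof -
  have "cochain_map p X f ` cclass p Y \<phi> = {as_cochain p X (pullback p f \<psi>) | \<psi>. cobdry p Y (\<lambda>\<sigma>. \<psi> \<sigma> - \<phi> \<sigma>)}"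
    by (auto simp: cclass_def image_image cochain_map_as_cochain[OF f])
  then have "cohomology_map p X f (cclass p Y \<phi>) =
     (\<Union>\<psi>\<in>{\<psi>. cobdry p Y (\<lambda>\<sigma>. \<psi> \<sigma> - \<phi> \<sigma>)}. coboundaries p X #>\<^bsub>cochain_group p X\<^esub> as_cochain p X (pullback p f \<psi>))"
    unfolding cohomology_map_def by (auto simp: set_mult_def r_coset_def)
  also have "\<dots> = (\<Union>\<psi>\<in>{\<psi>. cobdry p Y (\<lambda>\<sigma>. \<psi> \<sigma> - \<phi> \<sigma>)}. cclass p X (pullback p f \<psi>))"
    by (simp only: cclass_eq_coset)
  also have "\<dots> = (\<Union>\<psi>\<in>{\<psi>. cobdry p Y (\<lambda>\<sigma>. \<psi> \<sigma> - \<phi> \<sigma>)}. cclass p X (pullback p f \<phi>))"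
  proof (rule SUP_cong[OF refl])
    fix \<psi> assume "\<psi> \<in> {\<psi>. cobdry p Y (\<lambda>\<sigma>. \<psi> \<sigma> - \<phi> \<sigma>)}"
    then have "cobdry p X (pullback p f (\<lambda>\<sigma>. \<psi> \<sigma> - \<phi> \<sigma>))" using cobdry_pullback f by blast
    then show "cclass p X (pullback p f \<psi>) = cclass p X (pullback p f \<phi>)"
      by (intro cclass_eqI) (simp add: pullback_def[abs_def])
  qed
  also have "\<dots> = cclass p X (pullback p f \<phi>)"
  proof -
    have "\<phi> \<in> {\<psi>. cobdry p Y (\<lambda>\<sigma>. \<psi> \<sigma> - \<phi> \<sigma>)}" by (simp add: cobdry_zero)
    then show ?thesis by blast
  qed
  finally show ?thesis .
qed

lemma pullback_add: "pullback p f (\<lambda>\<sigma>. \<phi> \<sigma> + \<psi> \<sigma>) = (\<lambda>\<sigma>. pullback p f \<phi> \<sigma> + pullback p f \<psi> \<sigma>)"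
  by (simp add: pullback_def fun_eq_iff)

lemma cohomology_map_hom:
  assumes f: "continuous_map X Y f"
  shows "cohomology_map p X f \<in> hom (cohomology_group p Y) (cohomology_group p X)"
proof (rule homI)
  fix x assume "x \<in> carrier (cohomology_group p Y)"
  then show "cohomology_map p X f x \<in> carrier (cohomology_group p X)"
    using cocycle_pullback[OF _ f] by (auto simp: carrier_cohomology_group cohomology_map_cclass[OF f])
next
  fix x y assume "x \<in> carrier (cohomology_group p Y)" "y \<in> carrier (cohomology_group p Y)"
  then show "cohomology_map p X f (x \<otimes>\<^bsub>cohomology_group p Y\<^esub> y) =
    cohomology_map p X f x \<otimes>\<^bsub>cohomology_group p X\<^esub> cohomology_map p X f y"
    by (auto simp: carrier_cohomology_group cohomology_map_cclass[OF f] mult_cclass pullback_add)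
qed

lemma pullback_eq:
  assumes "singular_simplex p X \<sigma>" "\<And>x. x \<in> topspace X \<Longrightarrow> f x = g x"
  shows "pullback p f \<phi> \<sigma> = pullback p g \<phi> \<sigma>"
  by (simp add: pullback_def simplex_map_eq[OF assms])

lemma cohomology_map_compose:
  assumes f: "continuous_map X Y f" and g: "continuous_map Y Z g" and h: "\<And>x. x \<in> topspace X \<Longrightarrow> h x = g (f x)"
    and x: "x \<in> carrier (cohomology_group p Z)"
  shows "cohomology_map p X h x = cohomology_map p X f (cohomology_map p Y g x)"
proof -
  obtain \<phi> where \<phi>: "x = cclass p Z \<phi>" using x by (auto simp: carrier_cohomology_group)
  have hc: "continuous_map X Z h"
    using continuous_map_compose[OF f g] by (rule continuous_map_eq) (simp add: h)
  have "pullback p h \<phi> \<sigma> = pullback p f (pullback p g \<phi>) \<sigma>" if "singular_simplex p X \<sigma>" for \<sigma>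
  proof -
    have "pullback p h \<phi> \<sigma> = pullback p (g \<circ> f) \<phi> \<sigma>" by (rule pullback_eq[OF that]) (simp add: h)
    then show ?thesis by (simp add: pullback_def simplex_map_compose)
  qed
  then show ?thesis
    unfolding \<phi> cohomology_map_cclass[OF hc] cohomology_map_cclass[OF f] cohomology_map_cclass[OF g]
    by (rule cclass_cong)
qed

lemma cohomology_map_ident:
  assumes h: "\<And>x. x \<in> topspace X \<Longrightarrow> h x = x" and x: "x \<in> carrier (cohomology_group p X)"
  shows "cohomology_map p X h x = x"
proof -
  obtain \<phi> where \<phi>: "x = cclass p X \<phi>" using x by (auto simp: carrier_cohomology_group)
  have hc: "continuous_map X X h"
    using continuous_map_id by (rule continuous_map_eq) (simp add: h)
  show ?thesis
    unfolding \<phi> cohomology_map_cclass[OF hc]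
    by (rule cclass_cong) (simp add: pullback_def simplex_map_id_gen[OF _ h])
qed

lemma cspan_generate:
  assumes Z: "\<And>z. z \<in> Z \<Longrightarrow> cocycle p X z" and "cspan p X Z c"
  shows "cocycle p X c \<and> cclass p X c \<in> generate (cohomology_group p X) (cclass p X ` Z)"
  using assms(2)
proof induction
  case (base z)
  then show ?case using Z by (auto intro: generate.incl)
next
  case (cobdry \<phi>)
  then have "cclass p X \<phi> = \<one>\<^bsub>cohomology_group p X\<^esub>"
    unfolding one_cohomology_group by (intro cclass_eqI) simp
  then show ?case using cobdry cobdry_imp_cocycle by (auto intro: generate.one)
next
  case (diff \<phi> \<psi>)
  interpret comm_group "cohomology_group p X" by (rule comm_group_cohomology_group)
  let ?G = "generate (cohomology_group p X) (cclass p X ` Z)"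
  have sub: "subgroup ?G (cohomology_group p X)"
    by (rule generate_is_subgroup) (use Z carrier_cohomology_group in blast)
  have "inv\<^bsub>cohomology_group p X\<^esub> (cclass p X \<psi>) = cclass p X (\<lambda>\<sigma>. - \<psi> \<sigma>)"
    by (rule inv_equality) (use diff cocycle_minus in \<open>auto simp: mult_cclass one_cohomology_group carrier_cohomology_group\<close>)
  then have "cclass p X (\<lambda>\<sigma>. \<phi> \<sigma> - \<psi> \<sigma>) = cclass p X \<phi> \<otimes>\<^bsub>cohomology_group p X\<^esub> inv\<^bsub>cohomology_group p X\<^esub> (cclass p X \<psi>)"
    by (simp add: mult_cclass)
  then show ?case
    using diff subgroup.m_closed[OF sub] subgroup.m_inv_closed[OF sub] cocycle_diff by auto
qed

lemma generated_generate:
  assumes "generated p X \<Y>"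
  obtains Z where "finite Z" "carrier (cohomology_group p X) = generate (cohomology_group p X) (cclass p X ` Z)"
    "\<And>z. z \<in> Z \<Longrightarrow> \<exists>Y q \<zeta>. (Y, q) \<in> \<Y> \<and> continuous_map X Y q \<and> cocycle p Y \<zeta> \<and> z = pullback p q \<zeta>"
proof -
  obtain Z where Z: "finite Z"
     "\<And>z. z \<in> Z \<Longrightarrow> \<exists>Y q \<zeta>. (Y, q) \<in> \<Y> \<and> continuous_map X Y q \<and> cocycle p Y \<zeta> \<and> z = pullback p q \<zeta>"
     "\<And>c. cocycle p X c \<Longrightarrow> cspan p X Z c"
    using assms unfolding generated_def by blast
  have cocycle: "cocycle p X z" if "z \<in> Z" for z
    using Z(2)[OF that] by (elim exE conjE) (simp add: cocycle_pullback)
  interpret comm_group "cohomology_group p X" by (rule comm_group_cohomology_group)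
  have "carrier (cohomology_group p X) = generate (cohomology_group p X) (cclass p X ` Z)"
  proof
    show "carrier (cohomology_group p X) \<subseteq> generate (cohomology_group p X) (cclass p X ` Z)"
      using cspan_generate[OF cocycle Z(3)] by (auto simp: carrier_cohomology_group)
    show "generate (cohomology_group p X) (cclass p X ` Z) \<subseteq> carrier (cohomology_group p X)"
      by (rule generate_incl) (use cocycle carrier_cohomology_group in blast)
  qed
  from that[OF Z(1) this Z(2)] show ?thesis .
qed

lemma generated_finitely_generated:
  assumes "generated p X \<Y>" shows "finitely_generated_group (cohomology_group p X)"
proof -
  obtain Z where Z: "finite Z" "carrier (cohomology_group p X) = generate (cohomology_group p X) (cclass p X ` Z)"
    by (rule generated_generate[OF assms])
  have "cclass p X ` Z \<subseteq> carrier (cohomology_group p X)"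
    unfolding Z(2) by (blast intro: generate.incl)
  then show ?thesis unfolding finitely_generated_group_def using Z by (intro exI[of _ "cclass p X ` Z"]) auto
qed

section \<open>Connectedness and cycles of graphs\<close>

lemma truncate_sel [simp]:
  "verts (digraph_of G) = verts G" "arcs (digraph_of G) = arcs G"
  "tail (digraph_of G) = tail G" "head (digraph_of G) = head G"
  by (simp_all add: pre_digraph.truncate_def)

lemma mgraphD:
  assumes "mgraph G"
  shows mgraph_finite: "finite (verts G)" "finite (arcs G)"
    and mgraph_wf: "\<And>a. a \<in> arcs G \<Longrightarrow> tail G a \<in> verts G" "\<And>a. a \<in> arcs G \<Longrightarrow> head G a \<in> verts G"
    and mgraph_rev: "\<And>a. a \<in> arcs G \<Longrightarrow> rev_arc G a \<in> arcs G" "\<And>a. rev_arc G (rev_arc G a) = a"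
      "\<And>a. a \<in> arcs G \<longleftrightarrow> rev_arc G a \<noteq> a"
      "\<And>a. a \<in> arcs G \<Longrightarrow> tail G (rev_arc G a) = head G a" "\<And>a. a \<in> arcs G \<Longrightarrow> head G (rev_arc G a) = tail G a"
proof -
  have f: "fin_digraph (digraph_of G)" and b: "bidirected_digraph (digraph_of G) (rev_arc G)"
    using assms by (auto simp: mgraph_def)
  interpret fin_digraph "digraph_of G" by (rule f)
  interpret bidirected_digraph "digraph_of G" "rev_arc G" by (rule b)
  show "finite (verts G)" "finite (arcs G)" using finite_verts finite_arcs by simp_all
  show "tail G a \<in> verts G" "head G a \<in> verts G" if "a \<in> arcs G" for a
    using tail_in_verts[of a] head_in_verts[of a] that by simp_all
  show "rev_arc G a \<in> arcs G" "tail G (rev_arc G a) = head G a" "head G (rev_arc G a) = tail G a" if "a \<in> arcs G" for a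
    using arev_in_arcs[of a] tail_arev[of a] head_arev[of a] that by simp_all
  show "rev_arc G (rev_arc G a) = a" for a by (rule arev_arev)
  show "a \<in> arcs G \<longleftrightarrow> rev_arc G a \<noteq> a" for a using arev_dom[of a] by simp
qed

lemma mgraphI:
  assumes "finite (verts G)" "finite (arcs G)"
    "\<And>a. a \<in> arcs G \<Longrightarrow> tail G a \<in> verts G" "\<And>a. a \<in> arcs G \<Longrightarrow> head G a \<in> verts G"
    "\<And>a. a \<in> arcs G \<longleftrightarrow> rev_arc G a \<noteq> a" "\<And>a. a \<in> arcs G \<Longrightarrow> rev_arc G (rev_arc G a) = a"
    "\<And>a. a \<in> arcs G \<Longrightarrow> tail G (rev_arc G a) = head G a"
  shows "mgraph G"
  unfolding mgraph_def
  by (intro conjI; unfold_locales) (use assms in auto)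

text \<open>Sets of vertices closed under adjacency pass to quotients and to subgraphs more easily than walks
  do.\<close>

lemma connected_mgraph_iff_cut:
  assumes wf: "\<And>a. a \<in> arcs G \<Longrightarrow> tail G a \<in> verts G" "\<And>a. a \<in> arcs G \<Longrightarrow> head G a \<in> verts G"
  shows "connected_mgraph G \<longleftrightarrow> verts G \<noteq> {} \<and>
     (\<forall>U \<subseteq> verts G. U \<noteq> {} \<longrightarrow> (\<forall>a\<in>arcs G. tail G a \<in> U \<longleftrightarrow> head G a \<in> U) \<longrightarrow> U = verts G)"
proof -
  define R where "R = (\<Union>e\<in>arcs G. {(tail G e, head G e), (head G e, tail G e)})"
  have c: "connected_mgraph G \<longleftrightarrow> verts G \<noteq> {} \<and> (\<forall>u\<in>verts G. \<forall>v\<in>verts G. (u, v) \<in> rtrancl_on (verts G) R)"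
    by (simp add: connected_mgraph_def connected_def strongly_connected_def reachable_def parcs_mk_symmetric R_def)
  show ?thesis
    unfolding c
  proof (intro iffI conjI; elim conjE)
    assume ne: "verts G \<noteq> {}" and r: "\<forall>u\<in>verts G. \<forall>v\<in>verts G. (u, v) \<in> rtrancl_on (verts G) R"
    show "\<forall>U \<subseteq> verts G. U \<noteq> {} \<longrightarrow> (\<forall>a\<in>arcs G. tail G a \<in> U \<longleftrightarrow> head G a \<in> U) \<longrightarrow> U = verts G"
    proof (intro allI impI)
      fix U assume U: "U \<subseteq> verts G" "U \<noteq> {}" "\<forall>a\<in>arcs G. tail G a \<in> U \<longleftrightarrow> head G a \<in> U"
      then obtain u where u: "u \<in> U" by blast
      have "v \<in> U" if "(u, v) \<in> rtrancl_on (verts G) R" for v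
        using that by (induction rule: rtrancl_on_induct) (use u U(3) in \<open>auto simp: R_def\<close>)
      then show "U = verts G" using r u U(1) by blast
    qed
  next
    assume ne: "verts G \<noteq> {}" and
      cut: "\<forall>U \<subseteq> verts G. U \<noteq> {} \<longrightarrow> (\<forall>a\<in>arcs G. tail G a \<in> U \<longleftrightarrow> head G a \<in> U) \<longrightarrow> U = verts G"
    show "\<forall>u\<in>verts G. \<forall>v\<in>verts G. (u, v) \<in> rtrancl_on (verts G) R"
    proof
      fix u assume u: "u \<in> verts G"
      let ?U = "{v \<in> verts G. (u, v) \<in> rtrancl_on (verts G) R}"
      have "?U = verts G"
      proof (rule cut[rule_format])
        show "?U \<noteq> {}" using u by (auto intro: rtrancl_on.intros)
        fix a assume a: "a \<in> arcs G"
        then have "(tail G a, head G a) \<in> R" "(head G a, tail G a) \<in> R" by (auto simp: R_def)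
        then show "tail G a \<in> ?U \<longleftrightarrow> head G a \<in> ?U" using wf[OF a] by (auto intro: rtrancl_on_into_rtrancl_on)
      qed auto
      then show "\<forall>v\<in>verts G. (u, v) \<in> rtrancl_on (verts G) R" by blast
    qed
  qed auto
qed

lemma mgraph_cycle_around:
  assumes "mgraph_cycle G p"
  shows "p \<noteq> []" "set p \<subseteq> arcs G"
    and "\<And>a. a \<in> set p \<Longrightarrow> \<exists>b\<in>set p. tail G b = head G a"
    and "\<And>a. a \<in> set p \<Longrightarrow> \<exists>b\<in>set p. head G b = tail G a"
    and "\<And>a. a \<in> set p \<Longrightarrow> rev_arc G a \<notin> set p"
proof -
  obtain u where p: "pre_digraph.cas (digraph_of G) u p u" "p \<noteq> []" "set p \<subseteq> arcs G"
    using assms by (auto simp: mgraph_cycle_def pre_digraph.cycle_def pre_digraph.awalk_def)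
  show "p \<noteq> []" "set p \<subseteq> arcs G" "\<And>a. a \<in> set p \<Longrightarrow> rev_arc G a \<notin> set p"
    using p assms by (auto simp: mgraph_cycle_def)
  have cas: "(\<forall>a\<in>set p. head G a = v \<or> (\<exists>b\<in>set p. tail G b = head G a)) \<and>
      (\<forall>a\<in>set p. tail G a = u \<or> (\<exists>b\<in>set p. head G b = tail G a)) \<and>
      (p \<noteq> [] \<longrightarrow> (\<exists>b\<in>set p. tail G b = u) \<and> (\<exists>b\<in>set p. head G b = v))"
    if "pre_digraph.cas (digraph_of G) u p v" for u p v
    using that
  proof (induction p arbitrary: u)
    case (Cons a p)
    then have "tail G a = u" "pre_digraph.cas (digraph_of G) (head G a) p v"
      by (auto simp: pre_digraph.cas.simps)
    with Cons.IH[OF this(2)] show ?case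
      by (cases "p = []") (auto simp: pre_digraph.cas.simps)
  qed simp
  show "\<exists>b\<in>set p. tail G b = head G a" "\<exists>b\<in>set p. head G b = tail G a" if "a \<in> set p" for a
    using cas[OF p(1)] p(2) that by metis+
qed

section \<open>Contraction of a spanning forest\<close>

locale marked_mgraph =
  fixes G :: "('v, 'a) mgraph" and M :: "'v set"
  assumes G: "mgraph G" and conn: "connected_mgraph G" and M: "M \<subseteq> verts G" "M \<noteq> {}"
begin

lemmas fin = mgraph_finite[OF G]
lemmas wf = mgraph_wf[OF G]
lemmas rev = mgraph_rev[OF G]

text \<open>The vertices at distance at most \<open>n\<close> from the marked ones.\<close>

primrec layer :: "nat \<Rightarrow> 'v set" where
  "layer 0 = M"
| "layer (Suc n) = layer n \<union> {tail G a | a. a \<in> arcs G \<and> head G a \<in> layer n}"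

lemma layer_verts: "layer n \<subseteq> verts G"
  by (induction n) (use M wf in auto)

lemma layer_covers: "(\<Union>n. layer n) = verts G"
proof -
  have "\<forall>U \<subseteq> verts G. U \<noteq> {} \<longrightarrow> (\<forall>a\<in>arcs G. tail G a \<in> U \<longleftrightarrow> head G a \<in> U) \<longrightarrow> U = verts G"
    using conn connected_mgraph_iff_cut[OF wf] by blast
  then show ?thesis
  proof (elim allE impE)
    show "(\<Union>n. layer n) \<subseteq> verts G" using layer_verts by blast
    show "(\<Union>n. layer n) \<noteq> {}" using M(2) layer.simps(1) by blast
    have 1: "tail G a \<in> (\<Union>n. layer n)" if a: "a \<in> arcs G" and h: "head G a \<in> (\<Union>n. layer n)" for a
    proof -
      from h obtain n where "head G a \<in> layer n" by blast
      then have "tail G a \<in> layer (Suc n)" using a by auto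
      then show ?thesis by blast
    qed
    show "\<forall>a\<in>arcs G. tail G a \<in> (\<Union>n. layer n) \<longleftrightarrow> head G a \<in> (\<Union>n. layer n)"
    proof
      fix a assume a: "a \<in> arcs G"
      show "tail G a \<in> (\<Union>n. layer n) \<longleftrightarrow> head G a \<in> (\<Union>n. layer n)"
        using 1[OF a] 1[of "rev_arc G a"] rev[of a] a by auto
    qed
  qed
qed

definition depth :: "'v \<Rightarrow> nat" where
  "depth v = (LEAST n. v \<in> layer n)"

lemma depth_le: "v \<in> layer n \<Longrightarrow> depth v \<le> n"
  unfolding depth_def by (rule Least_le)

lemma in_layer_depth: "v \<in> verts G \<Longrightarrow> v \<in> layer (depth v)"
  unfolding depth_def using layer_covers by (metis LeastI UN_E)

lemma parent_ex:
  assumes "v \<in> verts G - M"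
  shows "\<exists>a\<in>arcs G. tail G a = v \<and> depth (head G a) < depth v"
proof -
  have v: "v \<in> layer (depth v)" using in_layer_depth assms by blast
  show ?thesis
  proof (cases "depth v")
    case 0
    then show ?thesis using v assms by simp
  next
    case (Suc n)
    then have "v \<notin> layer n" using depth_le[of v n] by auto
    then obtain a where "a \<in> arcs G" "tail G a = v" "head G a \<in> layer n" using v Suc by auto
    then show ?thesis using depth_le[of "head G a" n] Suc by auto
  qed
qed

definition parent :: "'v \<Rightarrow> 'a" where
  "parent v = (SOME a. a \<in> arcs G \<and> tail G a = v \<and> depth (head G a) < depth v)"

lemma parent:
  assumes "v \<in> verts G - M"
  shows "parent v \<in> arcs G" "tail G (parent v) = v" "depth (head G (parent v)) < depth v"
proof -
  have "\<exists>a. a \<in> arcs G \<and> tail G a = v \<and> depth (head G a) < depth v" using parent_ex[OF assms] by blast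
  from someI_ex[OF this] show "parent v \<in> arcs G" "tail G (parent v) = v" "depth (head G (parent v)) < depth v"
    unfolding parent_def by auto
qed

definition hop :: "'v \<Rightarrow> 'v" where
  "hop v = (if v \<in> M then v else head G (parent v))"

lemma hop_verts: "v \<in> verts G \<Longrightarrow> hop v \<in> verts G"
  using parent wf by (auto simp: hop_def)

lemma hop_pow_M: "v \<in> M \<Longrightarrow> (hop ^^ n) v = v"
  by (induction n) (auto simp: hop_def)

lemma hop_reaches: "v \<in> verts G \<Longrightarrow> depth v \<le> n \<Longrightarrow> (hop ^^ n) v \<in> M"
proof (induction n arbitrary: v)
  case 0
  then show ?case using in_layer_depth[of v] by simp
next
  case (Suc n)
  show ?case
  proof (cases "v \<in> M")
    case True then show ?thesis using hop_pow_M[OF True, of "Suc n"] by (simp only:)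
  next
    case False
    then have "depth (hop v) \<le> n" using Suc.prems parent(3)[of v] by (auto simp: hop_def)
    then show ?thesis using Suc.IH[OF hop_verts[OF Suc.prems(1)]] by (simp add: funpow_swap1)
  qed
qed

definition maxdepth :: nat where "maxdepth = Max (depth ` verts G)"

lemma depth_le_maxdepth: "v \<in> verts G \<Longrightarrow> depth v \<le> maxdepth"
  unfolding maxdepth_def using fin by simp

definition root :: "'v \<Rightarrow> 'v" where "root v = (hop ^^ maxdepth) v"

lemma root_M: "v \<in> verts G \<Longrightarrow> root v \<in> M"
  unfolding root_def by (rule hop_reaches[OF _ depth_le_maxdepth])

lemma root_id: "v \<in> M \<Longrightarrow> root v = v"
  unfolding root_def by (rule hop_pow_M)

lemma root_hop: "v \<in> verts G \<Longrightarrow> root (hop v) = root v"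
proof -
  assume v: "v \<in> verts G"
  have "root (hop v) = hop (root v)" unfolding root_def by (simp add: funpow_swap1)
  also have "\<dots> = root v" using root_M[OF v] by (simp add: hop_def)
  finally show ?thesis .
qed

definition forest_arcs :: "'a set" where
  "forest_arcs = parent ` (verts G - M) \<union> rev_arc G ` parent ` (verts G - M)"

lemma forest_arcs_sub: "forest_arcs \<subseteq> arcs G"
  using parent(1) rev(1) by (auto simp: forest_arcs_def)

lemma forest_arcs_rev: "rev_arc G a \<in> forest_arcs \<longleftrightarrow> a \<in> forest_arcs"
proof -
  have "rev_arc G a \<in> forest_arcs" if "a \<in> forest_arcs" for a
    using that by (auto simp: forest_arcs_def rev(2))
  from this[of a] this[of "rev_arc G a"] show ?thesis by (auto simp: rev(2))
qed

lemma forest_arc_cases: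
  assumes "a \<in> forest_arcs"
  obtains v where "v \<in> verts G - M" "a = parent v" | v where "v \<in> verts G - M" "a = rev_arc G (parent v)"
  using assms unfolding forest_arcs_def by blast

lemma forest_arc_root: "a \<in> forest_arcs \<Longrightarrow> root (head G a) = root (tail G a)"
proof -
  have p: "root (head G (parent v)) = root (tail G (parent v))" if "v \<in> verts G - M" for v
    using root_hop[of v] that parent(2)[OF that] by (auto simp: hop_def)
  assume "a \<in> forest_arcs"
  then show ?thesis
    by (rule forest_arc_cases) (use p parent(1) rev in auto)
qed

lemma forest_arc_not_marked: "a \<in> forest_arcs \<Longrightarrow> \<not> (tail G a \<in> M \<and> head G a \<in> M)"
  by (erule forest_arc_cases) (use parent rev in auto)

text \<open>The trees of the forest become vertices and are named by their roots. Outside the remaining arcs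
  the involution has to be the identity.\<close>

definition contracted :: "('v, 'a) mgraph" where
  "contracted = \<lparr>verts = M, arcs = arcs G - forest_arcs, tail = root \<circ> tail G, head = root \<circ> head G,
     rev_arc = (\<lambda>a. if a \<in> arcs G - forest_arcs then rev_arc G a else a)\<rparr>"

definition contraction :: "('v, 'a) elem \<Rightarrow> ('v, 'a) elem" where
  "contraction = (\<lambda>u\<in>elems G. case u of Vert v \<Rightarrow> Vert (root v)
      | Arr a \<Rightarrow> if a \<in> forest_arcs then Vert (root (tail G a)) else Arr a | Star \<Rightarrow> Star)"

lemma elems_simps [simp]: "Vert v \<in> elems G' \<longleftrightarrow> v \<in> verts G'" "Arr a \<in> elems G' \<longleftrightarrow> a \<in> arcs G'" "Star \<in> elems G'"
  by (auto simp: elems_def)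

lemma contraction_simps [simp]:
  "v \<in> verts G \<Longrightarrow> contraction (Vert v) = Vert (root v)"
  "a \<in> arcs G \<Longrightarrow> contraction (Arr a) = (if a \<in> forest_arcs then Vert (root (tail G a)) else Arr a)"
  "contraction Star = Star"
  by (simp_all add: contraction_def)

lemma mgraph_contracted: "mgraph contracted"
proof (rule mgraphI)
  show "finite (verts contracted)" using fin M finite_subset by (auto simp: contracted_def)
qed (use fin wf root_M rev forest_arcs_rev in \<open>auto simp: contracted_def\<close>)

lemma connected_contracted: "connected_mgraph contracted"
proof (subst connected_mgraph_iff_cut)
  show "tail contracted a \<in> verts contracted" "head contracted a \<in> verts contracted" if "a \<in> arcs contracted" for a
    using mgraph_wf[OF mgraph_contracted] that by auto
  show "verts contracted \<noteq> {} \<and> (\<forall>U\<subseteq>verts contracted. U \<noteq> {} \<longrightarrow> (\<forall>a\<in>arcs contracted. (tail contracted a \<in> U) = (head contracted a \<in> U)) \<longrightarrow> U = verts contracted)"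
  proof (intro conjI allI impI)
    show "verts contracted \<noteq> {}" using M by (simp add: contracted_def)
    fix U assume U: "U \<subseteq> verts contracted" "U \<noteq> {}" "\<forall>a\<in>arcs contracted. (tail contracted a \<in> U) = (head contracted a \<in> U)"
    have cut: "\<forall>U \<subseteq> verts G. U \<noteq> {} \<longrightarrow> (\<forall>a\<in>arcs G. tail G a \<in> U \<longleftrightarrow> head G a \<in> U) \<longrightarrow> U = verts G"
      using conn connected_mgraph_iff_cut[OF wf] by blast
    have UM: "U \<subseteq> M" using U(1) by (simp add: contracted_def)
    have "{v \<in> verts G. root v \<in> U} = verts G"
    proof (rule cut[rule_format])
      obtain u where "u \<in> U" using U(2) by blast
      then have "u \<in> {v \<in> verts G. root v \<in> U}" using UM M(1) root_id[of u] by auto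
      then show "{v \<in> verts G. root v \<in> U} \<noteq> {}" by blast
      fix a assume a: "a \<in> arcs G"
      have "root (tail G a) \<in> U \<longleftrightarrow> root (head G a) \<in> U"
      proof (cases "a \<in> forest_arcs")
        case True then show ?thesis using forest_arc_root by simp
      next
        case False then show ?thesis using U(3) a by (auto simp: contracted_def)
      qed
      then show "tail G a \<in> {v \<in> verts G. root v \<in> U} \<longleftrightarrow> head G a \<in> {v \<in> verts G. root v \<in> U}" using wf a by auto
    qed auto
    then have "v \<in> U" if "v \<in> M" for v using that M root_id by (metis (mono_tags, lifting) mem_Collect_eq subsetD)
    then show "U = verts contracted" using UM by (auto simp: contracted_def)
  qed
qed

lemma fibre_eq:
  assumes "w \<in> M"
  shows "verts (fibre G contraction w) = {v \<in> verts G. root v = w}" "arcs (fibre G contraction w) = {a \<in> forest_arcs. root (tail G a) = w}"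
    "tail (fibre G contraction w) = tail G" "head (fibre G contraction w) = head G" "rev_arc (fibre G contraction w) = rev_arc G"
  using forest_arcs_sub by (auto simp: fibre_def split: if_splits)

text \<open>A fibre is connected because every vertex is joined to the root. On a cycle in a fibre, consider an
  arc into a vertex of maximal depth. Forest arcs at this vertex lead either to its parent or to
  vertices of larger depth, so this arc and the next one on the cycle both join the vertex to its
  parent and are reverse to each other, which a cycle excludes.\<close>

lemma fibre_tree:
  assumes w: "w \<in> M" shows "mgraph_tree (fibre G contraction w)"
  unfolding mgraph_tree_def
proof
  let ?F = "fibre G contraction w"
  show "connected_mgraph ?F"
  proof (subst connected_mgraph_iff_cut)
    show "tail ?F a \<in> verts ?F" "head ?F a \<in> verts ?F" if "a \<in> arcs ?F" for a
      using that forest_arcs_sub wf forest_arc_root by (auto simp: fibre_eq[OF w])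
    show "verts ?F \<noteq> {} \<and> (\<forall>U\<subseteq>verts ?F. U \<noteq> {} \<longrightarrow> (\<forall>a\<in>arcs ?F. (tail ?F a \<in> U) = (head ?F a \<in> U)) \<longrightarrow> U = verts ?F)"
    proof (intro conjI allI impI)
      have "w \<in> verts ?F" using w M root_id by (auto simp: fibre_eq[OF w])
      then show "verts ?F \<noteq> {}" by blast
      fix U assume U: "U \<subseteq> verts ?F" "U \<noteq> {}" "\<forall>a\<in>arcs ?F. (tail ?F a \<in> U) = (head ?F a \<in> U)"
      have step: "v \<in> U \<longleftrightarrow> hop v \<in> U" if "v \<in> verts ?F" for v
      proof (cases "v \<in> M")
        case False
        have v: "v \<in> verts G - M" "root v = w" using that False by (auto simp: fibre_eq[OF w])
        then have "parent v \<in> arcs ?F" using parent(2)[OF v(1)] by (auto simp: fibre_eq[OF w] forest_arcs_def)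
        then show ?thesis using U(3) parent(2)[OF v(1)] False by (auto simp: fibre_eq[OF w] hop_def)
      qed (simp add: hop_def)
      have nF: "hop v \<in> verts ?F" if "v \<in> verts ?F" for v
        using that hop_verts root_hop by (auto simp: fibre_eq[OF w])
      have pow: "v \<in> U \<longleftrightarrow> (hop ^^ n) v \<in> U" if "v \<in> verts ?F" for v n
        using that
      proof (induction n arbitrary: v)
        case (Suc n)
        then show ?case using step[OF Suc.prems] Suc.IH[OF nF[OF Suc.prems]] by (simp add: funpow_swap1)
      qed simp
      have all: "v \<in> U \<longleftrightarrow> w \<in> U" if "v \<in> verts ?F" for v
        using pow[OF that, of maxdepth] that by (simp add: fibre_eq[OF w] root_def)
      then show "U = verts ?F" using U(1,2) by blast
    qed
  qed
  show "\<nexists>p. mgraph_cycle ?F p"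
  proof
    assume "\<exists>p. mgraph_cycle ?F p"
    then obtain p where "mgraph_cycle ?F p" by blast
    note p = mgraph_cycle_around[OF this, unfolded fibre_eq[OF w]]
    have fa: "a \<in> forest_arcs" if "a \<in> set p" for a using p(2) that by auto
    \<comment> \<open>The heads of the arcs on a cycle are all its vertices.\<close>
    let ?H = "(depth \<circ> head G) ` set p"
    have H: "finite ?H" "?H \<noteq> {}" using p(1) by auto
    then have "Max ?H \<in> ?H" by (rule Max_in)
    then obtain a where a: "a \<in> set p" "depth (head G a) = Max ?H" by auto
    have mx: "depth (head G b) \<le> depth (head G a)" if "b \<in> set p" for b
      unfolding a(2) using H(1) that by (intro Max_ge) auto
    obtain b where b: "b \<in> set p" "tail G b = head G a" using p(3)[OF a(1)] by blast
    obtain c where c: "c \<in> set p" "head G c = tail G a" using p(4)[OF a(1)] by blast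
    have "depth (tail G a) \<le> depth (head G a)" using mx[OF c(1)] c(2) by simp
    with fa[OF a(1)] obtain v where v: "v \<in> verts G - M" "a = rev_arc G (parent v)"
      by (metis forest_arc_cases leD parent(2,3))
    then have hv: "head G a = v" using parent(1,2) rev by auto
    have "depth (head G b) \<le> depth (tail G b)" using mx[OF b(1)] b(2) by simp
    have "\<exists>v'\<in>verts G - M. b = parent v'"
      using fa[OF b(1)]
    proof (rule forest_arc_cases)
      fix v' assume "v' \<in> verts G - M" "b = rev_arc G (parent v')"
      then have "depth (head G b) > depth (tail G b)" using parent rev by auto
      then show ?thesis using \<open>depth (head G b) \<le> depth (tail G b)\<close> by simp
    qed blast
    then obtain v' where v': "v' \<in> verts G - M" "b = parent v'" by blast
    have "v' = v" using parent(2)[OF v'(1)] v'(2) b(2) hv by simp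
    then have "rev_arc G a = b" using v v' rev(2) by simp
    then show False using p(5)[OF a(1)] b(1) by simp
  qed
qed

lemma minor_morphism_contraction: "minor_morphism G contracted contraction"
  unfolding minor_morphism_def
proof (intro conjI ballI impI)
  show "contraction \<in> elems G \<rightarrow>\<^sub>E elems contracted"
    using root_M wf by (auto simp: PiE_def contraction_def elems_def contracted_def)
  show "\<exists>!a. a \<in> arcs G \<and> contraction (Arr a) = Arr a'" if "a' \<in> arcs contracted" for a'
    using that by (intro ex1I[of _ a']) (auto simp: contracted_def split: if_splits)
  show "contraction (Arr (rev_arc G a)) = rev_elem contracted (contraction (Arr a))" if "a \<in> arcs G" for a
    using that rev forest_arcs_rev[of a] forest_arc_root[of a] by (auto simp: contracted_def)
  show "contraction (Vert v) \<in> Vert ` verts contracted" if "v \<in> verts G" for v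
    using that root_M by (auto simp: contracted_def)
  show "contraction (Vert (head G a)) = Vert (head contracted a')" "contraction (Vert (tail G a)) = Vert (tail contracted a')"
    if "a \<in> arcs G" "a' \<in> arcs contracted" "contraction (Arr a) = Arr a'" for a a'
    using that wf by (auto simp: contracted_def split: if_splits)
  show "contraction (Vert (head G a)) = Vert v'" "contraction (Vert (tail G a)) = Vert v'"
    if "a \<in> arcs G" "v' \<in> verts contracted" "contraction (Arr a) = Vert v'" for a v'
    using that wf forest_arc_root by (auto simp: contracted_def split: if_splits)
  show "mgraph_tree (fibre G contraction v')" if "v' \<in> verts contracted" for v'
    using that fibre_tree by (simp add: contracted_def)
qed simp

text \<open>Each unmarked vertex disappears together with the edge to its parent.\<close>

lemma genus_contracted: "genus contracted = genus G"
proof -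
  define pe where "pe v = {parent v, rev_arc G (parent v)}" for v
  have inj: "inj_on pe (verts G - M)"
  proof (rule inj_onI)
    fix v w assume vw: "v \<in> verts G - M" "w \<in> verts G - M" "pe v = pe w"
    show "v = w"
    proof (rule ccontr)
      assume "v \<noteq> w"
      then have "parent v \<noteq> parent w" using vw parent(2) by metis
      then have "parent v = rev_arc G (parent w)" "rev_arc G (parent v) = parent w"
        using vw unfolding pe_def by (auto simp: doubleton_eq_iff)
      then have "head G (parent w) = v" "head G (parent v) = w"
        using vw parent(1,2) rev by metis+
      then show False using parent(3) vw by (metis order_less_asym)
    qed
  qed
  have sub: "pe ` (verts G - M) \<subseteq> edges G" unfolding edges_def pe_def using parent(1) by blast
  have eq: "edges contracted = edges G - pe ` (verts G - M)"
  proof (intro Set.set_eqI iffI)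
    fix e assume "e \<in> edges contracted"
    then obtain a where a: "a \<in> arcs G" "a \<notin> forest_arcs" "e = {a, rev_arc G a}"
      by (auto simp: edges_def contracted_def)
    then have "e \<in> edges G" by (auto simp: edges_def)
    moreover have "e \<noteq> pe v" if "v \<in> verts G - M" for v
      using a(2,3) that unfolding pe_def forest_arcs_def by auto
    ultimately show "e \<in> edges G - pe ` (verts G - M)" by blast
  next
    fix e assume e: "e \<in> edges G - pe ` (verts G - M)"
    then obtain a where a: "a \<in> arcs G" "e = {a, rev_arc G a}" by (auto simp: edges_def)
    have "a \<notin> forest_arcs"
    proof
      assume "a \<in> forest_arcs"
      then show False
        by (rule forest_arc_cases) (use a(2) e rev(2) in \<open>auto simp: pe_def insert_commute\<close>)
    qed
    then show "e \<in> edges contracted" using a by (auto simp: edges_def contracted_def)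
  qed
  have finE: "finite (edges G)" using fin by (simp add: edges_def)
  have "card (edges contracted) = card (edges G) - card (verts G - M)"
    unfolding eq using card_Diff_subset[OF finite_subset[OF sub finE] sub] card_image[OF inj] by simp
  moreover have "card (verts G - M) \<le> card (edges G)"
    using card_mono[OF finE sub] card_image[OF inj] by simp
  moreover have "card (verts G - M) = card (verts G) - card M" "card M \<le> card (verts G)"
    using M fin card_Diff_subset[OF finite_subset[OF M(1)]] card_mono by auto
  ultimately show ?thesis by (simp add: genus_def contracted_def)
qed

end

section \<open>Finitely many isomorphism classes\<close>

definition mgraph_iso :: "('v, 'a) mgraph \<Rightarrow> ('v, 'a) mgraph \<Rightarrow> ('v \<Rightarrow> 'v) \<Rightarrow> ('a \<Rightarrow> 'a) \<Rightarrow> bool" where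
  "mgraph_iso Q H fv fa \<longleftrightarrow> bij_betw fv (verts Q) (verts H) \<and> bij_betw fa (arcs Q) (arcs H) \<and>
     (\<forall>a\<in>arcs Q. tail H (fa a) = fv (tail Q a) \<and> head H (fa a) = fv (head Q a) \<and> rev_arc H (fa a) = fa (rev_arc Q a))"

fun map_elem :: "('v \<Rightarrow> 'v) \<Rightarrow> ('a \<Rightarrow> 'a) \<Rightarrow> ('v, 'a) elem \<Rightarrow> ('v, 'a) elem" where
  "map_elem fv fa (Vert v) = Vert (fv v)"
| "map_elem fv fa (Arr a) = Arr (fa a)"
| "map_elem fv fa Star = Star"

text \<open>Composition with an isomorphism does not change the fibres.\<close>

lemma minor_morphism_iso:
  assumes \<phi>: "minor_morphism G Q \<phi>" and i: "mgraph_iso Q H fv fa" and G: "mgraph G"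
  shows "minor_morphism G H (\<lambda>u\<in>elems G. map_elem fv fa (\<phi> u))" (is "minor_morphism G H ?\<theta>")
proof -
  have fv: "bij_betw fv (verts Q) (verts H)" and fa: "bij_betw fa (arcs Q) (arcs H)"
    and com: "\<And>a. a \<in> arcs Q \<Longrightarrow> tail H (fa a) = fv (tail Q a)" "\<And>a. a \<in> arcs Q \<Longrightarrow> head H (fa a) = fv (head Q a)"
     "\<And>a. a \<in> arcs Q \<Longrightarrow> rev_arc H (fa a) = fa (rev_arc Q a)"
    using i by (auto simp: mgraph_iso_def)
  have el [simp]: "Vert v \<in> elems G' \<longleftrightarrow> v \<in> verts G'" "Arr a \<in> elems G' \<longleftrightarrow> a \<in> arcs G'" "Star \<in> elems G'"
    for v a and G' :: "('x, 'y) mgraph" by (auto simp: elems_def)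
  have P: "\<phi> \<in> elems G \<rightarrow>\<^sub>E elems Q" "\<phi> Star = Star" "\<And>v. v \<in> verts G \<Longrightarrow> \<phi> (Vert v) \<in> Vert ` verts Q"
    "\<And>a. a \<in> arcs G \<Longrightarrow> \<phi> (Arr (rev_arc G a)) = rev_elem Q (\<phi> (Arr a))"
    "\<And>a'. a' \<in> arcs Q \<Longrightarrow> \<exists>!a. a \<in> arcs G \<and> \<phi> (Arr a) = Arr a'"
    "\<And>a a'. a \<in> arcs G \<Longrightarrow> a' \<in> arcs Q \<Longrightarrow> \<phi> (Arr a) = Arr a' \<Longrightarrow> \<phi> (Vert (head G a)) = Vert (head Q a') \<and> \<phi> (Vert (tail G a)) = Vert (tail Q a')"
    "\<And>a v'. a \<in> arcs G \<Longrightarrow> v' \<in> verts Q \<Longrightarrow> \<phi> (Arr a) = Vert v' \<Longrightarrow> \<phi> (Vert (head G a)) = Vert v' \<and> \<phi> (Vert (tail G a)) = Vert v'"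
    "\<And>v'. v' \<in> verts Q \<Longrightarrow> mgraph_tree (fibre G \<phi> v')"
    using \<phi> unfolding minor_morphism_def by auto
  have \<phi>E: "\<phi> u \<in> elems Q" if "u \<in> elems G" for u using P(1) that by auto
  have fvi: "fv v = fv w \<longleftrightarrow> v = w" if "v \<in> verts Q" "w \<in> verts Q" for v w
    using fv that by (auto simp: bij_betw_def inj_on_def)
  have fai: "fa v = fa w \<longleftrightarrow> v = w" if "v \<in> arcs Q" "w \<in> arcs Q" for v w
    using fa that by (auto simp: bij_betw_def inj_on_def)
  have mV: "map_elem fv fa x = Vert (fv w) \<longleftrightarrow> x = Vert w" if "x \<in> elems Q" "w \<in> verts Q" for x w
    using that fvi by (cases x) auto
  have mA: "map_elem fv fa x = Arr (fa w) \<longleftrightarrow> x = Arr w" if "x \<in> elems Q" "w \<in> arcs Q" for x w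
    using that fai by (cases x) auto
  have mE: "map_elem fv fa x \<in> elems H" if "x \<in> elems Q" for x
    using that fv fa by (cases x) (auto dest: bij_betwE)
  note wfG = mgraph_wf[OF G] mgraph_rev(1)[OF G]
  have vH: "\<exists>w\<in>verts Q. v' = fv w" if "v' \<in> verts H" for v'
    using fv that unfolding bij_betw_def by blast
  have aH: "\<exists>b\<in>arcs Q. a' = fa b" if "a' \<in> arcs H" for a'
    using fa that unfolding bij_betw_def by blast
  show ?thesis
    unfolding minor_morphism_def
  proof (intro conjI ballI impI)
    show "?\<theta> \<in> elems G \<rightarrow>\<^sub>E elems H" using mE \<phi>E by auto
    show "?\<theta> Star = Star" using P(2) by simp
    show "?\<theta> (Vert v) \<in> Vert ` verts H" if "v \<in> verts G" for v
      using P(3)[OF that] that fv by (auto dest: bij_betwE)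
    show "?\<theta> (Arr (rev_arc G a)) = rev_elem H (?\<theta> (Arr a))" if "a \<in> arcs G" for a
    proof -
      have "\<phi> (Arr a) \<in> elems Q" using \<phi>E that by simp
      then have "map_elem fv fa (rev_elem Q (\<phi> (Arr a))) = rev_elem H (map_elem fv fa (\<phi> (Arr a)))"
        using com(3) by (cases "\<phi> (Arr a)") auto
      then show ?thesis using that wfG P(4)[OF that] by simp
    qed
    show "\<exists>!a. a \<in> arcs G \<and> ?\<theta> (Arr a) = Arr a'" if h: "a' \<in> arcs H" for a'
    proof -
      obtain b where b: "b \<in> arcs Q" "a' = fa b" using aH[OF h] by blast
      have "a \<in> arcs G \<and> ?\<theta> (Arr a) = Arr a' \<longleftrightarrow> a \<in> arcs G \<and> \<phi> (Arr a) = Arr b" for a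
        using mA[OF \<phi>E b(1), of "Arr a"] b(2) by auto
      then show ?thesis using P(5)[OF b(1)] by simp
    qed
    show "?\<theta> (Vert (head G a)) = Vert (head H a')" "?\<theta> (Vert (tail G a)) = Vert (tail H a')"
      if h: "a \<in> arcs G" "a' \<in> arcs H" "?\<theta> (Arr a) = Arr a'" for a a'
    proof -
      obtain b where b: "b \<in> arcs Q" "a' = fa b" using aH[OF h(2)] by blast
      then have "\<phi> (Arr a) = Arr b" using mA[OF \<phi>E b(1), of "Arr a"] h(1,3) by auto
      from P(6)[OF h(1) b(1) this] show "?\<theta> (Vert (head G a)) = Vert (head H a')" "?\<theta> (Vert (tail G a)) = Vert (tail H a')"
        using h(1) wfG b com by auto
    qed
    show "?\<theta> (Vert (head G a)) = Vert v'" "?\<theta> (Vert (tail G a)) = Vert v'"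
      if h: "a \<in> arcs G" "v' \<in> verts H" "?\<theta> (Arr a) = Vert v'" for a v'
    proof -
      obtain w where w: "w \<in> verts Q" "v' = fv w" using vH[OF h(2)] by blast
      then have "\<phi> (Arr a) = Vert w" using mV[OF \<phi>E w(1), of "Arr a"] h(1,3) by auto
      from P(7)[OF h(1) w(1) this] show "?\<theta> (Vert (head G a)) = Vert v'" "?\<theta> (Vert (tail G a)) = Vert v'"
        using h(1) wfG w by auto
    qed
    show "mgraph_tree (fibre G ?\<theta> v')" if h: "v' \<in> verts H" for v'
    proof -
      obtain w where w: "w \<in> verts Q" "v' = fv w" using vH[OF h] by blast
      have "fibre G ?\<theta> v' = fibre G \<phi> w"
      proof -
        have "{v \<in> verts G. ?\<theta> (Vert v) = Vert v'} = {v \<in> verts G. \<phi> (Vert v) = Vert w}"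
          using mV[OF \<phi>E w(1)] w(2) by auto
        moreover have "{a \<in> arcs G. ?\<theta> (Arr a) = Vert v'} = {a \<in> arcs G. \<phi> (Arr a) = Vert w}"
          using mV[OF \<phi>E w(1)] w(2) by auto
        ultimately show ?thesis unfolding fibre_def by simp
      qed
      then show ?thesis using P(8)[OF w(1)] by simp
    qed
  qed
qed

text \<open>The incidence structure after the vertices and arcs have been numbered. Graphs of bounded size have
  finitely many codes, and the code determines the graph up to isomorphism.\<close>

definition code_of :: "('v \<Rightarrow> nat) \<Rightarrow> ('a \<Rightarrow> nat) \<Rightarrow> ('v, 'a) mgraph \<Rightarrow> nat \<times> nat set \<times> (nat \<times> nat \<times> nat \<times> nat) set" where
  "code_of bv ba G = (card (verts G), ba ` arcs G,
     (\<lambda>a. (ba a, bv (tail G a), bv (head G a), ba (rev_arc G a))) ` arcs G)"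

lemma iso_if_code_eq:
  assumes H: "mgraph H"
    and bQ: "bij_betw bv (verts Q) {..<card (verts Q)}" "inj_on ba (arcs Q)"
    and bH: "bij_betw bv' (verts H) {..<card (verts H)}" "inj_on ba' (arcs H)"
    and eq: "code_of bv ba Q = code_of bv' ba' H"
  shows "mgraph_iso Q H (inv_into (verts H) bv' \<circ> bv) (inv_into (arcs H) ba' \<circ> ba)"
proof -
  let ?fv = "inv_into (verts H) bv' \<circ> bv" and ?fa = "inv_into (arcs H) ba' \<circ> ba"
  have c: "card (verts Q) = card (verts H)" "ba ` arcs Q = ba' ` arcs H"
    and s: "(\<lambda>a. (ba a, bv (tail Q a), bv (head Q a), ba (rev_arc Q a))) ` arcs Q
      = (\<lambda>a. (ba' a, bv' (tail H a), bv' (head H a), ba' (rev_arc H a))) ` arcs H"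
    using eq by (auto simp: code_of_def)
  have fv: "bij_betw ?fv (verts Q) (verts H)"
    using bij_betw_trans[OF bQ(1) bij_betw_inv_into[OF bH(1)[folded c(1)]]] .
  have fa: "bij_betw ?fa (arcs Q) (arcs H)"
    using bij_betw_trans[OF bij_betw_imageI[OF bQ(2) c(2)] bij_betw_inv_into[OF bij_betw_imageI[OF bH(2) refl]]] .
  have bv'i: "inv_into (verts H) bv' (bv' v) = v" if "v \<in> verts H" for v
    using bH(1) that by (simp add: bij_betw_def)
  have ba'i: "inv_into (arcs H) ba' (ba' v) = v" if "v \<in> arcs H" for v
    using bH(2) that by simp
  have "tail H (?fa a) = ?fv (tail Q a) \<and> head H (?fa a) = ?fv (head Q a) \<and> rev_arc H (?fa a) = ?fa (rev_arc Q a)"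
    if a: "a \<in> arcs Q" for a
  proof -
    have "(ba a, bv (tail Q a), bv (head Q a), ba (rev_arc Q a)) \<in> (\<lambda>a. (ba' a, bv' (tail H a), bv' (head H a), ba' (rev_arc H a))) ` arcs H"
      unfolding s[symmetric] using a by blast
    then obtain b where b: "b \<in> arcs H" "ba a = ba' b" "bv (tail Q a) = bv' (tail H b)" "bv (head Q a) = bv' (head H b)"
      "ba (rev_arc Q a) = ba' (rev_arc H b)" by auto
    show ?thesis
      using b mgraph_wf[OF H b(1)] mgraph_rev(1)[OF H b(1)] by (simp add: bv'i ba'i)
  qed
  then show ?thesis using fv fa by (simp add: mgraph_iso_def)
qed

lemma finite_iso_classes:
  fixes K :: "('v, 'a) mgraph set"
  assumes K: "\<And>G. G \<in> K \<Longrightarrow> mgraph G \<and> card (verts G) \<le> n \<and> card (arcs G) \<le> m"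
  shows "\<exists>R. finite R \<and> R \<subseteq> K \<and> (\<forall>Q\<in>K. \<exists>H\<in>R. \<exists>fv fa. mgraph_iso Q H fv fa)"
proof -
  have "\<exists>bv. bij_betw bv (verts G) {..<card (verts G)}" "\<exists>ba. bij_betw ba (arcs G) {..<card (arcs G)}" if "G \<in> K" for G
    using mgraph_finite[of G] K[OF that] ex_bij_betw_finite_nat[of "verts G"] ex_bij_betw_finite_nat[of "arcs G"]
    by (auto simp: atLeast0LessThan)
  then obtain bv ba where b: "\<And>G. G \<in> K \<Longrightarrow> bij_betw (bv G) (verts G) {..<card (verts G)}"
     "\<And>G. G \<in> K \<Longrightarrow> bij_betw (ba G) (arcs G) {..<card (arcs G)}" by metis
  let ?c = "\<lambda>G. code_of (bv G) (ba G) G"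
  have "?c ` K \<subseteq> {..n} \<times> Pow {..<m} \<times> Pow ({..<m} \<times> {..<n} \<times> {..<n} \<times> {..<m})"
  proof
    fix x assume "x \<in> ?c ` K"
    then obtain G where G: "G \<in> K" "x = ?c G" by blast
    have v: "bv G v < n" if "v \<in> verts G" for v
      using bij_betwE[OF b(1)[OF G(1)]] that K[OF G(1)] by fastforce
    have a: "ba G a < m" if "a \<in> arcs G" for a
      using bij_betwE[OF b(2)[OF G(1)]] that K[OF G(1)] by fastforce
    show "x \<in> {..n} \<times> Pow {..<m} \<times> Pow ({..<m} \<times> {..<n} \<times> {..<n} \<times> {..<m})"
      using K[OF G(1)] v a mgraph_wf[of G] mgraph_rev(1)[of G] unfolding G(2) code_of_def by auto
  qed
  then have fin: "finite (?c ` K)" by (rule finite_subset) auto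
  define R where "R = inv_into K ?c ` ?c ` K"
  have "finite R" using fin by (simp add: R_def)
  moreover have "R \<subseteq> K" unfolding R_def by (auto intro: inv_into_into)
  moreover have "\<forall>Q\<in>K. \<exists>H\<in>R. \<exists>fv fa. mgraph_iso Q H fv fa"
  proof
    fix Q assume Q: "Q \<in> K"
    let ?H = "inv_into K ?c (?c Q)"
    have H: "?H \<in> K" "?c ?H = ?c Q" using Q by (auto intro: inv_into_into f_inv_into_f)
    have "mgraph_iso Q ?H (inv_into (verts ?H) (bv ?H) \<circ> bv Q) (inv_into (arcs ?H) (ba ?H) \<circ> ba Q)"
      by (rule iso_if_code_eq) (use K[OF Q] K[OF H(1)] b(1)[OF Q] b(1)[OF H(1)] b(2)[OF Q] b(2)[OF H(1)] H(2)
        in \<open>auto simp: bij_betw_def\<close>)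
    moreover have "?H \<in> R" unfolding R_def using Q by (intro imageI)
    ultimately show "\<exists>H\<in>R. \<exists>fv fa. mgraph_iso Q H fv fa" by blast
  qed
  ultimately show ?thesis by (intro exI[of _ R] conjI)
qed

lemma card_arcs_le: assumes "mgraph G" shows "card (arcs G) \<le> 2 * card (edges G)"
proof -
  have fin: "finite (edges G)" using mgraph_finite[OF assms] by (simp add: edges_def)
  have "arcs G \<subseteq> \<Union>(edges G)" by (auto simp: edges_def)
  moreover have "finite (\<Union>(edges G))" using mgraph_finite[OF assms] by (auto simp: edges_def)
  ultimately have "card (arcs G) \<le> card (\<Union>(edges G))" by (intro card_mono)
  also have "\<dots> \<le> (\<Sum>e\<in>edges G. card e)" by (rule card_Union_le_sum_card)
  also have "\<dots> \<le> (\<Sum>e\<in>edges G. 2)" by (rule sum_mono) (auto simp: edges_def card_insert_if)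
  finally show ?thesis by simp
qed

text \<open>The contraction has one vertex for each marked vertex (one vertex if nothing is marked), and it
  preserves the genus, so it has at most \<open>N + 1\<close> vertices and at most \<open>g + N\<close> edges. Arcs between
  marked vertices do not belong to the forest and survive.\<close>

theorem marked_contraction:
  fixes g N :: nat
  shows "\<exists>Gs :: ('v, 'a) mgraph set. finite Gs \<and> Gs \<subseteq> graphs_le g \<and>
    (\<forall>G \<in> graphs_le g :: ('v, 'a) mgraph set. \<forall>M \<subseteq> verts G. card M \<le> N \<longrightarrow>
       (\<exists>H \<in> Gs. \<exists>\<theta>. minor_morphism G H \<theta> \<and> inj_on (\<lambda>v. \<theta> (Vert v)) M \<and>
          (\<forall>a \<in> arcs G. tail G a \<in> M \<longrightarrow> head G a \<in> M \<longrightarrow> \<theta> (Arr a) \<in> Arr ` arcs H)))"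
proof -
  define K :: "('v, 'a) mgraph set" where "K = {Q \<in> graphs_le g. card (verts Q) \<le> Suc N}"
  have K: "mgraph Q \<and> card (verts Q) \<le> Suc N \<and> card (arcs Q) \<le> 2 * (g + N)" if "Q \<in> K" for Q
  proof -
    have m: "mgraph Q" "card (verts Q) \<le> Suc N" "genus Q \<le> int g" using that by (auto simp: K_def graphs_le_def)
    then have "card (edges Q) \<le> g + N" by (simp add: genus_def)
    then show ?thesis using m card_arcs_le[OF m(1)] by simp
  qed
  obtain R where R: "finite R" "R \<subseteq> K" "\<And>Q. Q \<in> K \<Longrightarrow> \<exists>H\<in>R. \<exists>fv fa. mgraph_iso Q H fv fa"
  proof -
    from finite_iso_classes[OF K] obtain R where "finite R \<and> R \<subseteq> K \<and> (\<forall>Q\<in>K. \<exists>H\<in>R. \<exists>fv fa. mgraph_iso Q H fv fa)" ..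
    then show thesis by (intro that[of R]) (simp_all del: ex_simps)
  qed
  have main: "\<exists>H \<in> R. \<exists>\<theta>. minor_morphism G H \<theta> \<and> inj_on (\<lambda>v. \<theta> (Vert v)) M \<and>
          (\<forall>a \<in> arcs G. tail G a \<in> M \<longrightarrow> head G a \<in> M \<longrightarrow> \<theta> (Arr a) \<in> Arr ` arcs H)"
    if G: "G \<in> graphs_le g" and M: "M \<subseteq> verts G" "card M \<le> N" for G :: "('v, 'a) mgraph" and M
  proof -
    have mG: "mgraph G" "connected_mgraph G" "genus G \<le> int g" using G by (auto simp: graphs_le_def)
    then have ne: "verts G \<noteq> {}" using connected_mgraph_iff_cut[OF mgraph_wf[OF mG(1)]] by blast
    obtain M' where M': "M \<subseteq> M'" "M' \<subseteq> verts G" "M' \<noteq> {}" "card M' \<le> Suc N"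
    proof (cases "M = {}")
      case True
      obtain v where "v \<in> verts G" using ne by blast
      then show ?thesis using that[of "{v}"] True by simp
    next
      case False then show ?thesis using that[of M] M by simp
    qed
    interpret marked_mgraph G M' by unfold_locales (use mG M' in auto)
    have "contracted \<in> K"
      using mgraph_contracted connected_contracted genus_contracted mG(3) M'(4) by (simp add: K_def graphs_le_def) (simp add: contracted_def)
    then obtain H fv fa where H: "H \<in> R" "mgraph_iso contracted H fv fa" using R(3) by blast
    let ?\<theta> = "\<lambda>u\<in>elems G. map_elem fv fa (contraction u)"
    have "minor_morphism G H ?\<theta>"
      by (rule minor_morphism_iso[OF minor_morphism_contraction H(2) mG(1)])
    moreover have "inj_on (\<lambda>v. ?\<theta> (Vert v)) M"
    proof (rule inj_onI)
      fix v w assume vw: "v \<in> M" "w \<in> M" "?\<theta> (Vert v) = ?\<theta> (Vert w)"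
      then have vw': "v \<in> M'" "w \<in> M'" "v \<in> verts G" "w \<in> verts G" using M' by auto
      then have "fv v = fv w" using vw(3) by (simp add: root_id)
      moreover have "inj_on fv M'" using H(2) by (simp add: mgraph_iso_def bij_betw_def contracted_def)
      ultimately show "v = w" using vw' by (simp add: inj_on_def)
    qed
    moreover have "?\<theta> (Arr a) \<in> Arr ` arcs H" if "a \<in> arcs G" "tail G a \<in> M" "head G a \<in> M" for a
    proof -
      have "a \<notin> forest_arcs" using forest_arc_not_marked that M'(1) by blast
      moreover from this have "fa a \<in> arcs H"
        using H(2) that(1) by (auto simp: mgraph_iso_def contracted_def dest: bij_betwE)
      ultimately show ?thesis using that(1) by simp
    qed
    ultimately show ?thesis using H(1) by blast
  qed
  have sub: "R \<subseteq> graphs_le g" using R(2) by (auto simp: K_def)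
  show ?thesis
    by (rule exI[of _ R], intro conjI ballI allI impI) (rule R(1), rule sub, rule main)
qed

section \<open>Minor morphisms and configuration spaces\<close>

definition diff_form :: "'l \<Rightarrow> 'l \<Rightarrow> 'l \<Rightarrow> real" where
  "diff_form e f = (\<lambda>w. (if w = e then 1 else 0) - (if w = f then 1 else 0))"

lemma diff_form_support: "e \<noteq> f \<Longrightarrow> {w. diff_form e f w \<noteq> 0} = {e, f}"
  by (auto simp: diff_form_def)

lemma lform_diff_form:
  assumes "finite W" "e \<in> W" "f \<in> W" shows "lform W (diff_form e f) x = x e - x f"
proof -
  have "lform W (diff_form e f) x = (\<Sum>v\<in>W. (if v = e then x v else 0) - (if v = f then x v else 0))"
    unfolding lform_def diff_form_def by (rule sum.cong) auto
  also have "\<dots> = x e - x f" using assms by (simp add: sum_subtractf)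
  finally show ?thesis .
qed

text \<open>The parallel forms \<open>x e - x f\<close> and \<open>x f - x e\<close> both occur.\<close>

definition edge_forms :: "('v, 'a) mgraph \<Rightarrow> ('a set \<Rightarrow> real) set" where
  "edge_forms G = {diff_form e f | e f. (e, f) \<in> parcs (line_graph_complement G)}"

lemma parcs_lgc: "(e, f) \<in> parcs (line_graph_complement G) \<longleftrightarrow>
    e \<in> edges G \<and> f \<in> edges G \<and> e \<noteq> f \<and> endpoints G e \<inter> endpoints G f = {}"
  by (simp add: line_graph_complement_def)

lemma finite_edges: "mgraph G \<Longrightarrow> finite (edges G)"
  using mgraph_finite by (auto simp: edges_def)

lemma Conf_lgc:
  assumes "mgraph G"
  shows "(Conf (line_graph_complement G) :: ('a set \<Rightarrow> complex ^ 'd) topology) = subtopology (coords (edges G)) (arr_compl (edges G) (edge_forms (G :: ('v, 'a) mgraph)))"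
proof -
  let ?S = "{x :: 'a set \<Rightarrow> complex ^ 'd. \<forall>v w. (v, w) \<in> parcs (line_graph_complement G) \<longrightarrow> x v \<noteq> x w}"
  have "arr_compl (edges G) (edge_forms G) = extensional (edges G) \<inter> ?S"
  proof -
    have "lform (edges G) (diff_form v w) x = 0 \<longleftrightarrow> x v = x w" if "(v, w) \<in> parcs (line_graph_complement G)"
      for v w and x :: "'a set \<Rightarrow> complex ^ 'd"
      using that by (simp add: parcs_lgc lform_diff_form[OF finite_edges[OF assms]])
    moreover have "arr_compl (edges G) (edge_forms G) = {x \<in> extensional (edges G). \<forall>v w.
        (v, w) \<in> parcs (line_graph_complement G) \<longrightarrow> lform (edges G) (diff_form v w) x \<noteq> (0 :: complex ^ 'd)}"
      unfolding arr_compl_def edge_forms_def by blast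
    ultimately show ?thesis by auto
  qed
  then have "arr_compl (edges G) (edge_forms G) = topspace (coords (edges G)) \<inter> ?S" by (simp only: topspace_coords)
  then have "subtopology (coords (edges G)) (arr_compl (edges G) (edge_forms G)) = subtopology (coords (edges G)) ?S"
    by (simp only: subtopology_restrict)
  then show ?thesis by (simp add: Conf_def line_graph_complement_def)
qed

lemma topspace_Conf_lgc:
  "topspace (Conf (line_graph_complement G) :: ('a set \<Rightarrow> complex ^ 'd) topology) =
    {x \<in> extensional (edges (G :: ('v, 'a) mgraph)). \<forall>e f. (e, f) \<in> parcs (line_graph_complement G) \<longrightarrow> x e \<noteq> x f}"
proof -
  have "pverts (line_graph_complement G) = edges G" by (simp add: line_graph_complement_def)
  then show ?thesis by (auto simp: Conf_def PiE_def)
qed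

locale minor =
  fixes G :: "('v, 'a) mgraph" and G' :: "('w, 'b) mgraph" and \<phi>
  assumes G: "mgraph G" and G': "mgraph G'" and \<phi>: "minor_morphism G G' \<phi>"
begin

lemma phi_rev: "a \<in> arcs G \<Longrightarrow> \<phi> (Arr (rev_arc G a)) = rev_elem G' (\<phi> (Arr a))"
  using \<phi> unfolding minor_morphism_def by blast

lemma phi_ex1: "a' \<in> arcs G' \<Longrightarrow> \<exists>!a. a \<in> arcs G \<and> \<phi> (Arr a) = Arr a'"
  using \<phi> unfolding minor_morphism_def by blast

lemma phi_ends:
  "a \<in> arcs G \<Longrightarrow> a' \<in> arcs G' \<Longrightarrow> \<phi> (Arr a) = Arr a' \<Longrightarrow> \<phi> (Vert (head G a)) = Vert (head G' a')"
  "a \<in> arcs G \<Longrightarrow> a' \<in> arcs G' \<Longrightarrow> \<phi> (Arr a) = Arr a' \<Longrightarrow> \<phi> (Vert (tail G a)) = Vert (tail G' a')"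
  using \<phi> unfolding minor_morphism_def by blast+

lemma phi_arc:
  assumes "a \<in> arcs G" "\<phi> (Arr a) = Arr a'" shows "a' \<in> arcs G'"
proof -
  have "\<phi> \<in> elems G \<rightarrow>\<^sub>E elems G'" using \<phi> unfolding minor_morphism_def by blast
  moreover have "Arr a \<in> elems G" using assms by (simp add: elems_def)
  ultimately have "\<phi> (Arr a) \<in> elems G'" by blast
  then show ?thesis unfolding assms(2) by (auto simp: elems_def)
qed

lemma edge_pullback_arc:
  assumes a: "a \<in> arcs G" "\<phi> (Arr a) = Arr a'"
  shows "edge_pullback G \<phi> {a', rev_arc G' a'} = {a, rev_arc G a}"
  unfolding edge_pullback_def
proof (rule the_equality)
  have a': "a' \<in> arcs G'" by (rule phi_arc[OF a])
  show "{a, rev_arc G a} \<in> edges G \<and> (\<lambda>a. \<phi> (Arr a)) ` {a, rev_arc G a} = Arr ` {a', rev_arc G' a'}"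
    using a phi_rev[OF a(1)] by (auto simp: edges_def)
  fix e assume e: "e \<in> edges G \<and> (\<lambda>a. \<phi> (Arr a)) ` e = Arr ` {a', rev_arc G' a'}"
  then obtain b where b: "b \<in> arcs G" "e = {b, rev_arc G b}" by (auto simp: edges_def)
  have "Arr a' \<in> (\<lambda>a. \<phi> (Arr a)) ` e" using e by simp
  then obtain c where c: "c \<in> e" "\<phi> (Arr c) = Arr a'" by auto
  then have "c \<in> arcs G" using b mgraph_rev(1)[OF G b(1)] by auto
  then have "c = a" using phi_ex1[OF a'] a c(2) by blast
  then show "e = {a, rev_arc G a}" using c(1) b mgraph_rev(2)[OF G] by auto
qed

lemma edge_lift:
  assumes "e' \<in> edges G'"
  obtains a a' where "a \<in> arcs G" "a' \<in> arcs G'" "\<phi> (Arr a) = Arr a'" "e' = {a', rev_arc G' a'}" "edge_pullback G \<phi> e' = {a, rev_arc G a}"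
proof -
  obtain a' where a': "a' \<in> arcs G'" "e' = {a', rev_arc G' a'}" using assms by (auto simp: edges_def)
  then obtain a where a: "a \<in> arcs G" "\<phi> (Arr a) = Arr a'" using phi_ex1 by blast
  show ?thesis by (rule that[OF a(1) a'(1) a(2) a'(2)]) (simp add: a'(2) edge_pullback_arc[OF a])
qed

lemma edge_pullback_edges: "e' \<in> edges G' \<Longrightarrow> edge_pullback G \<phi> e' \<in> edges G"
  by (erule edge_lift) (auto simp: edges_def)

lemma endpoints_edge:
  assumes "mgraph H" "a \<in> arcs H" shows "endpoints H {a, rev_arc H a} = {tail H a, head H a}"
  using mgraph_rev[OF assms(1)] assms(2) by (auto simp: endpoints_def)

lemma edge_pullback_endpoints:
  assumes "e' \<in> edges G'" "x \<in> endpoints G (edge_pullback G \<phi> e')"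
  shows "\<exists>x'. \<phi> (Vert x) = Vert x' \<and> x' \<in> endpoints G' e'"
proof -
  obtain a a' where a: "a \<in> arcs G" "a' \<in> arcs G'" "\<phi> (Arr a) = Arr a'" "e' = {a', rev_arc G' a'}"
    "edge_pullback G \<phi> e' = {a, rev_arc G a}" by (rule edge_lift[OF assms(1)])
  have "endpoints G (edge_pullback G \<phi> e') = {tail G a, head G a}"
    unfolding a(5) by (rule endpoints_edge[OF G a(1)])
  moreover have "endpoints G' e' = {tail G' a', head G' a'}"
    unfolding a(4) by (rule endpoints_edge[OF G' a(2)])
  ultimately show ?thesis using assms(2) phi_ends[OF a(1-3)] by auto
qed

lemma edge_pullback_inj:
  assumes "e' \<in> edges G'" "f' \<in> edges G'" "edge_pullback G \<phi> e' = edge_pullback G \<phi> f'"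
  shows "e' = f'"
proof -
  obtain a a' where a: "a \<in> arcs G" "a' \<in> arcs G'" "\<phi> (Arr a) = Arr a'" "e' = {a', rev_arc G' a'}"
    "edge_pullback G \<phi> e' = {a, rev_arc G a}" by (rule edge_lift[OF assms(1)])
  obtain b b' where b: "b \<in> arcs G" "b' \<in> arcs G'" "\<phi> (Arr b) = Arr b'" "f' = {b', rev_arc G' b'}"
    "edge_pullback G \<phi> f' = {b, rev_arc G b}" by (rule edge_lift[OF assms(2)])
  have "(\<lambda>a. \<phi> (Arr a)) ` {a, rev_arc G a} = Arr ` e'" "(\<lambda>a. \<phi> (Arr a)) ` {b, rev_arc G b} = Arr ` f'"
    using a b phi_rev[OF a(1)] phi_rev[OF b(1)] by auto
  moreover have "{a, rev_arc G a} = {b, rev_arc G b}" using assms(3) a(5) b(5) by simp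
  ultimately have "Arr ` e' = (Arr ` f' :: ('w, 'b) elem set)" by simp
  then show ?thesis by (simp add: inj_image_eq_iff inj_def)
qed

text \<open>A minor morphism maps the ends of a pulled back edge to the ends of the edge, so a common end of
  two pullbacks yields a common end of the edges.\<close>

lemma edge_pullback_parcs:
  assumes "(e', f') \<in> parcs (line_graph_complement G')"
  shows "(edge_pullback G \<phi> e', edge_pullback G \<phi> f') \<in> parcs (line_graph_complement G)"
proof -
  have ef: "e' \<in> edges G'" "f' \<in> edges G'" "e' \<noteq> f'" "endpoints G' e' \<inter> endpoints G' f' = {}"
    using assms by (auto simp: parcs_lgc)
  have "endpoints G (edge_pullback G \<phi> e') \<inter> endpoints G (edge_pullback G \<phi> f') = {}"
    using edge_pullback_endpoints[OF ef(1)] edge_pullback_endpoints[OF ef(2)] ef(4) by fastforce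
  moreover have "edge_pullback G \<phi> e' \<noteq> edge_pullback G \<phi> f'"
    using edge_pullback_inj[OF ef(1,2)] ef(3) by blast
  ultimately show ?thesis
    using ef by (simp add: parcs_lgc edge_pullback_edges)
qed

lemma continuous_conf_restriction:
  "continuous_map (Conf (line_graph_complement G)) (Conf (line_graph_complement G'))
     (conf_restriction G G' \<phi> :: ('a set \<Rightarrow> complex ^ 'd) \<Rightarrow> 'b set \<Rightarrow> complex ^ 'd)"
proof -
  have pv: "pverts (line_graph_complement G) = edges G" "pverts (line_graph_complement G') = edges G'"
    by (simp_all add: line_graph_complement_def)
  have "continuous_map (coords (edges G)) (coords (edges G'))
     (conf_restriction G G' \<phi> :: ('a set \<Rightarrow> complex ^ 'd) \<Rightarrow> 'b set \<Rightarrow> complex ^ 'd)"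
    unfolding continuous_map_componentwise conf_restriction_def
    using edge_pullback_edges by (auto intro!: continuous_map_product_projection)
  then show ?thesis
    unfolding Conf_def pv continuous_map_in_subtopology
  proof (intro conjI continuous_map_from_subtopology)
    show "conf_restriction G G' \<phi> \<in> topspace (subtopology (coords (edges G))
        {x. \<forall>v w. (v, w) \<in> parcs (line_graph_complement G) \<longrightarrow> x v \<noteq> x w}) \<rightarrow>
      {x :: 'b set \<Rightarrow> complex ^ 'd. \<forall>v w. (v, w) \<in> parcs (line_graph_complement G') \<longrightarrow> x v \<noteq> x w}"
    proof
      fix x :: "'a set \<Rightarrow> complex ^ 'd"
      assume "x \<in> topspace (subtopology (coords (edges G)) {x. \<forall>v w. (v, w) \<in> parcs (line_graph_complement G) \<longrightarrow> x v \<noteq> x w})"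
      then have x: "x v \<noteq> x w" if "(v, w) \<in> parcs (line_graph_complement G)" for v w using that by auto
      have "conf_restriction G G' \<phi> x v \<noteq> conf_restriction G G' \<phi> x w" if "(v, w) \<in> parcs (line_graph_complement G')" for v w
        using x[OF edge_pullback_parcs[OF that]] that by (simp add: conf_restriction_def parcs_lgc)
      then show "conf_restriction G G' \<phi> x \<in> {x. \<forall>v w. (v, w) \<in> parcs (line_graph_complement G') \<longrightarrow> x v \<noteq> x w}" by blast
    qed
  qed
qed

end

lemma edge_pullback_ident:
  assumes G: "mgraph G" and e: "e \<in> edges G"
  shows "edge_pullback G (\<lambda>u\<in>elems G. u) e = e"
  unfolding edge_pullback_def
proof (rule the_equality)
  have im: "(\<lambda>a. (\<lambda>u\<in>elems G. u) (Arr a)) ` f = Arr ` f" if f: "f \<in> edges G" for f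
  proof (rule image_cong[OF refl])
    fix a assume "a \<in> f"
    then have "a \<in> arcs G" using f mgraph_rev(1)[OF G] by (auto simp: edges_def)
    then show "(\<lambda>u\<in>elems G. u) (Arr a) = Arr a" by (simp add: elems_def)
  qed
  show "e \<in> edges G \<and> (\<lambda>a. (\<lambda>u\<in>elems G. u) (Arr a)) ` e = Arr ` e" using im[OF e] e by simp
  show "f = e" if "f \<in> edges G \<and> (\<lambda>a. (\<lambda>u\<in>elems G. u) (Arr a)) ` f = Arr ` e" for f
    using im[of f] that by (simp add: inj_image_eq_iff inj_def)
qed

lemma edge_pullback_compose:
  assumes "minor G G' \<phi>" "minor G' G'' \<psi>" "e \<in> edges G''"
  shows "edge_pullback G (compose (elems G) \<psi> \<phi>) e = edge_pullback G \<phi> (edge_pullback G' \<psi> e)"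
proof -
  interpret P: minor G G' \<phi> by (rule assms(1))
  interpret Q: minor G' G'' \<psi> by (rule assms(2))
  obtain b c where b: "b \<in> arcs G'" "c \<in> arcs G''" "\<psi> (Arr b) = Arr c" "e = {c, rev_arc G'' c}" "edge_pullback G' \<psi> e = {b, rev_arc G' b}"
    by (rule Q.edge_lift[OF assms(3)])
  obtain a where a: "a \<in> arcs G" "\<phi> (Arr a) = Arr b" using P.phi_ex1[OF b(1)] by blast
  have "edge_pullback G (compose (elems G) \<psi> \<phi>) e = {a, rev_arc G a}"
    unfolding edge_pullback_def
  proof (rule the_equality)
    have cmp: "compose (elems G) \<psi> \<phi> (Arr x) = \<psi> (\<phi> (Arr x))" if "x \<in> arcs G" for x
      using that by (simp add: compose_def elems_def)
    show "{a, rev_arc G a} \<in> edges G \<and> (\<lambda>a. compose (elems G) \<psi> \<phi> (Arr a)) ` {a, rev_arc G a} = Arr ` e"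
      using a b P.phi_rev[OF a(1)] Q.phi_rev[OF b(1)] cmp mgraph_rev(1)[OF P.G a(1)] by (auto simp: edges_def)
    fix f assume f: "f \<in> edges G \<and> (\<lambda>a. compose (elems G) \<psi> \<phi> (Arr a)) ` f = Arr ` e"
    then obtain x where x: "x \<in> arcs G" "f = {x, rev_arc G x}" by (auto simp: edges_def)
    have "Arr c \<in> (\<lambda>a. compose (elems G) \<psi> \<phi> (Arr a)) ` f" using f b(4) by simp
    then obtain y where y: "y \<in> f" "compose (elems G) \<psi> \<phi> (Arr y) = Arr c" by auto
    have yG: "y \<in> arcs G" using y(1) x mgraph_rev(1)[OF P.G x(1)] by auto
    then have y2: "\<psi> (\<phi> (Arr y)) = Arr c" using y(2) cmp by simp
    have "\<phi> (Arr y) = Arr b"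
    proof (cases "\<phi> (Arr y)")
      case (Arr z)
      then show ?thesis using Q.phi_ex1[OF b(2)] b(1,3) y2 P.phi_arc[OF yG Arr] by auto
    next
      case (Vert v)
      have el: "\<phi> \<in> elems G \<rightarrow>\<^sub>E elems G'" using P.\<phi> unfolding minor_morphism_def by blast
      have "\<phi> (Arr y) \<in> elems G'" using el yG by (auto simp: elems_def)
      then have "v \<in> verts G'" using Vert by (auto simp: elems_def)
      then have "\<psi> (Vert v) \<in> Vert ` verts G''" using Q.\<phi> unfolding minor_morphism_def by blast
      then show ?thesis using y2 Vert by auto
    next
      case Star
      have "\<psi> Star = Star" using Q.\<phi> unfolding minor_morphism_def by blast
      then show ?thesis using y2 Star by simp
    qed
    then have "y = a" using P.phi_ex1[OF b(1)] yG a by blast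
    then show "f = {a, rev_arc G a}" using y(1) x mgraph_rev(2)[OF P.G] by auto
  qed
  then show ?thesis using P.edge_pullback_arc[OF a] b(5) by simp
qed

section \<open>Finite generation\<close>

lemma generated_Conf:
  fixes G :: "('v, 'a) mgraph"
  assumes G: "mgraph G"
  shows "generated i (Conf (line_graph_complement G) :: ('a set \<Rightarrow> complex ^ 'd) topology) (indep_family (edges G) (edge_forms G) i)"
  unfolding Conf_lgc[OF G]
proof (rule generated_complement)
  show "2 \<le> DIM(complex ^ 'd)" by simp
  show "finite (edges G)" by (rule finite_edges[OF G])
  have "edge_forms G \<subseteq> (\<lambda>(e, f). diff_form e f) ` (edges G \<times> edges G)" by (auto simp: edge_forms_def parcs_lgc)
  then show "finite (edge_forms G)" using finite_edges[OF G] finite_subset by blast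
  fix f assume "f \<in> edge_forms G"
  then obtain e1 e2 where e: "f = diff_form e1 e2" "e1 \<in> edges G" "e2 \<in> edges G" "e1 \<noteq> e2" by (auto simp: edge_forms_def parcs_lgc)
  note sup = diff_form_support[OF e(4), folded e(1)]
  show "w \<in> edges G" if "f w \<noteq> 0" for w using that sup e by auto
  show "\<exists>w. f w \<noteq> 0" using sup by blast
  show "card {w. f w \<noteq> 0} \<le> 2" unfolding sup by (simp add: card_insert_if)
qed

text \<open>The edges in \<open>W\<close> survive in \<open>H\<close>, and disjoint ones stay disjoint because their ends stay distinct.
  So forgetting all coordinates outside \<open>W\<close> factors through the configuration space of \<open>H\<close>.\<close>

lemma class_from_small_minor:
  fixes G H :: "('v, 'a) mgraph" and \<zeta> :: "((nat \<Rightarrow> real) \<Rightarrow> 'a set \<Rightarrow> complex ^ 'd) \<Rightarrow> int"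
  assumes m: "minor G H \<theta>" and W: "W \<subseteq> edges G" and F: "F \<subseteq> edge_forms G" "\<And>f v. f \<in> F \<Longrightarrow> f v \<noteq> 0 \<Longrightarrow> v \<in> W"
    and inj: "inj_on (\<lambda>v. \<theta> (Vert v)) (\<Union>e\<in>W. endpoints G e)"
    and surv: "\<And>a. a \<in> \<Union>W \<Longrightarrow> \<theta> (Arr a) \<in> Arr ` arcs H"
    and \<zeta>: "cocycle i (subtopology (coords W) (arr_compl W F)) \<zeta>"
  shows "cclass i (Conf (line_graph_complement G)) (pullback i (\<lambda>x. restrict x W) \<zeta>) \<in>
    cohomology_map i (Conf (line_graph_complement G)) (conf_restriction G H \<theta>) `
      carrier (cohomology_group i (Conf (line_graph_complement H) :: ('a set \<Rightarrow> complex ^ 'd) topology))"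
proof -
  interpret minor G H \<theta> by (rule m)
  define \<eta> where "\<eta> w = {b. \<exists>a\<in>w. \<theta> (Arr a) = Arr b}" for w
  have \<eta>: "\<exists>a b. a \<in> arcs G \<and> b \<in> arcs H \<and> \<theta> (Arr a) = Arr b \<and> w = {a, rev_arc G a} \<and> \<eta> w = {b, rev_arc H b}" if w: "w \<in> W" for w
  proof -
    obtain a where a: "a \<in> arcs G" "w = {a, rev_arc G a}" using w W by (auto simp: edges_def)
    then obtain b where b: "b \<in> arcs H" "\<theta> (Arr a) = Arr b" using surv[of a] w by auto
    then have "\<eta> w = {b, rev_arc H b}" unfolding \<eta>_def a(2) using phi_rev[OF a(1)] by auto
    then show ?thesis using a b by blast
  qed
  have \<eta>E: "\<eta> w \<in> edges H" and \<eta>p: "edge_pullback G \<theta> (\<eta> w) = w" if "w \<in> W" for w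
    using \<eta>[OF that] edge_pullback_arc by (auto simp: edges_def)
  have \<eta>end: "\<exists>x\<in>endpoints G w. \<theta> (Vert x) = Vert y" if w: "w \<in> W" and y: "y \<in> endpoints H (\<eta> w)" for w y
  proof -
    obtain a b where ab: "a \<in> arcs G" "b \<in> arcs H" "\<theta> (Arr a) = Arr b" "w = {a, rev_arc G a}" "\<eta> w = {b, rev_arc H b}"
      using \<eta>[OF w] by blast
    have "endpoints H (\<eta> w) = {tail H b, head H b}" unfolding ab(5) by (rule endpoints_edge[OF G' ab(2)])
    moreover have "endpoints G w = {tail G a, head G a}"
      by (subst ab(4)) (rule endpoints_edge[OF G ab(1)])
    ultimately show ?thesis using y phi_ends[OF ab(1-3)] by auto
  qed
  have \<eta>par: "(\<eta> v, \<eta> w) \<in> parcs (line_graph_complement H)"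
    if vw: "v \<in> W" "w \<in> W" "(v, w) \<in> parcs (line_graph_complement G)" for v w
  proof -
    have d: "v \<noteq> w" "endpoints G v \<inter> endpoints G w = {}" using vw(3) by (auto simp: parcs_lgc)
    have "\<eta> v \<noteq> \<eta> w" using \<eta>p[OF vw(1)] \<eta>p[OF vw(2)] d(1) by metis
    moreover have "endpoints H (\<eta> v) \<inter> endpoints H (\<eta> w) = {}"
    proof (rule equals0I)
      fix y assume y: "y \<in> endpoints H (\<eta> v) \<inter> endpoints H (\<eta> w)"
      obtain x where x: "x \<in> endpoints G v" "\<theta> (Vert x) = Vert y" using \<eta>end[OF vw(1)] y by blast
      obtain z where z: "z \<in> endpoints G w" "\<theta> (Vert z) = Vert y" using \<eta>end[OF vw(2)] y by blast
      have "x = z" using inj_onD[OF inj, of x z] x z vw(1,2) by auto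
      then show False using d(2) x z by blast
    qed
    ultimately show ?thesis using \<eta>E vw by (auto simp: parcs_lgc)
  qed
  define \<rho> :: "('a set \<Rightarrow> complex ^ 'd) \<Rightarrow> 'a set \<Rightarrow> complex ^ 'd" where "\<rho> x = (\<lambda>w\<in>W. x (\<eta> w))" for x
  have fW: "finite W" using W finite_edges[OF G] finite_subset by blast
  have \<rho>: "continuous_map (Conf (line_graph_complement H)) (subtopology (coords W) (arr_compl W F)) \<rho>"
    unfolding continuous_map_in_subtopology
  proof
    have "continuous_map (coords (edges H)) (coords W) \<rho>"
      unfolding continuous_map_componentwise \<rho>_def using \<eta>E by (auto intro!: continuous_map_product_projection)
    then show "continuous_map (Conf (line_graph_complement H)) (coords W) \<rho>"
      unfolding Conf_lgc[OF G'] by (rule continuous_map_from_subtopology)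
    show "\<rho> \<in> topspace (Conf (line_graph_complement H)) \<rightarrow> arr_compl W F"
    proof
      fix x :: "'a set \<Rightarrow> complex ^ 'd" assume "x \<in> topspace (Conf (line_graph_complement H))"
      then have x: "x e \<noteq> x f" if "(e, f) \<in> parcs (line_graph_complement H)" for e f
        using that unfolding topspace_Conf_lgc by blast
      have "lform W f (\<rho> x) \<noteq> 0" if f: "f \<in> F" for f
      proof -
        obtain e1 e2 where e: "f = diff_form e1 e2" "(e1, e2) \<in> parcs (line_graph_complement G)"
          using f F(1) by (auto simp: edge_forms_def)
        have "e1 \<noteq> e2" using e(2) by (simp add: parcs_lgc)
        then have eW: "e1 \<in> W" "e2 \<in> W" using F(2)[OF f] diff_form_support[of e1 e2] unfolding e(1) by auto
        have "lform W f (\<rho> x) = x (\<eta> e1) - x (\<eta> e2)"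
          unfolding e(1) lform_diff_form[OF fW eW] using eW by (simp add: \<rho>_def)
        then show ?thesis using x[OF \<eta>par[OF eW e(2)]] by simp
      qed
      then show "\<rho> x \<in> arr_compl W F" by (simp add: arr_compl_def \<rho>_def)
    qed
  qed
  let ?c = "cclass i (Conf (line_graph_complement H)) (pullback i \<rho> \<zeta>)"
  have "?c \<in> carrier (cohomology_group i (Conf (line_graph_complement H)))"
    using cocycle_pullback[OF \<zeta> \<rho>] by (auto simp: carrier_cohomology_group)
  moreover have "cohomology_map i (Conf (line_graph_complement G)) (conf_restriction G H \<theta>) ?c =
      cclass i (Conf (line_graph_complement G)) (pullback i (\<lambda>x. restrict x W) \<zeta>)"
    unfolding cohomology_map_cclass[OF continuous_conf_restriction]
  proof (rule cclass_cong)
    fix \<sigma> assume s: "singular_simplex i (Conf (line_graph_complement G) :: ('a set \<Rightarrow> complex ^ 'd) topology) \<sigma>"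
    have "pullback i (conf_restriction G H \<theta>) (pullback i \<rho> \<zeta>) \<sigma> = pullback i (\<rho> \<circ> conf_restriction G H \<theta>) \<zeta> \<sigma>"
      by (simp add: pullback_def simplex_map_compose)
    also have "\<dots> = pullback i (\<lambda>x. restrict x W) \<zeta> \<sigma>"
      by (rule pullback_eq[OF s]) (auto simp: \<rho>_def conf_restriction_def \<eta>E \<eta>p)
    finally show "pullback i (conf_restriction G H \<theta>) (pullback i \<rho> \<zeta>) \<sigma> = pullback i (\<lambda>x. restrict x W) \<zeta> \<sigma>" .
  qed
  ultimately show ?thesis by (metis imageI)
qed

theorem theorem1p3:
  fixes i g :: nat
  shows "finitely_generated_graph_op_module g
    (\<lambda>G :: ('v, 'a) mgraph.
       cohomology_group i (Conf (line_graph_complement G) :: ('a set \<Rightarrow> complex ^ 'd) topology))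
    (\<lambda>G G' \<phi>.
       cohomology_map i (Conf (line_graph_complement G) :: ('a set \<Rightarrow> complex ^ 'd) topology)
         (conf_restriction G G' \<phi>))"
proof -
  let ?C = "\<lambda>G :: ('v, 'a) mgraph. Conf (line_graph_complement G) :: ('a set \<Rightarrow> complex ^ 'd) topology"
  have mg: "mgraph G" if "G \<in> graphs_le g" for G :: "('v, 'a) mgraph" using that by (simp add: graphs_le_def)
  have mI: "minor G G' \<phi>" if "G \<in> graphs_le g" "G' \<in> graphs_le g" "minor_morphism G G' \<phi>" for G G' :: "('v, 'a) mgraph" and \<phi>
    using that mg by (simp add: minor_def)
  have module: "graph_op_module g (\<lambda>G. cohomology_group i (?C G)) (\<lambda>G G' \<phi>. cohomology_map i (?C G) (conf_restriction G G' \<phi>))"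
    unfolding graph_op_module_def
  proof (intro conjI ballI allI impI)
    show "comm_group (cohomology_group i (?C G))" for G by (rule comm_group_cohomology_group)
    show "cohomology_map i (?C G) (conf_restriction G G' \<phi>) \<in> hom (cohomology_group i (?C G')) (cohomology_group i (?C G))"
      if "G \<in> graphs_le g" "G' \<in> graphs_le g" "minor_morphism G G' \<phi>" for G G' \<phi>
      by (rule cohomology_map_hom[OF minor.continuous_conf_restriction[OF mI[OF that]]])
    show "cohomology_map i (?C G) (conf_restriction G G (\<lambda>u\<in>elems G. u)) x = x"
      if "G \<in> graphs_le g" "x \<in> carrier (cohomology_group i (?C G))" for G x
    proof (rule cohomology_map_ident[OF _ that(2)])
      fix y assume "y \<in> topspace (?C G)"
      then have "y \<in> extensional (edges G)" unfolding topspace_Conf_lgc by blast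
      then show "conf_restriction G G (\<lambda>u\<in>elems G. u) y = y"
        using edge_pullback_ident[OF mg[OF that(1)]] by (auto simp: conf_restriction_def fun_eq_iff extensional_def)
    qed
    show "cohomology_map i (?C G) (conf_restriction G G'' (compose (elems G) \<psi> \<phi>)) x =
        cohomology_map i (?C G) (conf_restriction G G' \<phi>) (cohomology_map i (?C G') (conf_restriction G' G'' \<psi>) x)"
      if "G \<in> graphs_le g" "G' \<in> graphs_le g" "G'' \<in> graphs_le g" "minor_morphism G G' \<phi>" "minor_morphism G' G'' \<psi>"
        "x \<in> carrier (cohomology_group i (?C G''))" for G G' G'' \<phi> \<psi> x
    proof -
      note m1 = mI[OF that(1,2,4)] and m2 = mI[OF that(2,3,5)]
      show ?thesis
      proof (rule cohomology_map_compose[OF minor.continuous_conf_restriction[OF m1] minor.continuous_conf_restriction[OF m2] _ that(6)])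
        fix y :: "'a set \<Rightarrow> complex ^ 'd"
        show "conf_restriction G G'' (compose (elems G) \<psi> \<phi>) y = conf_restriction G' G'' \<psi> (conf_restriction G G' \<phi> y)"
          using edge_pullback_compose[OF m1 m2] minor.edge_pullback_edges[OF m2]
          by (auto simp: conf_restriction_def fun_eq_iff)
      qed
    qed
  qed
  obtain Gs :: "('v, 'a) mgraph set" where Gs: "finite Gs" "Gs \<subseteq> graphs_le g"
    and contract: "\<And>(G :: ('v, 'a) mgraph) M. G \<in> graphs_le g \<Longrightarrow> M \<subseteq> verts G \<Longrightarrow> card M \<le> 4 * i \<Longrightarrow>
       \<exists>H \<in> Gs. \<exists>\<theta>. minor_morphism G H \<theta> \<and> inj_on (\<lambda>v. \<theta> (Vert v)) M \<and>
          (\<forall>a \<in> arcs G. tail G a \<in> M \<longrightarrow> head G a \<in> M \<longrightarrow> \<theta> (Arr a) \<in> Arr ` arcs H)"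
  proof -
    note r = that
    obtain Gs :: "('v, 'a) mgraph set" where r1: "finite Gs" "Gs \<subseteq> graphs_le g"
      and r2: "\<forall>G \<in> graphs_le g :: ('v, 'a) mgraph set. \<forall>M \<subseteq> verts G. card M \<le> 4 * i \<longrightarrow>
       (\<exists>H \<in> Gs. \<exists>\<theta>. minor_morphism G H \<theta> \<and> inj_on (\<lambda>v. \<theta> (Vert v)) M \<and>
          (\<forall>a \<in> arcs G. tail G a \<in> M \<longrightarrow> head G a \<in> M \<longrightarrow> \<theta> (Arr a) \<in> Arr ` arcs H))"
      by (rule exE[OF marked_contraction[of g "4 * i"]]) (elim conjE, rule that)
    show thesis by (rule r[OF r1]) (rule r2[rule_format])
  qed
  have fg: "finitely_generated_group (cohomology_group i (?C H))" if "H \<in> Gs" for H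
    by (rule generated_finitely_generated[OF generated_Conf[OF mg]]) (use that Gs in blast)
  have span: "carrier (cohomology_group i (?C G)) = generate (cohomology_group i (?C G))
     (\<Union>H\<in>Gs. \<Union>\<phi>\<in>{\<phi>. minor_morphism G H \<phi>}. cohomology_map i (?C G) (conf_restriction G H \<phi>) ` carrier (cohomology_group i (?C H)))"
    (is "_ = generate _ ?B") if G: "G \<in> graphs_le g" for G :: "('v, 'a) mgraph"
  proof
    interpret comm_group "cohomology_group i (?C G)" by (rule comm_group_cohomology_group)
    have "?B \<subseteq> carrier (cohomology_group i (?C G))"
    proof
      fix x assume "x \<in> ?B"
      then obtain H \<phi> y where h: "H \<in> Gs" "minor_morphism G H \<phi>" "y \<in> carrier (cohomology_group i (?C H))"
        "x = cohomology_map i (?C G) (conf_restriction G H \<phi>) y" by blast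
      then have "minor G H \<phi>" using mI G Gs by blast
      from cohomology_map_hom[OF minor.continuous_conf_restriction[OF this], of i]
      show "x \<in> carrier (cohomology_group i (?C G))" using h(3) unfolding h(4) by (rule hom_in_carrier)
    qed
    then show "generate (cohomology_group i (?C G)) ?B \<subseteq> carrier (cohomology_group i (?C G))"
      by (rule generate_incl)
    obtain Z where Z: "carrier (cohomology_group i (?C G)) = generate (cohomology_group i (?C G)) (cclass i (?C G) ` Z)"
      "\<And>z. z \<in> Z \<Longrightarrow> \<exists>Y q \<zeta>. (Y, q) \<in> indep_family (edges G) (edge_forms G) i \<and> continuous_map (?C G) Y q \<and> cocycle i Y \<zeta> \<and> z = pullback i q \<zeta>"
      by (rule generated_generate[OF generated_Conf[OF mg[OF G]]]) (rule that)
    have "cclass i (?C G) ` Z \<subseteq> ?B"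
    proof
      fix x assume "x \<in> cclass i (?C G) ` Z"
      then obtain z where z: "z \<in> Z" "x = cclass i (?C G) z" by blast
      from Z(2)[OF z(1)] obtain Y q \<zeta> where "(Y, q) \<in> indep_family (edges G) (edge_forms G) i \<and> continuous_map (?C G) Y q \<and> cocycle i Y \<zeta> \<and> z = pullback i q \<zeta>"
        by (elim exE) (rule that)
      then have Y: "(Y, q) \<in> indep_family (edges G) (edge_forms G) i" "cocycle i Y \<zeta>" "z = pullback i q \<zeta>"
        by simp_all
      then obtain W F where WF: "Y = subtopology (coords W) (arr_compl W F)" "q = (\<lambda>x. restrict x W)" "F \<subseteq> edge_forms G" "card F \<le> i"
        "W \<subseteq> edges G" "card W \<le> 2 * card F" "\<forall>f\<in>F. \<forall>v. f v \<noteq> 0 \<longrightarrow> v \<in> W"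
        unfolding indep_family_def by blast
      \<comment> \<open>At most \<open>i\<close> forms involve at most \<open>2 * i\<close> edges, which have at most \<open>4 * i\<close> ends.\<close>
      let ?M = "\<Union>e\<in>W. endpoints G e"
      have m: "mgraph G" using mg[OF G] .
      have ends: "endpoints G e \<subseteq> verts G \<and> card (endpoints G e) \<le> 2" if e: "e \<in> W" for e
      proof -
        obtain a where a: "a \<in> arcs G" "e = {a, rev_arc G a}" using e WF(5) by (auto simp: edges_def)
        have "endpoints G e = {tail G a, head G a}"
          using mgraph_rev[OF m] a by (auto simp: endpoints_def)
        then show ?thesis using mgraph_wf[OF m a(1)] by (simp add: card_insert_if)
      qed
      have "finite W" using WF(5) finite_edges[OF m] finite_subset by blast
      then have "card ?M \<le> (\<Sum>e\<in>W. card (endpoints G e))" by (rule card_UN_le)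
      also have "\<dots> \<le> (\<Sum>e\<in>W. 2)" using ends by (intro sum_mono) blast
      also have "\<dots> \<le> 4 * i" using WF(4,6) by simp
      finally have cM: "card ?M \<le> 4 * i" .
      have MG: "?M \<subseteq> verts G" using ends by blast
      from contract[OF G MG cM] obtain H \<theta> where H0: "H \<in> Gs" "minor_morphism G H \<theta> \<and> inj_on (\<lambda>v. \<theta> (Vert v)) ?M \<and>
        (\<forall>a \<in> arcs G. tail G a \<in> ?M \<longrightarrow> head G a \<in> ?M \<longrightarrow> \<theta> (Arr a) \<in> Arr ` arcs H)"
        by (elim bexE exE) (rule that)
      then have H: "H \<in> Gs" "minor_morphism G H \<theta>" "inj_on (\<lambda>v. \<theta> (Vert v)) ?M"
        "\<And>a. a \<in> arcs G \<Longrightarrow> tail G a \<in> ?M \<Longrightarrow> head G a \<in> ?M \<Longrightarrow> \<theta> (Arr a) \<in> Arr ` arcs H"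
        by simp_all
      have "minor G H \<theta>" using mI[OF G _ H(2)] H(1) Gs by blast
      moreover have "\<theta> (Arr a) \<in> Arr ` arcs H" if aW: "a \<in> \<Union>W" for a
      proof -
        obtain e where e: "e \<in> W" "a \<in> e" using aW by blast
        then have "a \<in> arcs G" using WF(5) mgraph_rev(1)[OF m] by (auto simp: edges_def)
        moreover have "tail G a \<in> ?M" "head G a \<in> ?M" using e by (auto simp: endpoints_def)
        ultimately show ?thesis by (rule H(4))
      qed
      ultimately have "x \<in> cohomology_map i (?C G) (conf_restriction G H \<theta>) ` carrier (cohomology_group i (?C H))"
        unfolding z(2) Y(3) WF(2)
        by (intro class_from_small_minor[where F = F and W = W]) (use WF H(3) Y(2) in auto)
      then show "x \<in> ?B" using H(1,2) by blast
    qed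
    then show "carrier (cohomology_group i (?C G)) \<subseteq> generate (cohomology_group i (?C G)) ?B"
      unfolding Z(1) by (rule mono_generate)
  qed
  show ?thesis
    unfolding finitely_generated_graph_op_module_def
    by (intro conjI exI[of _ Gs] ballI) (rule module, rule Gs(1), rule Gs(2), erule fg, erule span)
qed

end
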